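(* For every composition $\eta\in\mathbb{N}^n$ with $\eta\ne0$, $$x^{\underline\eta}=w_\eta\,x^{\underline{\eta^*}}+r\sum_{\gamma\in P[\eta]}x^{\underline\gamma}.$$
   Context: Fix $n\ge1$; $r$ is an indeterminate, $\alpha=1/r$, $\mathbb{F}=\mathbb{Q}(r)$, polynomials lie in $\mathbb{F}[x_1,\dots,x_n]$. Compositions are $\eta\in\mathbb{N}^n$, $|\eta|=\sum\eta_i$, $x^\eta=\prod x_i^{\eta_i}$; partitions are weakly decreasing compositions; $\delta=(n-1,\dots,0)$; permutations act on vectors by $(wv)_{w(i)}=v_i$; $w_\gamma$ is the minimal-length permutation with $w_\gamma^{-1}(\gamma)$ a partition, and $\overline\gamma=\gamma+w_\gamma(r\delta)$. Let $E_\eta^{r\delta}$ be the unique polynomial of degree $|\eta|$ vanishing at all $\overline\gamma$ with $\gamma\ne\eta$, $|\gamma|\le|\eta|$, with coefficient $1$ on $x^\eta$, and $E_\eta^{(\alpha)}$ its top homogeneous component. With $a_\eta(i,j)=\eta_i-j$, $l_\eta(i,j)=\#\{k>i:j\le\eta_k\le\eta_i\}+\#\{k<i:j\le\eta_k+1\le\eta_i\}$, $d_\eta(\alpha)=\prod_{1\le j\le\eta_i}(\alpha(a_\eta(i,j)+1)+l_\eta(i,j)+1)$, put $F_\eta^{(\alpha)}=d_\eta E_\eta^{(\alpha)}$, $F_\eta^{r\delta}(x)=(-1)^{|\eta|}d_\eta E_\eta^{r\delta}(-x)$; $\Xi$ is the unique $\mathbb{F}$-linear operator with $\Xi(F_\eta^{(\alpha)})=F_\eta^{r\delta}$,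 and $x^{\underline\eta}=\Xi(x^\eta)$. For $\eta\ne0$: $m=\max_i\eta_i$, $k=\min\{i:\eta_i=m\}$, $l[\eta]=\#\{i>k:\eta_i=m\}+\#\{i<k:\eta_i=m-1\}$, $w_\eta=x_k+(m-1)+r(n-1-l[\eta])$, and $\eta^*$ is $\eta$ with $\eta_k$ replaced by $m-1$. $P[\eta]$ is the set of compositions $\gamma$ for which there exist $j\ne k$ and an integer $l>0$ with $\gamma_j=\eta_j+l$, $\gamma_k=m-1-l$, $\gamma_i=\eta_i$ for $i\ne j,k$, where $\varepsilon=m-1-\eta_j-l$ satisfies $\varepsilon>0$ if $j<k$ and $\varepsilon\ge0$ if $j>k$, and $\gamma\neq\eta^*$. *)

theory Defs
  imports
    "HOL-Library.Poly_Mapping"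
    "HOL-Library.FuncSet"
    "HOL-Combinatorics.Permutations"
    "HOL-Computational_Algebra.Polynomial"
    "HOL-Computational_Algebra.Fraction_Field"
begin

section \<open>The field of rational functions in one indeterminate\<close>

type_synonym ratfun = "rat poly fract"

definition rr :: ratfun where
  "rr = Fract [:0, 1:] 1"

definition alpha :: ratfun where
  "alpha = 1 / rr"

section \<open>Polynomials in finitely many variables\<close>

text \<open>Monomials are finitely supported exponent functions on the variable indices; a polynomial
  is a finitely supported coefficient function on monomials. The convolution product of
  \<^theory>\<open>HOL-Library.Poly_Mapping\<close> is the product of polynomials. The variables x_1, ..., x_n are
  those with indices in \<open>{1..n}\<close>.\<close>

abbreviation lookup :: "('a \<Rightarrow>\<^sub>0 'b::zero) \<Rightarrow> 'a \<Rightarrow> 'b" where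
  "lookup \<equiv> Poly_Mapping.lookup"

abbreviation keys :: "('a \<Rightarrow>\<^sub>0 'b::zero) \<Rightarrow> 'a set" where
  "keys \<equiv> Poly_Mapping.keys"

type_synonym mpol = "(nat \<Rightarrow>\<^sub>0 nat) \<Rightarrow>\<^sub>0 ratfun"

definition comps :: "nat \<Rightarrow> (nat \<Rightarrow>\<^sub>0 nat) set" where
  "comps n = {\<eta>. keys \<eta> \<subseteq> {1..n}}"

definition csize :: "(nat \<Rightarrow>\<^sub>0 nat) \<Rightarrow> nat" where
  "csize \<eta> = (\<Sum>i\<in>keys \<eta>. lookup \<eta> i)"

definition Pol :: "nat \<Rightarrow> mpol set" where
  "Pol n = {p. keys p \<subseteq> comps n}"

definition Const :: "ratfun \<Rightarrow> mpol" where
  "Const c = Poly_Mapping.single 0 c"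

definition xmon :: "(nat \<Rightarrow>\<^sub>0 nat) \<Rightarrow> mpol" where
  "xmon \<eta> = Poly_Mapping.single \<eta> 1"

definition xvar :: "nat \<Rightarrow> mpol" where
  "xvar i = xmon (Poly_Mapping.single i 1)"

definition total_deg :: "mpol \<Rightarrow> nat" where
  "total_deg p = Max (insert 0 (csize ` keys p))"

definition top_component :: "mpol \<Rightarrow> mpol" where
  "top_component p =
     (\<Sum>m\<in>{m \<in> keys p. csize m = total_deg p}. Poly_Mapping.single m (lookup p m))"

definition peval :: "mpol \<Rightarrow> (nat \<Rightarrow> ratfun) \<Rightarrow> ratfun" where
  "peval p v = (\<Sum>m\<in>keys p. lookup p m * (\<Prod>i\<in>keys m. v i ^ lookup m i))"

definition psubst :: "mpol \<Rightarrow> (nat \<Rightarrow> mpol) \<Rightarrow> mpol" where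
  "psubst p s = (\<Sum>m\<in>keys p. Const (lookup p m) * (\<Prod>i\<in>keys m. s i ^ lookup m i))"

section \<open>The interpolation points\<close>

text \<open>Vectors of length n are functions on \<open>nat\<close>, of which only the entries at \<open>{1..n}\<close> matter.
  The action below is characterised by \<open>act w v (w i) = v i\<close>.\<close>

definition act :: "(nat \<Rightarrow> nat) \<Rightarrow> (nat \<Rightarrow> 'a) \<Rightarrow> nat \<Rightarrow> 'a" where
  "act w v = (\<lambda>i. v (inv w i))"

definition is_partition :: "nat \<Rightarrow> (nat \<Rightarrow> nat) \<Rightarrow> bool" where
  "is_partition n v \<longleftrightarrow> (\<forall>i j. 1 \<le> i \<and> i \<le> j \<and> j \<le> n \<longrightarrow> v j \<le> v i)"

text \<open>The length of a permutation, as its number of inversions.\<close>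

definition perm_length :: "nat \<Rightarrow> (nat \<Rightarrow> nat) \<Rightarrow> nat" where
  "perm_length n w = card {(i, j). 1 \<le> i \<and> i < j \<and> j \<le> n \<and> w j < w i}"

definition sort_perm :: "nat \<Rightarrow> (nat \<Rightarrow>\<^sub>0 nat) \<Rightarrow> nat \<Rightarrow> nat" where
  "sort_perm n \<gamma> =
     (THE w. is_arg_min (perm_length n)
        (\<lambda>w. w permutes {1..n} \<and> is_partition n (act (inv w) (lookup \<gamma>))) w)"

definition cbar :: "nat \<Rightarrow> (nat \<Rightarrow>\<^sub>0 nat) \<Rightarrow> nat \<Rightarrow> ratfun" where
  "cbar n \<gamma> =
     (\<lambda>i. of_nat (lookup \<gamma> i) + act (sort_perm n \<gamma>) (\<lambda>j. rr * of_nat (n - j)) i)"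

section \<open>Interpolation polynomials and their top components\<close>

definition E_inhom :: "nat \<Rightarrow> (nat \<Rightarrow>\<^sub>0 nat) \<Rightarrow> mpol" where
  "E_inhom n \<eta> =
     (THE p. p \<in> Pol n \<and> total_deg p = csize \<eta> \<and>
        (\<forall>\<gamma>\<in>comps n. \<gamma> \<noteq> \<eta> \<and> csize \<gamma> \<le> csize \<eta> \<longrightarrow> peval p (cbar n \<gamma>) = 0) \<and>
        lookup p \<eta> = 1)"

definition E_hom :: "nat \<Rightarrow> (nat \<Rightarrow>\<^sub>0 nat) \<Rightarrow> mpol" where
  "E_hom n \<eta> = top_component (E_inhom n \<eta>)"

definition arm :: "(nat \<Rightarrow>\<^sub>0 nat) \<Rightarrow> nat \<Rightarrow> nat \<Rightarrow> nat" where
  "arm \<eta> i j = lookup \<eta> i - j"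

definition leg :: "nat \<Rightarrow> (nat \<Rightarrow>\<^sub>0 nat) \<Rightarrow> nat \<Rightarrow> nat \<Rightarrow> nat" where
  "leg n \<eta> i j =
     card {k \<in> {1..n}. i < k \<and> j \<le> lookup \<eta> k \<and> lookup \<eta> k \<le> lookup \<eta> i} +
     card {k \<in> {1..n}. k < i \<and> j \<le> lookup \<eta> k + 1 \<and> lookup \<eta> k + 1 \<le> lookup \<eta> i}"

definition dfac :: "nat \<Rightarrow> (nat \<Rightarrow>\<^sub>0 nat) \<Rightarrow> ratfun" where
  "dfac n \<eta> =
     (\<Prod>i=1..n. \<Prod>j=1..lookup \<eta> i.
        alpha * (of_nat (arm \<eta> i j) + 1) + of_nat (leg n \<eta> i j) + 1)"

definition F_hom :: "nat \<Rightarrow> (nat \<Rightarrow>\<^sub>0 nat) \<Rightarrow> mpol" where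
  "F_hom n \<eta> = Const (dfac n \<eta>) * E_hom n \<eta>"

definition F_inhom :: "nat \<Rightarrow> (nat \<Rightarrow>\<^sub>0 nat) \<Rightarrow> mpol" where
  "F_inhom n \<eta> =
     Const ((- 1) ^ csize \<eta> * dfac n \<eta>) * psubst (E_inhom n \<eta>) (\<lambda>i. - xvar i)"

section \<open>The operator Xi and the falling monomials\<close>

text \<open>Since \<open>Pol n\<close> is a proper subset of its type, the extensional function space is what makes
  the operator unique as a HOL function.\<close>

definition linear_op :: "nat \<Rightarrow> (mpol \<Rightarrow> mpol) \<Rightarrow> bool" where
  "linear_op n T \<longleftrightarrow> T \<in> Pol n \<rightarrow>\<^sub>E Pol n \<and>
     (\<forall>p\<in>Pol n. \<forall>q\<in>Pol n. T (p + q) = T p + T q) \<and>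
     (\<forall>c. \<forall>p\<in>Pol n. T (Const c * p) = Const c * T p)"

definition Xi :: "nat \<Rightarrow> mpol \<Rightarrow> mpol" where
  "Xi n = (THE T. linear_op n T \<and> (\<forall>\<eta>\<in>comps n. T (F_hom n \<eta>) = F_inhom n \<eta>))"

definition xfall :: "nat \<Rightarrow> (nat \<Rightarrow>\<^sub>0 nat) \<Rightarrow> mpol" where
  "xfall n \<eta> = Xi n (xmon \<eta>)"

section \<open>Ingredients of the recursion\<close>

definition mpart :: "nat \<Rightarrow> (nat \<Rightarrow>\<^sub>0 nat) \<Rightarrow> nat" where
  "mpart n \<eta> = Max (lookup \<eta> ` {1..n})"

definition kpos :: "nat \<Rightarrow> (nat \<Rightarrow>\<^sub>0 nat) \<Rightarrow> nat" where
  "kpos n \<eta> = Min {i \<in> {1..n}. lookup \<eta> i = mpart n \<eta>}"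

text \<open>The truncated subtractions \<open>mpart n \<eta> - 1\<close> below are only meaningful for \<open>\<eta> \<noteq> 0\<close>, where
  \<open>mpart n \<eta> \<ge> 1\<close>.\<close>

definition lnum :: "nat \<Rightarrow> (nat \<Rightarrow>\<^sub>0 nat) \<Rightarrow> nat" where
  "lnum n \<eta> =
     card {i \<in> {1..n}. kpos n \<eta> < i \<and> lookup \<eta> i = mpart n \<eta>} +
     card {i \<in> {1..n}. i < kpos n \<eta> \<and> lookup \<eta> i = mpart n \<eta> - 1}"

definition wfac :: "nat \<Rightarrow> (nat \<Rightarrow>\<^sub>0 nat) \<Rightarrow> mpol" where
  "wfac n \<eta> = xvar (kpos n \<eta>) +
     Const ((of_nat (mpart n \<eta>) - 1) + rr * (of_nat n - 1 - of_nat (lnum n \<eta>)))"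

definition star :: "nat \<Rightarrow> (nat \<Rightarrow>\<^sub>0 nat) \<Rightarrow> (nat \<Rightarrow>\<^sub>0 nat)" where
  "star n \<eta> = Poly_Mapping.update (kpos n \<eta>) (mpart n \<eta> - 1) \<eta>"

text \<open>The integer equations force \<open>mpart n \<eta> - 1 - l \<ge> 0\<close>.\<close>

definition Pset :: "nat \<Rightarrow> (nat \<Rightarrow>\<^sub>0 nat) \<Rightarrow> (nat \<Rightarrow>\<^sub>0 nat) set" where
  "Pset n \<eta> =
     {\<gamma> \<in> comps n. \<gamma> \<noteq> star n \<eta> \<and>
        (\<exists>j\<in>{1..n}. \<exists>l::int. j \<noteq> kpos n \<eta> \<and> l > 0 \<and>
           int (lookup \<gamma> j) = int (lookup \<eta> j) + l \<and>
           int (lookup \<gamma> (kpos n \<eta>)) = int (mpart n \<eta>) - 1 - l \<and>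
           (\<forall>i\<in>{1..n}. i \<noteq> j \<and> i \<noteq> kpos n \<eta> \<longrightarrow> lookup \<gamma> i = lookup \<eta> i) \<and>
           (let e = int (mpart n \<eta>) - 1 - int (lookup \<eta> j) - l
            in (j < kpos n \<eta> \<longrightarrow> e > 0) \<and> (kpos n \<eta> < j \<longrightarrow> e \<ge> 0)))}"

end

theory Submission
  imports Defs
begin

text \<open>The homogeneous Cherednik operators \<open>\<xi>\<^sub>k\<close> have joint eigenvectors \<open>e\<^sub>\<gamma>\<close>, unitriangular
  over the monomials, whose eigenvalues are the interpolation points \<open>cbar n \<gamma>\<close>; they are generated
  from 1 by the intertwiners \<open>s\<^sub>i + r / (c\<^sub>i\<^sub>+\<^sub>1 - c\<^sub>i)\<close> and \<open>x\<^sub>n \<pi>\<close>. With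
  \<open>p\<^sub>1 = x\<^sub>1 + \<dots> + x\<^sub>n\<close> one has \<open>[\<xi>\<^sub>k, p\<^sub>1] = x\<^sub>k\<close>, so conjugation by \<open>exp p\<^sub>1\<close>
  turns \<open>\<xi>\<^sub>k\<close> into \<open>\<xi>\<^sub>k - x\<^sub>k\<close>, and for a polynomial \<open>p\<close>
  \<open>p(\<xi> - x) 1 = exp p\<^sub>1 \<cdot> p(\<xi>) exp (- p\<^sub>1)\<close>.
  Expanding \<open>exp (- p\<^sub>1)\<close> in the \<open>e\<^sub>\<gamma>\<close>, the right-hand side sees only the values of \<open>p\<close> at the
  interpolation points, and the vanishing conditions say exactly that \<open>p(\<xi> - x) 1\<close> is a multiple
  of \<open>e\<^sub>\<eta>\<close> if \<open>p\<close> is the interpolation polynomial of \<open>\<eta>\<close>. Hence \<open>\<Xi>\<close> is the inverse of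
  \<open>p(x) \<mapsto> p(x - \<xi>) 1\<close>, so that \<open>\<Xi> (x\<^sub>k g) = x\<^sub>k \<Xi> g + \<Xi> (\<xi>\<^sub>k g)\<close>, and the recursion is the
  expansion of \<open>\<xi>\<^sub>k x\<^sup>\<mu>\<close> in monomials for \<open>\<mu> = star n \<eta>\<close>.\<close>

section \<open>Polynomials\<close>

text \<open>Both \<open>E_inhom\<close> and \<open>Xi\<close> are definite descriptions, so most of
  the work lies in existence and uniqueness, and one bijection supplies both. The exponential is a
  power series and is never formed: the coordinate along the eigenvector of index \<gamma> vanishes
  in every degree except |\<gamma>|, so against a monomial m only the term of degree |\<gamma>| -
  |m| survives. The resulting functionals \<open>left_eigen n \<gamma>\<close> stand in for the
  operators: applying the k-th twisted operator multiplies them by the number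
  \<open>spec n \<gamma> k\<close>, so a polynomial in the operators acts through its value at one
  point. They are triangular for the grading and therefore separate polynomials degree by degree.

  Genericity of r enters through an order on the rational functions in which r exceeds every natural
  number. It makes distinct compositions have distinct spectra and keeps the intertwiners and the
  factors d_\<eta> from vanishing.

  All terms of the final sum carry a plus sign because k is the first position of the maximum: the
  branch with negative terms in the expansion of the Cherednik operator is then empty.\<close>

lemma lookup_Const_mult [simp]: "lookup (Const c * p) m = c * lookup p m"
  unfolding Const_def mult_map_scale_conv_mult [symmetric]
  by (simp add: Poly_Mapping.map.rep_eq when_def)

lemma lookup_Const: "lookup (Const c) m = (if m = 0 then c else 0)"
  by (simp add: Const_def lookup_single when_def)

lemma lookup_xmon: "lookup (xmon a) m = (if m = a then 1 else 0)"
  by (simp add: xmon_def lookup_single when_def)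

lemma Const_add: "Const (a + b) = Const a + Const b"
  by (simp add: Const_def single_add)

lemma Const_mult: "Const (a * b) = Const a * Const b"
  by (simp add: Const_def mult_single)

lemma Const_0 [simp]: "Const 0 = 0"
  by (simp add: Const_def)

lemma Const_1 [simp]: "Const 1 = 1"
  by (simp add: Const_def)

lemma Const_uminus: "Const (- a) = - Const a"
  by (simp add: Const_def single_uminus)

lemma Const_diff: "Const (a - b) = Const a - Const b"
  by (simp add: Const_def single_diff)

lemma Const_eq_0_iff [simp]: "Const c = 0 \<longleftrightarrow> c = 0"
  by (metis Const_0 Const_def lookup_single_eq lookup_zero)

lemma Const_of_nat: "Const (of_nat a) = of_nat a"
  by (simp add: Const_def)

lemma xmon_0 [simp]: "xmon 0 = 1"
  by (simp add: xmon_def)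

lemma xmon_add: "xmon (a + b) = xmon a * xmon b"
  by (simp add: xmon_def mult_single)

lemma xvar_mult_xmon: "xvar i * xmon m = xmon (Poly_Mapping.single i 1 + m)"
  by (simp add: xvar_def xmon_add)

lemma single_eq_Const_xmon: "Poly_Mapping.single m c = Const c * xmon m"
  by (simp add: Const_def xmon_def mult_single)

lemma xmon_expand:
  assumes "finite A" "keys p \<subseteq> A"
  shows "p = (\<Sum>m\<in>A. Const (lookup p m) * xmon m)"
proof (rule poly_mapping_eqI)
  fix k
  have "lookup (\<Sum>m\<in>A. Const (lookup p m) * xmon m) k
      = (\<Sum>m\<in>A. if m = k then lookup p k else 0)"
    by (auto simp: lookup_sum lookup_xmon intro!: sum.cong)
  also have "\<dots> = lookup p k"
    using assms by (auto simp: sum.delta' in_keys_iff)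
  finally show "lookup p k = lookup (\<Sum>m\<in>A. Const (lookup p m) * xmon m) k" by simp
qed

lemma csize_superset:
  assumes "finite A" "keys m \<subseteq> A"
  shows "csize m = (\<Sum>i\<in>A. lookup m i)"
  unfolding csize_def using assms by (intro sum.mono_neutral_left) (auto simp: in_keys_iff)

lemma csize_add [simp]: "csize (a + b) = csize a + csize b"
  using keys_add[of a b]
  by (simp add: csize_superset[of "keys a \<union> keys b"] lookup_add sum.distrib)

lemma csize_0 [simp]: "csize 0 = 0"
  by (simp add: csize_def)

lemma csize_single [simp]: "csize (Poly_Mapping.single i a) = a"
  by (simp add: csize_def)

lemma csize_eq_0_iff: "csize m = 0 \<longleftrightarrow> m = 0"
  by (auto simp: csize_def in_keys_iff intro: poly_mapping_eqI)

lemma keys_add_nat: "keys (a + b) = keys a \<union> keys (b :: nat \<Rightarrow>\<^sub>0 nat)"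
  by (auto simp: in_keys_iff lookup_add)

lemma nonzero_exponent_split:
  fixes m :: "nat \<Rightarrow>\<^sub>0 nat"
  assumes "i \<in> keys m"
  obtains m' where "m = Poly_Mapping.single i 1 + m'" "csize m = Suc (csize m')"
    "keys m' \<subseteq> keys m"
proof -
  have eq: "m = Poly_Mapping.single i 1 + (m - Poly_Mapping.single i 1)"
    using assms by (intro poly_mapping_eqI) (auto simp: lookup_add lookup_minus lookup_single when_def in_keys_iff)
  show ?thesis
  proof (rule that[OF eq])
    show "csize m = Suc (csize (m - Poly_Mapping.single i 1))"
      by (subst eq) simp
    show "keys (m - Poly_Mapping.single i 1) \<subseteq> keys m"
      by (auto simp: in_keys_iff lookup_minus)
  qed
qed

lemma keys_xmon [simp]: "keys (xmon m) = {m}"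
  by (simp add: xmon_def)

lemma keys_Const_mult: "keys (Const c * p) \<subseteq> keys p"
  by (auto simp: in_keys_iff)

lemma keys_Const_mult_xmon: "keys (Const c * xmon m) \<subseteq> {m}"
  using keys_Const_mult[of c "xmon m"] by simp

text \<open>Supports never leave \<open>keys p\<close> during the induction, so a support condition
  on \<open>p\<close>, such as membership in \<open>polys_in I\<close>, stays usable in the monomial
  case and for both summands.\<close>

lemma mpol_induct [case_names zero monomial add]:
  assumes "P 0"
    and "\<And>m c. m \<in> keys p \<Longrightarrow> P (Const c * xmon m)"
    and "\<And>f g. keys f \<subseteq> keys p \<Longrightarrow> keys g \<subseteq> keys p \<Longrightarrow> P f \<Longrightarrow> P g \<Longrightarrow> P (f + g)"
  shows "P p"
proof -
  have "P (\<Sum>m\<in>A. Const (lookup p m) * xmon m)" if "finite A" "A \<subseteq> keys p" for A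
    using that
  proof (induction A rule: finite_induct)
    case (insert x F)
    have "keys (\<Sum>m\<in>F. Const (lookup p m) * xmon m) \<subseteq> (\<Union>m\<in>F. keys (Const (lookup p m) * xmon m))"
      by (rule keys_sum)
    also have "\<dots> \<subseteq> F"
      using keys_Const_mult_xmon by blast
    finally have "keys (\<Sum>m\<in>F. Const (lookup p m) * xmon m) \<subseteq> keys p"
      using insert by blast
    moreover have "keys (Const (lookup p x) * xmon x) \<subseteq> keys p"
      using insert keys_Const_mult_xmon[of "lookup p x" x] by blast
    ultimately show ?case using insert assms by simp
  qed (simp add: assms(1))
  then have "P (\<Sum>m\<in>keys p. Const (lookup p m) * xmon m)" by simp
  then show ?thesis by (simp add: xmon_expand[of "keys p" p, symmetric])
qed

text \<open>Arbitrary index sets generalise \<open>Pol n\<close>: with \<open>UNIV\<close> the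
  induction rule below applies to every polynomial, and the complement of two indices expresses that
  a transposition fixes a polynomial.\<close>

definition polys_in :: "nat set \<Rightarrow> mpol set" where
  "polys_in I = {p. \<forall>m\<in>keys p. keys m \<subseteq> I}"

lemma Pol_eq_polys_in: "Pol n = polys_in {1..n}"
  by (auto simp: Pol_def polys_in_def comps_def)

lemma polys_in_UNIV [simp]: "p \<in> polys_in UNIV"
  by (simp add: polys_in_def)

lemma polys_in_0 [simp]: "0 \<in> polys_in I"
  by (simp add: polys_in_def)

lemma polys_in_Const [simp]: "Const c \<in> polys_in I"
  by (auto simp: polys_in_def in_keys_iff lookup_Const split: if_splits)

lemma polys_in_add: "p \<in> polys_in I \<Longrightarrow> q \<in> polys_in I \<Longrightarrow> p + q \<in> polys_in I"
  using keys_add[of p q] unfolding polys_in_def by blast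

lemma polys_in_mult:
  assumes "p \<in> polys_in I" "q \<in> polys_in I"
  shows "p * q \<in> polys_in I"
  using keys_mult[of p q] assms unfolding polys_in_def by (fastforce simp: keys_add_nat)

lemma polys_in_xvar: "i \<in> I \<Longrightarrow> xvar i \<in> polys_in I"
  by (auto simp: polys_in_def xvar_def in_keys_iff lookup_xmon lookup_single when_def split: if_splits)

lemma polys_in_xmon: "keys m \<subseteq> I \<Longrightarrow> xmon m \<in> polys_in I"
  by (auto simp: polys_in_def in_keys_iff lookup_xmon split: if_splits)

lemma polys_in_diff: "p \<in> polys_in I \<Longrightarrow> q \<in> polys_in I \<Longrightarrow> p - q \<in> polys_in I"
  using keys_diff[of p q] unfolding polys_in_def by blast

lemma polys_in_sum: "(\<And>x. x \<in> A \<Longrightarrow> f x \<in> polys_in I) \<Longrightarrow> sum f A \<in> polys_in I"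
  by (induction A rule: infinite_finite_induct) (auto intro: polys_in_add)

text \<open>Peels off one variable at a time, so that an operator identity reduces to its behaviour
  under multiplication by a variable.\<close>

lemma polys_in_induct [consumes 1, case_names Const xvar add]:
  assumes p: "p \<in> polys_in I"
    and Const: "\<And>c. P (Const c)"
    and xvar: "\<And>i f. i \<in> I \<Longrightarrow> f \<in> polys_in I \<Longrightarrow> P f \<Longrightarrow> P (xvar i * f)"
    and add: "\<And>f g. f \<in> polys_in I \<Longrightarrow> g \<in> polys_in I \<Longrightarrow> P f \<Longrightarrow> P g \<Longrightarrow> P (f + g)"
  shows "P p"
proof (induction rule: mpol_induct[of P p])
  case zero
  show ?case using Const[of 0] by simp
next
  case (monomial m c)
  then have "keys m \<subseteq> I" using p by (auto simp: polys_in_def)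
  then show ?case
  proof (induction "csize m" arbitrary: m)
    case 0
    then show ?case using Const[of c] by (simp add: csize_eq_0_iff)
  next
    case (Suc d)
    then obtain i where i: "i \<in> keys m"
      by (metis csize_def nat.distinct(1) sum.empty equals0I)
    from i obtain m' where m': "m = Poly_Mapping.single i 1 + m'" "csize m = Suc (csize m')"
      "keys m' \<subseteq> keys m" by (rule nonzero_exponent_split)
    have "P (xvar i * (Const c * xmon m'))"
      using Suc i m' by (intro xvar polys_in_mult polys_in_xmon polys_in_Const) auto
    then show ?case
      by (simp add: m'(1) xmon_add xvar_def algebra_simps)
  qed
next
  case (add f g)
  then show ?case using p by (intro assms(4)) (auto simp: polys_in_def)
qed

section \<open>Substitution and evaluation\<close>

text \<open>Common form of \<open>peval\<close> (with \<open>h = id\<close>) and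
  \<open>psubst\<close> (with \<open>h = Const\<close>), so that the homomorphism laws are proved
  once.\<close>

definition subst :: "(ratfun \<Rightarrow> 'b::comm_ring_1) \<Rightarrow> (nat \<Rightarrow> 'b) \<Rightarrow> mpol \<Rightarrow> 'b" where
  "subst h s p = (\<Sum>m\<in>keys p. h (lookup p m) * (\<Prod>i\<in>keys m. s i ^ lookup m i))"

lemma peval_eq_subst: "peval p v = subst id v p"
  by (simp add: peval_def subst_def)

lemma psubst_eq_subst: "psubst p s = subst Const s p"
  by (simp add: psubst_def subst_def)

locale coeff_hom =
  fixes h :: "ratfun \<Rightarrow> 'b::comm_ring_1"
  assumes h_add: "h (a + b) = h a + h b"
    and h_mult: "h (a * b) = h a * h b"
    and h_1 [simp]: "h 1 = 1"
begin

lemma h_0 [simp]: "h 0 = 0"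
  using h_add[of 0 0] by simp

lemma subst_add: "subst h s (p + q) = subst h s p + subst h s q"
  unfolding subst_def by (rule setsum_keys_plus_distrib) (auto simp: h_add algebra_simps)

lemma subst_Const [simp]: "subst h s (Const c) = h c"
  by (cases "c = 0") (auto simp: subst_def Const_def)

lemma subst_xvar_mult: "subst h s (xvar i * p) = s i * subst h s p"
proof (induction p rule: mpol_induct)
  case zero
  then show ?case by (simp add: subst_def)
next
  case (monomial m c)
  have e: "(\<Prod>j\<in>keys (Poly_Mapping.single i 1 + m). s j ^ lookup (Poly_Mapping.single i 1 + m) j)
      = s i * (\<Prod>j\<in>keys m. s j ^ lookup m j)"
  proof -
    let ?A = "insert i (keys m)"
    have "(\<Prod>j\<in>keys (Poly_Mapping.single i 1 + m). s j ^ lookup (Poly_Mapping.single i 1 + m) j)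
      = (\<Prod>j\<in>?A. s j ^ (lookup (Poly_Mapping.single i 1) j) * s j ^ lookup m j)"
      by (simp add: keys_add_nat lookup_add power_add)
    also have "\<dots> = (\<Prod>j\<in>?A. s j ^ (lookup (Poly_Mapping.single i 1) j)) * (\<Prod>j\<in>?A. s j ^ lookup m j)"
      by (rule prod.distrib)
    also have "(\<Prod>j\<in>?A. s j ^ (lookup (Poly_Mapping.single i 1) j)) = (\<Prod>j\<in>?A. if j = i then s j else 1)"
      by (rule prod.cong) (auto simp: lookup_single when_def)
    also have "\<dots> = s i"
      by (simp add: prod.delta)
    also have "(\<Prod>j\<in>?A. s j ^ lookup m j) = (\<Prod>j\<in>keys m. s j ^ lookup m j)"
      by (rule prod.mono_neutral_right) (auto simp: in_keys_iff)
    finally show ?thesis .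
  qed
  have "xvar i * (Const c * xmon m) = Poly_Mapping.single (Poly_Mapping.single i 1 + m) c"
    by (simp add: single_eq_Const_xmon xmon_add xvar_def)
  then show ?case
    using e by (cases "c = 0") (simp_all add: subst_def single_eq_Const_xmon [symmetric])
next
  case (add f g)
  then show ?case by (simp add: distrib_left subst_add)
qed

lemma subst_xvar [simp]: "subst h s (xvar i) = s i"
  using subst_xvar_mult[of s i "Const 1"] by (simp del: Const_1) simp

lemma subst_0 [simp]: "subst h s 0 = 0"
  using subst_Const[of s 0] by simp

lemma subst_1 [simp]: "subst h s 1 = 1"
  using subst_Const[of s 1] by simp

lemma subst_Const_mult: "subst h s (Const c * p) = h c * subst h s p"
proof -
  have "p \<in> polys_in UNIV" by simp
  then show ?thesis
  proof (induction rule: polys_in_induct)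
    case (Const d)
    then show ?case by (simp add: Const_mult [symmetric] h_mult)
  next
    case (xvar i f)
    have e: "Const c * (xvar i * f) = xvar i * (Const c * f)" by (simp add: algebra_simps)
    show ?case unfolding e subst_xvar_mult xvar.IH by (simp add: mult.left_commute)
  next
    case (add f g)
    then show ?case by (simp add: distrib_left subst_add)
  qed
qed

lemma subst_mult: "subst h s (p * q) = subst h s p * subst h s q"
proof -
  have "p \<in> polys_in UNIV" by simp
  then show ?thesis
    by (induction rule: polys_in_induct)
      (simp_all add: subst_Const_mult subst_xvar_mult subst_add distrib_right mult.assoc)
qed

lemma subst_uminus: "subst h s (- p) = - subst h s p"
  using subst_add[of s p "- p"] by (simp add: eq_neg_iff_add_eq_0 add.commute)

lemma subst_diff: "subst h s (p - q) = subst h s p - subst h s q"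
  using subst_add[of s p "- q"] by (simp add: subst_uminus)

lemma subst_sum: "subst h s (sum f A) = (\<Sum>x\<in>A. subst h s (f x))"
  by (induction A rule: infinite_finite_induct) (simp_all add: subst_add)

end

interpretation peval: coeff_hom id
  by (rule coeff_hom.intro) simp_all

interpretation psubst: coeff_hom Const
  by (rule coeff_hom.intro) (simp_all add: Const_add Const_mult)

section \<open>Cherednik operators\<close>

definition vperm :: "(nat \<Rightarrow> nat) \<Rightarrow> mpol \<Rightarrow> mpol" where
  "vperm w p = psubst p (\<lambda>i. xvar (w i))"

lemma vperm_add [simp]: "vperm w (p + q) = vperm w p + vperm w q"
  and vperm_diff [simp]: "vperm w (p - q) = vperm w p - vperm w q"
  and vperm_mult [simp]: "vperm w (p * q) = vperm w p * vperm w q"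
  and vperm_Const [simp]: "vperm w (Const c) = Const c"
  and vperm_xvar [simp]: "vperm w (xvar i) = xvar (w i)"
  and vperm_0 [simp]: "vperm w 0 = 0"
  and vperm_1 [simp]: "vperm w 1 = 1"
  and vperm_sum: "vperm w (sum g A) = (\<Sum>x\<in>A. vperm w (g x))"
  by (simp_all add: vperm_def psubst_eq_subst psubst.subst_add psubst.subst_diff
      psubst.subst_mult psubst.subst_sum)

lemma vperm_vperm: "vperm w (vperm v p) = vperm (w \<circ> v) p"
proof -
  have "p \<in> polys_in UNIV" by simp
  then show ?thesis by (induction rule: polys_in_induct) simp_all
qed

lemma vperm_fixed:
  assumes "p \<in> polys_in I" "\<And>i. i \<in> I \<Longrightarrow> w i = i"
  shows "vperm w p = p"
  using assms(1) by (induction rule: polys_in_induct) (simp_all add: assms(2))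

lemma vperm_id: "vperm id p = p"
  by (rule vperm_fixed[of _ UNIV]) simp_all

lemma vperm_polys_in:
  assumes "p \<in> polys_in I" "w ` I \<subseteq> J"
  shows "vperm w p \<in> polys_in J"
  using assms(1)
proof (induction rule: polys_in_induct)
  case (xvar i f)
  then show ?case using assms(2) by (auto intro!: polys_in_mult polys_in_xvar)
qed (auto intro: polys_in_add)

lemma vperm_eq_0_iff:
  assumes "bij w"
  shows "vperm w p = 0 \<longleftrightarrow> p = 0"
proof
  assume "vperm w p = 0"
  then have "vperm (inv w) (vperm w p) = 0" by simp
  then show "p = 0"
    using assms by (simp add: vperm_vperm bij_is_inj vperm_id)
qed simp

lemma vperm_xmon: "\<exists>m'. vperm w (xmon m) = xmon m' \<and> csize m' = csize m"
proof (induction "csize m" arbitrary: m)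
  case 0
  then show ?case by (intro exI[of _ 0]) (simp add: csize_eq_0_iff)
next
  case (Suc d)
  then obtain i where i: "i \<in> keys m"
    by (metis csize_def nat.distinct(1) sum.empty equals0I)
  from i obtain m1 where m1: "m = Poly_Mapping.single i 1 + m1" "csize m = Suc (csize m1)"
    by (rule nonzero_exponent_split)
  with Suc obtain m' where "vperm w (xmon m1) = xmon m'" "csize m' = csize m1" by auto
  with m1 show ?case
    by (intro exI[of _ "Poly_Mapping.single (w i) 1 + m'"]) (simp add: xvar_mult_xmon [symmetric] del: One_nat_def)
qed

section \<open>Transpositions and divided differences\<close>

abbreviation sw :: "nat \<Rightarrow> nat \<Rightarrow> mpol \<Rightarrow> mpol" where
  "sw k j \<equiv> vperm (transpose k j)"

lemma sw_sw [simp]: "sw k j (sw k j f) = f"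
  by (simp add: vperm_vperm vperm_id)

lemma xvar_eq_iff: "xvar i = xvar j \<longleftrightarrow> i = j"
proof
  assume "xvar i = xvar j"
  then have "Poly_Mapping.single i (1::nat) = Poly_Mapping.single j 1"
    by (metis keys_xmon singleton_inject xvar_def)
  then have "lookup (Poly_Mapping.single i (1::nat)) i = lookup (Poly_Mapping.single j 1) i" by simp
  then show "i = j" by (simp add: lookup_single when_def split: if_splits)
qed simp

lemma xvar_nonzero: "xvar i \<noteq> 0"
  by (metis keys_xmon keys_zero insert_not_empty xvar_def)

text \<open>Divisibility propagates through products with a variable by the twisted Leibniz rule for
  divided differences. The quotient stays in \<open>polys_in I\<close>, which later keeps the
  Cherednik operators inside \<open>Pol n\<close>.\<close>

lemma divided_difference_exists:
  assumes "f \<in> polys_in I" "k \<in> I" "j \<in> I"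
  shows "\<exists>g\<in>polys_in I. (xvar k - xvar j) * g = f - sw k j f"
  using assms(1)
proof (induction rule: polys_in_induct)
  case (Const c)
  then show ?case by (intro bexI[of _ 0]) simp_all
next
  case (xvar i f)
  then obtain g where g: "g \<in> polys_in I" "(xvar k - xvar j) * g = f - sw k j f" by auto
  have swf: "sw k j f \<in> polys_in I"
    using xvar(2) assms by (intro vperm_polys_in[of _ I]) (auto simp: transpose_def)
  \<comment> \<open>This is the divided difference of \<open>xvar i\<close> itself; the witness
    below is the Leibniz expression built from it and \<open>g\<close>.\<close>
  define c :: mpol where "c = (if i = k then 1 else if i = j then -1 else 0)"
  have "(xvar k - xvar j) * c = xvar i - xvar (transpose k j i)"
    by (auto simp: c_def transpose_def)
  moreover have "(xvar k - xvar j) * (xvar i * g + c * sw k j f)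
      = xvar i * ((xvar k - xvar j) * g) + ((xvar k - xvar j) * c) * sw k j f"
    by (simp add: algebra_simps)
  ultimately have "(xvar k - xvar j) * (xvar i * g + c * sw k j f)
      = xvar i * ((xvar k - xvar j) * g) + (xvar i - xvar (transpose k j i)) * sw k j f"
    by simp
  also have "\<dots> = xvar i * f - sw k j (xvar i * f)"
    by (simp add: g(2)) (simp add: algebra_simps)
  finally have "(xvar k - xvar j) * (xvar i * g + c * sw k j f) = xvar i * f - sw k j (xvar i * f)" .
  moreover have "c = Const (if i = k then 1 else if i = j then -1 else 0)"
    by (simp add: c_def Const_uminus)
  then have "xvar i * g + c * sw k j f \<in> polys_in I"
    using xvar(1) g swf by (auto intro!: polys_in_add polys_in_mult polys_in_xvar polys_in_Const)
  ultimately show ?case by blast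
next
  case (add f g)
  then obtain f' g' where *: "f' \<in> polys_in I" "g' \<in> polys_in I"
    "(xvar k - xvar j) * f' = f - sw k j f" "(xvar k - xvar j) * g' = g - sw k j g" by blast
  have "(xvar k - xvar j) * (f' + g') = f + g - sw k j (f + g)"
    unfolding distrib_left *(3,4) vperm_add by (rule add_diff_add [symmetric])
  then show ?case using polys_in_add[OF *(1,2)] by blast
qed

text \<open>Exact division in the polynomial ring. For \<open>k = j\<close> both sides of the
  defining equation are 0, so the chosen value is arbitrary.\<close>

definition divided_diff :: "nat \<Rightarrow> nat \<Rightarrow> mpol \<Rightarrow> mpol" where
  "divided_diff k j f = (SOME g. (xvar k - xvar j) * g = f - sw k j f)"

lemma divided_diff_mult: "(xvar k - xvar j) * divided_diff k j f = f - sw k j f"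
  unfolding divided_diff_def
  by (rule someI_ex) (use divided_difference_exists[OF polys_in_UNIV UNIV_I UNIV_I, of k j f] in blast)

text \<open>Polynomials form an integral domain, so \<open>xvar k - xvar j\<close> can be cancelled.
  Most rules below are obtained by multiplying the claimed value by this factor.\<close>

lemma divided_diff_unique:
  assumes "k \<noteq> j" "(xvar k - xvar j) * g = f - sw k j f"
  shows "divided_diff k j f = g"
proof -
  have "(xvar k - xvar j) * divided_diff k j f = (xvar k - xvar j) * g"
    using assms(2) by (simp add: divided_diff_mult)
  moreover have "xvar k - xvar j \<noteq> 0"
    using assms(1) by (simp add: xvar_eq_iff)
  ultimately show ?thesis using mult_left_cancel by blast
qed

lemma divided_diff_polys_in:
  assumes "f \<in> polys_in I" "k \<in> I" "j \<in> I" "k \<noteq> j"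
  shows "divided_diff k j f \<in> polys_in I"
  using divided_difference_exists[OF assms(1-3)] divided_diff_unique[OF assms(4)] by metis

lemma divided_diff_add: "k \<noteq> j \<Longrightarrow> divided_diff k j (f + g) = divided_diff k j f + divided_diff k j g"
  by (rule divided_diff_unique) (simp_all add: divided_diff_mult distrib_left)

lemma divided_diff_mult_symmetric:
  assumes "k \<noteq> j" "sw k j q = q"
  shows "divided_diff k j (q * f) = q * divided_diff k j f"
proof (rule divided_diff_unique[OF assms(1)])
  have "(xvar k - xvar j) * (q * divided_diff k j f) = q * ((xvar k - xvar j) * divided_diff k j f)"
    by (simp only: mult.left_commute)
  then show "(xvar k - xvar j) * (q * divided_diff k j f) = q * f - sw k j (q * f)"
    by (simp add: divided_diff_mult assms right_diff_distrib)
qed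

text \<open>Twisted Leibniz rule: the divided difference of \<open>xvar k\<close> is 1, while that
  of \<open>xvar j\<close> is -1, which gives the companion rule.\<close>

lemma divided_diff_xvar_left:
  assumes "k \<noteq> j"
  shows "divided_diff k j (xvar k * f) = xvar k * divided_diff k j f + sw k j f"
proof (rule divided_diff_unique[OF assms])
  have "(xvar k - xvar j) * (xvar k * divided_diff k j f + sw k j f)
      = xvar k * ((xvar k - xvar j) * divided_diff k j f) + (xvar k - xvar j) * sw k j f"
    by (simp only: mult.left_commute distrib_left)
  also have "\<dots> = xvar k * f - sw k j (xvar k * f)"
    by (simp add: divided_diff_mult) (simp add: algebra_simps)
  finally show "(xvar k - xvar j) * (xvar k * divided_diff k j f + sw k j f) = xvar k * f - sw k j (xvar k * f)" .
qed

lemma divided_diff_xvar_right: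
  assumes "k \<noteq> j"
  shows "divided_diff k j (xvar j * f) = xvar j * divided_diff k j f - sw k j f"
proof (rule divided_diff_unique[OF assms])
  have "(xvar k - xvar j) * (xvar j * divided_diff k j f - sw k j f)
      = xvar j * ((xvar k - xvar j) * divided_diff k j f) - (xvar k - xvar j) * sw k j f"
    by (simp only: mult.left_commute right_diff_distrib)
  also have "\<dots> = xvar j * f - sw k j (xvar j * f)"
    by (simp add: divided_diff_mult) (simp add: algebra_simps)
  finally show "(xvar k - xvar j) * (xvar j * divided_diff k j f - sw k j f) = xvar j * f - sw k j (xvar j * f)" .
qed

lemma vperm_sw:
  assumes "inj w"
  shows "vperm w (sw k j f) = sw (w k) (w j) (vperm w f)"
proof -
  have "w \<circ> transpose k j = transpose (w k) (w j) \<circ> w"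
    using assms by (auto simp: fun_eq_iff transpose_def inj_eq)
  then show ?thesis by (simp add: vperm_vperm)
qed

lemma vperm_divided_diff:
  assumes "inj w" "k \<noteq> j"
  shows "vperm w (divided_diff k j f) = divided_diff (w k) (w j) (vperm w f)"
proof (rule divided_diff_unique[symmetric])
  show "w k \<noteq> w j" using assms by (simp add: inj_eq)
  have "vperm w ((xvar k - xvar j) * divided_diff k j f) = vperm w (f - sw k j f)"
    by (simp only: divided_diff_mult)
  then show "(xvar (w k) - xvar (w j)) * vperm w (divided_diff k j f) = vperm w f - sw (w k) (w j) (vperm w f)"
    by (simp add: vperm_sw[OF assms(1)])
qed

text \<open>The Euler operator x_k d/dx_k, given on coefficients because it scales each monomial by
  its exponent at \<open>k\<close>.\<close>

definition theta :: "nat \<Rightarrow> mpol \<Rightarrow> mpol" where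
  "theta k p = Poly_Mapping.mapp (\<lambda>m c. of_nat (lookup m k) * c) p"

lemma lookup_theta: "lookup (theta k p) m = of_nat (lookup m k) * lookup p m"
  by (auto simp: theta_def lookup_mapp when_def in_keys_iff)

lemma theta_add: "theta k (p + q) = theta k p + theta k q"
  by (rule poly_mapping_eqI) (simp add: lookup_theta lookup_add algebra_simps)

lemma theta_Const_mult: "theta k (Const c * p) = Const c * theta k p"
  by (rule poly_mapping_eqI) (simp add: lookup_theta)

lemma theta_Const [simp]: "theta k (Const c) = 0"
  by (rule poly_mapping_eqI) (simp add: lookup_theta lookup_Const)

lemma theta_xmon: "theta k (xmon m) = Const (of_nat (lookup m k)) * xmon m"
  by (rule poly_mapping_eqI) (simp add: lookup_theta lookup_xmon)

lemma theta_polys_in: "f \<in> polys_in I \<Longrightarrow> theta k f \<in> polys_in I"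
  by (auto simp: polys_in_def in_keys_iff lookup_theta)

lemma theta_xvar_mult: "theta k (xvar i * f) = xvar i * theta k f + (if i = k then xvar k * f else 0)"
proof (induction f rule: mpol_induct)
  case zero
  then show ?case using theta_Const[of k 0] by simp
next
  case (monomial m c)
  let ?A = "xmon (Poly_Mapping.single i 1 + m)"
  have 1: "xvar i * (Const c * xmon m) = Const c * ?A"
    by (simp only: xvar_mult_xmon mult.left_commute[of "xvar i"])
  have 2: "xvar i * theta k (Const c * xmon m) = Const c * (Const (of_nat (lookup m k)) * ?A)"
    by (simp only: theta_Const_mult theta_xmon xvar_mult_xmon mult.left_commute[of "xvar i"])
  have 3: "theta k (Const c * ?A)
      = Const c * ((Const (of_nat (lookup m k)) + (if i = k then 1 else 0)) * ?A)"
    by (simp add: theta_Const_mult theta_xmon lookup_add lookup_single when_def Const_add add.commute)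
  show ?case
    unfolding 1 2 3 by (cases "i = k")
      (simp_all add: distrib_left distrib_right xvar_mult_xmon [symmetric] mult.left_commute del: One_nat_def)
next
  case (add f g)
  then show ?case by (simp add: distrib_left theta_add)
qed

lemma vperm_theta:
  assumes "inj w"
  shows "vperm w (theta k f) = theta (w k) (vperm w f)"
proof -
  have "f \<in> polys_in UNIV" by simp
  then show ?thesis
    by (induction rule: polys_in_induct) (simp_all add: theta_xvar_mult theta_add inj_eq[OF assms])
qed

text \<open>\<open>var_dunkl n k\<close> is \<open>xvar k\<close> times the \<open>k\<close>-th Dunkl operator.\<close>

definition var_dunkl :: "nat \<Rightarrow> nat \<Rightarrow> mpol \<Rightarrow> mpol" where
  "var_dunkl n k f = theta k f + Const rr * (\<Sum>j\<in>{1..n} - {k}. xvar k * divided_diff k j f)"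

text \<open>The transpositions with \<open>j > k\<close> break the symmetry among the variables. On
  constants they alone act, by the scalar \<open>rr * (n - k)\<close>, which places the spectrum of
  1 at the vector r\<delta>.\<close>

definition cherednik :: "nat \<Rightarrow> nat \<Rightarrow> mpol \<Rightarrow> mpol" where
  "cherednik n k f = var_dunkl n k f + Const rr * (\<Sum>j\<in>{k<..n}. sw k j f)"

lemma cherednik_add: "cherednik n k (f + g) = cherednik n k f + cherednik n k g"
proof -
  have "(\<Sum>j\<in>{1..n} - {k}. xvar k * divided_diff k j (f + g))
      = (\<Sum>j\<in>{1..n} - {k}. xvar k * divided_diff k j f) + (\<Sum>j\<in>{1..n} - {k}. xvar k * divided_diff k j g)"
    unfolding sum.distrib [symmetric] by (rule sum.cong) (auto simp: divided_diff_add algebra_simps)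
  then show ?thesis
    by (simp add: cherednik_def var_dunkl_def theta_add sum.distrib distrib_left)
qed

lemma cherednik_Const_mult: "cherednik n k (Const c * f) = Const c * cherednik n k f"
proof -
  have "(\<Sum>j\<in>{1..n} - {k}. xvar k * divided_diff k j (Const c * f))
      = Const c * (\<Sum>j\<in>{1..n} - {k}. xvar k * divided_diff k j f)"
    unfolding sum_distrib_left by (rule sum.cong) (auto simp: divided_diff_mult_symmetric mult.left_commute)
  moreover have "(\<Sum>j\<in>{k<..n}. sw k j (Const c * f)) = Const c * (\<Sum>j\<in>{k<..n}. sw k j f)"
    by (simp add: sum_distrib_left)
  ultimately show ?thesis
    by (simp add: cherednik_def var_dunkl_def theta_Const_mult distrib_left mult.left_commute)
qed

lemma cherednik_polys_in:
  assumes "k \<in> {1..n}" "f \<in> polys_in {1..n}"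
  shows "cherednik n k f \<in> polys_in {1..n}"
proof -
  have "sw k j f \<in> polys_in {1..n}" if "j \<in> {k<..n}" for j
    using assms that by (intro vperm_polys_in[of _ "{1..n}"]) (auto simp: transpose_def)
  then show ?thesis
    unfolding cherednik_def var_dunkl_def using assms
    by (intro polys_in_add polys_in_mult polys_in_sum polys_in_Const theta_polys_in polys_in_xvar
        divided_diff_polys_in) auto
qed

text \<open>The sum in \<open>var_dunkl\<close> runs over all indices other than \<open>k\<close>,
  so a permutation only rearranges it.\<close>

lemma vperm_var_dunkl:
  assumes w: "w permutes {1..n}" and k: "k \<in> {1..n}"
  shows "vperm w (var_dunkl n k f) = var_dunkl n (w k) (vperm w f)"
proof -
  have inj: "inj w" using w by (rule permutes_inj)
  have "w ` ({1..n} - {k}) = {1..n} - {w k}"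
    using w inj by (simp add: image_set_diff permutes_image)
  then have "(\<Sum>j\<in>{1..n} - {w k}. xvar (w k) * divided_diff (w k) j (vperm w f))
      = (\<Sum>j\<in>{1..n} - {k}. xvar (w k) * divided_diff (w k) (w j) (vperm w f))"
    using sum.reindex[of w "{1..n} - {k}" "\<lambda>j. xvar (w k) * divided_diff (w k) j (vperm w f)"] inj
    by (simp add: inj_on_subset[of w UNIV])
  also have "\<dots> = (\<Sum>j\<in>{1..n} - {k}. vperm w (xvar k * divided_diff k j f))"
    by (rule sum.cong) (auto simp: vperm_divided_diff[OF inj])
  finally show ?thesis
    by (simp add: var_dunkl_def vperm_theta[OF inj] vperm_sum)
qed

lemma vperm_cherednik:
  assumes w: "w permutes {1..n}" and k: "k \<in> {1..n}"
  shows "vperm w (cherednik n k f)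
    = var_dunkl n (w k) (vperm w f) + Const rr * (\<Sum>j\<in>w ` {k<..n}. sw (w k) j (vperm w f))"
proof -
  have inj: "inj w" using w by (rule permutes_inj)
  have "(\<Sum>j\<in>w ` {k<..n}. sw (w k) j (vperm w f)) = (\<Sum>j\<in>{k<..n}. vperm w (sw k j f))"
    by (subst sum.reindex) (auto intro: inj_on_subset[OF inj] simp: vperm_sw[OF inj])
  then show ?thesis
    by (simp add: cherednik_def vperm_var_dunkl[OF w k] vperm_sum)
qed

section \<open>Commutation with adjacent transpositions\<close>

lemma sw_cherednik_other:
  assumes "1 \<le> i" "i < n" "k \<in> {1..n}" "k \<noteq> i" "k \<noteq> Suc i"
  shows "sw i (Suc i) (cherednik n k f) = cherednik n k (sw i (Suc i) f)"
proof -
  \<comment> \<open>The tail of \<open>k\<close> contains both of \<open>i\<close> and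
    \<open>Suc i\<close> or neither of them.\<close>
  have "transpose i (Suc i) ` {k<..n} = {k<..n}"
    using assms by (intro transpose_image_eq) auto
  then show ?thesis
    using assms vperm_cherednik[OF permutes_swap_id[of i "{1..n}" "Suc i"], of k f]
    by (simp add: cherednik_def)
qed

text \<open>The image of the tail of \<open>i\<close> is the tail of \<open>Suc i\<close> together
  with \<open>i\<close>. The extra element contributes a transposition that undoes the outer one,
  hence the term \<open>Const rr * f\<close>. This is the relation of the degenerate affine Hecke
  algebra.\<close>

lemma sw_cherednik:
  assumes "1 \<le> i" "i < n"
  shows "sw i (Suc i) (cherednik n i f) = cherednik n (Suc i) (sw i (Suc i) f) + Const rr * f"
proof -
  have "{i<..n} = insert (Suc i) {Suc i<..n}"
    using assms by auto
  then have "transpose i (Suc i) ` {i<..n} = insert i {Suc i<..n}"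
    by simp
  then have "(\<Sum>j\<in>transpose i (Suc i) ` {i<..n}. sw (Suc i) j (sw i (Suc i) f))
     = sw i (Suc i) (sw i (Suc i) f) + (\<Sum>j\<in>{Suc i<..n}. sw (Suc i) j (sw i (Suc i) f))"
    by (simp add: transpose_commute del: sw_sw)
  then show ?thesis
    using assms vperm_cherednik[OF permutes_swap_id[of i "{1..n}" "Suc i"], of i f]
    by (simp add: cherednik_def distrib_left)
qed

lemma cherednik_sw:
  assumes "1 \<le> i" "i < n"
  shows "cherednik n i (sw i (Suc i) f) = sw i (Suc i) (cherednik n (Suc i) f) + Const rr * f"
proof -
  have "sw i (Suc i) (sw i (Suc i) (cherednik n i (sw i (Suc i) f)))
      = sw i (Suc i) (cherednik n (Suc i) f + Const rr * sw i (Suc i) f)"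
    by (subst sw_cherednik[OF assms]) simp
  then show ?thesis by simp
qed

section \<open>The cyclic shift and the raising operator\<close>

definition cyc :: "nat \<Rightarrow> nat \<Rightarrow> nat" where
  "cyc n i = (if i = 1 \<and> 1 \<le> n then n else if 2 \<le> i \<and> i \<le> n then i - 1 else i)"

lemma cyc_permutes: "cyc n permutes {1..n}"
proof (rule bij_imp_permutes)
  show "bij_betw (cyc n) {1..n} {1..n}"
    by (rule bij_betwI[where g = "\<lambda>i. if i = n then 1 else Suc i"]) (auto simp: cyc_def)
qed (auto simp: cyc_def)

text \<open>Sends f(x_1, ..., x_n) to x_n f(x_n, x_1, ..., x_(n-1)). On spectral indices it moves
  the first entry to the end and increases it by 1.\<close>

definition raise :: "nat \<Rightarrow> mpol \<Rightarrow> mpol" where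
  "raise n f = xvar n * vperm (cyc n) f"

lemma var_dunkl_xvar_mult_other:
  assumes "i \<in> {1..n}" "k \<in> {1..n}" "i \<noteq> k"
  shows "var_dunkl n k (xvar i * f) = xvar i * var_dunkl n k f - Const rr * (xvar k * sw k i f)"
proof -
  let ?A = "{1..n} - {k}"
  have "(\<Sum>j\<in>?A. xvar k * divided_diff k j (xvar i * f))
      = (\<Sum>j\<in>?A. xvar i * (xvar k * divided_diff k j f) - (if j = i then xvar k * sw k i f else 0))"
  proof (rule sum.cong)
    fix j assume j: "j \<in> ?A"
    show "xvar k * divided_diff k j (xvar i * f) = xvar i * (xvar k * divided_diff k j f) - (if j = i then xvar k * sw k i f else 0)"
    proof (cases "j = i")
      case True
      with assms show ?thesis by (simp add: divided_diff_xvar_right) (simp add: algebra_simps)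
    next
      case False
      with assms j have "divided_diff k j (xvar i * f) = xvar i * divided_diff k j f"
        by (intro divided_diff_mult_symmetric) auto
      with False show ?thesis by (simp add: algebra_simps)
    qed
  qed simp
  also have "\<dots> = xvar i * (\<Sum>j\<in>?A. xvar k * divided_diff k j f) - xvar k * sw k i f"
    using assms by (simp add: sum_subtractf sum_distrib_left sum.delta)
  finally show ?thesis
    using assms by (simp add: var_dunkl_def theta_xvar_mult) (simp add: algebra_simps)
qed

lemma var_dunkl_xvar_mult_same:
  assumes "k \<in> {1..n}"
  shows "var_dunkl n k (xvar k * f)
    = xvar k * (var_dunkl n k f + f + Const rr * (\<Sum>j\<in>{1..n} - {k}. sw k j f))"
proof -
  have "(\<Sum>j\<in>{1..n} - {k}. xvar k * divided_diff k j (xvar k * f))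
      = xvar k * ((\<Sum>j\<in>{1..n} - {k}. xvar k * divided_diff k j f) + (\<Sum>j\<in>{1..n} - {k}. sw k j f))"
    unfolding sum.distrib [symmetric] sum_distrib_left
    by (rule sum.cong) (auto simp: divided_diff_xvar_left distrib_left mult.left_commute)
  then show ?thesis
    by (simp add: var_dunkl_def theta_xvar_mult) (simp add: algebra_simps)
qed

text \<open>The shift maps the tail of \<open>Suc i\<close> to the tail of \<open>i\<close> without
  \<open>n\<close>. The missing transposition with \<open>n\<close> yields
  \<open>xvar i * sw i n\<close> of the shifted polynomial, and exactly this is cancelled by the
  correction in \<open>var_dunkl_xvar_mult_other\<close>.\<close>

lemma cherednik_raise:
  assumes "1 \<le> i" "i < n"
  shows "cherednik n i (raise n f) = raise n (cherednik n (Suc i) f)"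
proof -
  let ?g = "vperm (cyc n) f"
  have img: "cyc n ` {Suc i<..n} = {i<..<n}"
  proof -
    have "j \<in> cyc n ` {Suc i<..n}" if "j \<in> {i<..<n}" for j
      using that assms by (intro image_eqI[of _ _ "Suc j"]) (auto simp: cyc_def)
    then show ?thesis using assms by (auto simp: cyc_def)
  qed
  have "vperm (cyc n) (cherednik n (Suc i) f) = var_dunkl n i ?g + Const rr * (\<Sum>j\<in>{i<..<n}. sw i j ?g)"
    using assms vperm_cherednik[OF cyc_permutes, of "Suc i" n f] img by (simp add: cyc_def)
  moreover have "(\<Sum>j\<in>{i<..n}. sw i j (xvar n * ?g)) = xvar i * sw i n ?g + xvar n * (\<Sum>j\<in>{i<..<n}. sw i j ?g)"
  proof -
    have "{i<..n} = insert n {i<..<n}" using assms by auto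
    moreover have "(\<Sum>j\<in>{i<..<n}. sw i j (xvar n * ?g)) = xvar n * (\<Sum>j\<in>{i<..<n}. sw i j ?g)"
      unfolding sum_distrib_left using assms by (intro sum.cong) (auto simp: transpose_def)
    ultimately show ?thesis by simp
  qed
  ultimately show ?thesis
    using assms by (simp add: raise_def cherednik_def var_dunkl_xvar_mult_other algebra_simps)
qed

text \<open>The tail of \<open>n\<close> is empty, but moving \<open>xvar n\<close> out of
  \<open>var_dunkl\<close> creates transpositions with all other indices, and these are the image of
  the tail of 1. The Euler operator adds the summand \<open>f\<close>.\<close>

lemma cherednik_raise_last:
  assumes "1 \<le> n"
  shows "cherednik n n (raise n f) = raise n (cherednik n 1 f + f)"
proof -
  let ?g = "vperm (cyc n) f"
  have img: "cyc n ` {1<..n} = {1..n} - {n}"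
  proof -
    have "j \<in> cyc n ` {1<..n}" if "j \<in> {1..n} - {n}" for j
      using that assms by (intro image_eqI[of _ _ "Suc j"]) (auto simp: cyc_def)
    moreover have "cyc n ` {1<..n} \<subseteq> {1..n} - {n}" by (auto simp: cyc_def)
    ultimately show ?thesis by blast
  qed
  have "vperm (cyc n) (cherednik n 1 f) = var_dunkl n n ?g + Const rr * (\<Sum>j\<in>{1..n} - {n}. sw n j ?g)"
    using assms vperm_cherednik[OF cyc_permutes, of 1 n f] img by (simp add: cyc_def)
  then show ?thesis
    using assms by (simp add: raise_def cherednik_def var_dunkl_xvar_mult_same algebra_simps)
qed

section \<open>Multiplication by the first power sum\<close>

definition psum :: "nat \<Rightarrow> mpol" where
  "psum n = (\<Sum>i=1..n. xvar i)"

lemma vperm_psum: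
  assumes "w permutes {1..n}"
  shows "vperm w (psum n) = psum n"
proof -
  have "vperm w (psum n) = (\<Sum>i=1..n. (xvar \<circ> w) i)"
    by (simp add: psum_def vperm_sum)
  also have "\<dots> = psum n"
    unfolding psum_def by (rule sum.permute[OF assms, symmetric])
  finally show ?thesis .
qed

lemma theta_psum_mult:
  assumes "k \<in> {1..n}"
  shows "theta k (psum n * f) = psum n * theta k f + xvar k * f"
proof -
  have "theta k (\<Sum>i\<in>A. xvar i * f) = (\<Sum>i\<in>A. xvar i * theta k f) + (if k \<in> A then xvar k * f else 0)"
    if "finite A" for A
    using that
  proof (induction A rule: finite_induct)
    case empty
    then show ?case using theta_Const[of k 0] by simp
  qed (auto simp: theta_add theta_xvar_mult)
  then show ?thesis
    using assms by (simp add: psum_def sum_distrib_right)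
qed

text \<open>A symmetric factor passes through transpositions and divided differences, so the
  commutator comes from the Euler operator alone.\<close>

lemma cherednik_psum_mult:
  assumes "k \<in> {1..n}"
  shows "cherednik n k (psum n * f) = psum n * cherednik n k f + xvar k * f"
proof -
  have sym: "sw k j (psum n) = psum n" if "j \<in> {1..n}" for j
    using assms that by (intro vperm_psum permutes_swap_id)
  have "(\<Sum>j\<in>{1..n} - {k}. xvar k * divided_diff k j (psum n * f))
      = psum n * (\<Sum>j\<in>{1..n} - {k}. xvar k * divided_diff k j f)"
    unfolding sum_distrib_left by (rule sum.cong) (auto simp: divided_diff_mult_symmetric sym mult.left_commute)
  moreover have "(\<Sum>j\<in>{k<..n}. sw k j (psum n * f)) = psum n * (\<Sum>j\<in>{k<..n}. sw k j f)"
    unfolding sum_distrib_left using assms by (intro sum.cong) (auto simp: sym)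
  ultimately show ?thesis
    by (simp add: cherednik_def var_dunkl_def theta_psum_mult[OF assms]) (simp add: algebra_simps)
qed

section \<open>The spectrum\<close>

text \<open>Rational functions are ordered by the sign of leading coefficients, which places the
  indeterminate above every natural number. Independence statements about r thereby become
  inequalities.\<close>

lemma of_nat_less_rr: "of_nat m < rr"
proof -
  have "pos_poly ([:0, 1:] - of_nat m :: rat poly)"
    by (simp add: pos_poly_def of_nat_poly)
  then show ?thesis
    by (simp add: rr_def of_nat_fract less_poly_def)
qed

lemma rr_pos: "rr > 0"
  using of_nat_less_rr[of 0] by simp

text \<open>If \<open>b < d\<close>, comparing both sides would bound \<open>rr\<close> by the
  natural number \<open>a\<close>.\<close>

lemma rr_linear_inject:
  assumes "of_nat a + rr * of_nat b = of_nat c + rr * of_nat d"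
  shows "a = c \<and> b = d"
proof -
  have *: False if "(of_nat a :: ratfun) + rr * of_nat b = of_nat c + rr * of_nat d" "b < d" for a b c d
  proof -
    obtain e where e: "d = Suc (b + e)" using \<open>b < d\<close> less_iff_Suc_add by auto
    have "(of_nat a :: ratfun) = of_nat c + rr * (1 + of_nat e)"
      using that(1) unfolding e by (simp add: algebra_simps)
    also have "\<dots> \<ge> 0 + rr * (1 + 0)"
      using rr_pos by (intro add_mono mult_left_mono) auto
    finally have "rr \<le> of_nat a" by simp
    then show False using of_nat_less_rr[of a] by simp
  qed
  have "b = d"
    using *[OF assms] *[OF assms[symmetric]] by (cases b d rule: linorder_cases) auto
  then show ?thesis using assms by simp
qed

text \<open>Counts the entries placed after entry \<open>i\<close> when \<gamma> is sorted stably
  into decreasing order; hence the strict comparison on the left and the weak one on the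
  right.\<close>

definition below_count :: "nat \<Rightarrow> (nat \<Rightarrow>\<^sub>0 nat) \<Rightarrow> nat \<Rightarrow> nat" where
  "below_count n \<gamma> i = card {j \<in> {1..<i}. lookup \<gamma> j < lookup \<gamma> i}
     + card {j \<in> {i<..n}. lookup \<gamma> j \<le> lookup \<gamma> i}"

text \<open>Closed form of \<open>cbar n \<gamma>\<close>; the minimal sorting permutation is
  eliminated in \<open>cbar_eq_spec\<close>.\<close>

definition spec :: "nat \<Rightarrow> (nat \<Rightarrow>\<^sub>0 nat) \<Rightarrow> nat \<Rightarrow> ratfun" where
  "spec n \<gamma> i = of_nat (lookup \<gamma> i) + rr * of_nat (below_count n \<gamma> i)"

lemma spec_inject:
  assumes "\<gamma> \<in> comps n" "\<eta> \<in> comps n" "\<And>i. i \<in> {1..n} \<Longrightarrow> spec n \<gamma> i = spec n \<eta> i"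
  shows "\<gamma> = \<eta>"
proof (rule poly_mapping_eqI)
  fix i
  show "lookup \<gamma> i = lookup \<eta> i"
  proof (cases "i \<in> {1..n}")
    case True
    then show ?thesis using assms(3)[of i] rr_linear_inject unfolding spec_def by blast
  next
    case False
    then show ?thesis using assms(1,2) by (metis (no_types, lifting) comps_def in_keys_iff mem_Collect_eq subsetD)
  qed
qed

definition vec :: "nat \<Rightarrow> (nat \<Rightarrow> nat) \<Rightarrow> (nat \<Rightarrow>\<^sub>0 nat)" where
  "vec n g = (\<Sum>i=1..n. Poly_Mapping.single i (g i))"

lemma lookup_vec: "lookup (vec n g) i = (if i \<in> {1..n} then g i else 0)"
  by (simp add: vec_def lookup_sum lookup_single when_def)

lemma vec_comps [simp]: "vec n g \<in> comps n"
  by (auto simp: comps_def in_keys_iff lookup_vec split: if_splits)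

lemma comps_lookup_0: "\<gamma> \<in> comps n \<Longrightarrow> i \<notin> {1..n} \<Longrightarrow> lookup \<gamma> i = 0"
  by (auto simp: comps_def in_keys_iff)

lemma csize_comps: "\<gamma> \<in> comps n \<Longrightarrow> csize \<gamma> = (\<Sum>i=1..n. lookup \<gamma> i)"
  by (rule csize_superset) (auto simp: comps_def)

definition homog :: "nat \<Rightarrow> mpol \<Rightarrow> bool" where
  "homog d p \<longleftrightarrow> (\<forall>m\<in>keys p. csize m = d)"

lemma homog_0 [simp]: "homog d 0"
  by (simp add: homog_def)

lemma homog_add: "homog d p \<Longrightarrow> homog d q \<Longrightarrow> homog d (p + q)"
  using keys_add[of p q] unfolding homog_def by blast

lemma homog_sum: "(\<And>x. x \<in> A \<Longrightarrow> homog d (g x)) \<Longrightarrow> homog d (sum g A)"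
  by (induction A rule: infinite_finite_induct) (auto intro: homog_add)

lemma homog_mult: "homog d p \<Longrightarrow> homog e q \<Longrightarrow> homog (d + e) (p * q)"
  using keys_mult[of p q] unfolding homog_def by fastforce

lemma homog_Const: "homog 0 (Const c)"
  by (auto simp: homog_def in_keys_iff lookup_Const split: if_splits)

lemma homog_Const_mult: "homog d p \<Longrightarrow> homog d (Const c * p)"
  using homog_mult[OF homog_Const] by fastforce

lemma homog_xmon: "homog (csize m) (xmon m)"
  by (simp add: homog_def)

lemma homog_xvar: "homog 1 (xvar i)"
  by (simp add: homog_def xvar_def)

lemma vperm_homog:
  assumes "homog d p"
  shows "homog d (vperm w p)"
proof -
  have "vperm w p = (\<Sum>m\<in>keys p. vperm w (Const (lookup p m) * xmon m))"
    by (subst xmon_expand[of "keys p" p]) (simp_all add: vperm_sum)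
  also have "homog d \<dots>"
  proof (rule homog_sum)
    fix m assume "m \<in> keys p"
    moreover obtain m' where "vperm w (xmon m) = xmon m'" "csize m' = csize m"
      using vperm_xmon by blast
    ultimately show "homog d (vperm w (Const (lookup p m) * xmon m))"
      using assms homog_Const_mult[OF homog_xmon[of m']] by (simp add: homog_def)
  qed
  finally show ?thesis .
qed

section \<open>Joint eigenvectors\<close>

definition joint_eigenvector :: "nat \<Rightarrow> (nat \<Rightarrow>\<^sub>0 nat) \<Rightarrow> mpol \<Rightarrow> bool" where
  "joint_eigenvector n \<gamma> e \<longleftrightarrow> e \<in> polys_in {1..n} \<and> e \<noteq> 0 \<and> homog (csize \<gamma>) e \<and>
     (\<forall>i\<in>{1..n}. cherednik n i e = Const (spec n \<gamma> i) * e)"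

lemma joint_eigenvector_zero: "joint_eigenvector n 0 1"
proof -
  have dd1: "divided_diff k j 1 = 0" if "k \<noteq> j" for k j
    using that by (intro divided_diff_unique) simp_all
  have "theta k 1 = 0" for k
    using theta_Const[of k 1] by simp
  moreover have "below_count n 0 i = card {i<..n}" for i
  proof -
    have "{j \<in> {1..<i}. lookup (0 :: nat \<Rightarrow>\<^sub>0 nat) j < lookup (0 :: nat \<Rightarrow>\<^sub>0 nat) i} = {}"
      and "{j \<in> {i<..n}. lookup (0 :: nat \<Rightarrow>\<^sub>0 nat) j \<le> lookup (0 :: nat \<Rightarrow>\<^sub>0 nat) i} = {i<..n}" by auto
    then show ?thesis unfolding below_count_def by (simp only: card.empty add_0)
  qed
  ultimately have "cherednik n i 1 = Const (spec n 0 i) * 1" for i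
    by (simp add: cherednik_def var_dunkl_def spec_def dd1 Const_mult Const_of_nat)
  moreover have "1 \<in> polys_in {1..n}" "homog 0 1"
    using polys_in_Const[of 1] homog_Const[of 1] by simp_all
  ultimately show ?thesis by (simp add: joint_eigenvector_def)
qed

text \<open>The index changes from (\<gamma>_1, ..., \<gamma>_n) to (\<gamma>_2, ..., \<gamma>_n,
  \<gamma>_1 + 1). Combined with the two relations for \<open>raise\<close>, it remains to see that
  \<open>below_count\<close> is carried along.\<close>

lemma joint_eigenvector_raise:
  assumes n: "1 \<le> n" and "\<gamma> \<in> comps n" "\<eta> \<in> comps n"
    and shift: "\<And>i. i \<in> {1..<n} \<Longrightarrow> lookup \<eta> i = lookup \<gamma> (Suc i)"
    and last: "lookup \<eta> n = Suc (lookup \<gamma> 1)"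
    and e: "joint_eigenvector n \<gamma> e"
  shows "joint_eigenvector n \<eta> (raise n e)"
proof -
  have nz: "raise n e \<noteq> 0"
    using e cyc_permutes[of n]
    by (simp add: joint_eigenvector_def raise_def xvar_nonzero vperm_eq_0_iff permutes_bij)
  have mem: "raise n e \<in> polys_in {1..n}"
    using e n cyc_permutes[of n] unfolding raise_def joint_eigenvector_def
    by (intro polys_in_mult polys_in_xvar vperm_polys_in[of _ "{1..n}"]) (auto simp: permutes_image)
  have "csize \<eta> = Suc (csize \<gamma>)"
  proof -
    have "csize \<eta> = (\<Sum>i=1..<n. lookup \<eta> i) + lookup \<eta> n"
      using n assms(3) by (simp add: csize_comps sum.last_plus add.commute)
    also have "\<dots> = (\<Sum>i=1..<n. lookup \<gamma> (Suc i)) + Suc (lookup \<gamma> 1)"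
      using shift last by simp
    also have "(\<Sum>i=1..<n. lookup \<gamma> (Suc i)) = (\<Sum>i=Suc 1..n. lookup \<gamma> i)"
      by (rule sum.reindex_bij_witness[of _ "\<lambda>i. i - 1" Suc]) auto
    finally show ?thesis
      using n assms(2) by (simp add: csize_comps sum.atLeast_Suc_atMost)
  qed
  then have hom: "homog (csize \<eta>) (raise n e)"
    using e homog_mult[OF homog_xvar vperm_homog, of "csize \<gamma>" e n "cyc n"]
    by (simp add: joint_eigenvector_def raise_def)
  have lower: "spec n \<eta> i = spec n \<gamma> (Suc i)" if i: "i \<in> {1..<n}" for i
  proof -
    have "{j \<in> {1..<Suc i}. lookup \<gamma> j < lookup \<gamma> (Suc i)}
        = Suc ` {j \<in> {1..<i}. lookup \<eta> j < lookup \<eta> i} \<union> {j \<in> {1}. lookup \<gamma> 1 < lookup \<gamma> (Suc i)}"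
      (is "?L = Suc ` ?A \<union> ?B")
    proof -
      have "j \<in> Suc ` ?A" if "j \<in> ?L" "j \<noteq> 1" for j
        using that i shift[of "j - 1"] shift[of i] by (cases j) (auto intro: image_eqI[of _ _ "j - 1"])
      then show ?thesis using i shift by auto
    qed
    moreover have "{j \<in> {i<..n}. lookup \<eta> j \<le> lookup \<eta> i}
        = (\<lambda>j. j - 1) ` {j \<in> {Suc i<..n}. lookup \<gamma> j \<le> lookup \<gamma> (Suc i)} \<union> {j \<in> {n}. lookup \<eta> n \<le> lookup \<eta> i}"
      (is "?L' = _ ` ?A' \<union> ?B'")
    proof -
      have "j \<in> (\<lambda>j. j - 1) ` ?A'" if "j \<in> ?L'" "j \<noteq> n" for j
        using that i shift[of j] shift[of i] by (intro image_eqI[of _ _ "Suc j"]) auto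
      moreover have "j - 1 \<in> ?L'" if "j \<in> ?A'" for j
        using that i shift[of "j - 1"] shift[of i] by (cases j) auto
      moreover have "?B' \<subseteq> ?L'" using i by auto
      ultimately show ?thesis by blast
    qed
    moreover have "card (Suc ` ?A \<union> ?B) = card ?A + card ?B"
      by (subst card_Un_disjoint) (auto simp: card_image)
    moreover have "card ((\<lambda>j. j - 1) ` ?A' \<union> ?B') = card ?A' + card ?B'"
    proof -
      have "inj_on (\<lambda>j. j - 1) ?A'" by (rule inj_onI) auto
      then have "card ((\<lambda>j. j - 1) ` ?A') = card ?A'" by (rule card_image)
      moreover have "((\<lambda>j. j - 1) ` ?A') \<inter> ?B' = {}" by auto
      ultimately show ?thesis by (simp only: card_Un_disjoint finite_imageI finite_Collect_conjI
            finite_greaterThanAtMost finite.emptyI finite.insertI Collect_mem_eq finite_Collect_bounded_ex simp_thms)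
    qed
    \<comment> \<open>The moved entry was compared strictly from the left and is now compared weakly
      from the right; its increase by 1 makes the two conditions equivalent.\<close>
    moreover have "card ?B = card ?B'"
      using i shift[of i] last by (auto simp: card_eq_0_iff Collect_conv_if)
    ultimately have "below_count n \<eta> i = below_count n \<gamma> (Suc i)"
      unfolding below_count_def by (simp add: Collect_conj_eq)
    then show ?thesis
      using i shift[of i] by (simp add: spec_def)
  qed
  have top: "spec n \<eta> n = spec n \<gamma> 1 + 1"
  proof -
    have "{j \<in> {1<..n}. lookup \<gamma> j \<le> lookup \<gamma> 1} = Suc ` {j \<in> {1..<n}. lookup \<eta> j < lookup \<eta> n}"
      (is "?L = Suc ` ?A")
    proof -
      have "j \<in> Suc ` ?A" if "j \<in> ?L" for j
        using that last shift[of "j - 1"] by (cases j) (auto intro: image_eqI[of _ _ "j - 1"])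
      moreover have "Suc j \<in> ?L" if "j \<in> ?A" for j
        using that last shift[of j] by auto
      ultimately show ?thesis by blast
    qed
    then have "below_count n \<eta> n = below_count n \<gamma> 1"
      by (simp add: below_count_def card_image)
    then show ?thesis by (simp add: spec_def last)
  qed
  have raise_smult: "raise n (Const c * f) = Const c * raise n f" for c f
    by (simp add: raise_def mult.left_commute)
  have raise_add: "raise n (f + g) = raise n f + raise n g" for f g
    by (simp add: raise_def distrib_left)
  have "cherednik n i (raise n e) = Const (spec n \<eta> i) * raise n e" if i: "i \<in> {1..n}" for i
  proof (cases "i = n")
    case True
    with n e top show ?thesis
      by (simp add: cherednik_raise_last joint_eigenvector_def raise_add raise_smult Const_add distrib_right)
  next
    case False
    with i e lower[of i] show ?thesis
      by (simp add: cherednik_raise joint_eigenvector_def raise_smult)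
  qed
  with nz mem hom show ?thesis by (simp add: joint_eigenvector_def)
qed

text \<open>The intertwiner \<open>sw i (Suc i) + t\<close> exchanges the eigenvalues at
  \<open>i\<close> and \<open>Suc i\<close>. It cannot kill \<open>e\<close>: otherwise
  \<open>e\<close> would be an eigenvector of the transposition with eigenvalue \<open>- t\<close>,
  forcing \<open>t * t = 1\<close>.\<close>

lemma joint_eigenvector_swap:
  assumes i: "1 \<le> i" "i < n" and "\<gamma> \<in> comps n" "\<eta> \<in> comps n"
    and sw: "\<And>j. lookup \<eta> j = lookup \<gamma> (transpose i (Suc i) j)"
    and ne: "lookup \<gamma> i \<noteq> lookup \<gamma> (Suc i)"
    and e: "joint_eigenvector n \<gamma> e"
  shows "\<exists>e'. joint_eigenvector n \<eta> e'"
proof -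
  let ?s = "transpose i (Suc i)"
  have perm: "?s permutes {1..n}"
    using i by (intro permutes_swap_id) auto
  have spec_sw: "spec n \<eta> (?s k) = spec n \<gamma> k" if k: "k \<in> {1..n}" for k
  proof -
    have *: "below_count n \<gamma> k = card {j \<in> {1..n}. j \<noteq> k \<and>
        (lookup \<gamma> j < lookup \<gamma> k \<or> lookup \<gamma> j = lookup \<gamma> k \<and> k < j)}" if "k \<in> {1..n}" for \<gamma> k
      unfolding below_count_def using that
      by (subst card_Un_disjoint [symmetric]) (auto intro!: arg_cong[where f = card])
    have sk: "?s k \<in> {1..n}" using k by (simp only: permutes_in_image[OF perm])
    have "{j \<in> {1..n}. j \<noteq> ?s k \<and> (lookup \<eta> j < lookup \<eta> (?s k) \<or> lookup \<eta> j = lookup \<eta> (?s k) \<and> ?s k < j)}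
      = ?s ` {j \<in> {1..n}. j \<noteq> k \<and> (lookup \<gamma> j < lookup \<gamma> k \<or> lookup \<gamma> j = lookup \<gamma> k \<and> k < j)}"
      (is "?L = ?s ` ?R")
    proof -
      have iff: "?s j \<in> ?L \<longleftrightarrow> j \<in> ?R" for j
      proof -
        have "?s j \<in> {1..n} \<longleftrightarrow> j \<in> {1..n}" by (rule permutes_in_image[OF perm])
        moreover have "?s j \<noteq> ?s k \<longleftrightarrow> j \<noteq> k" by (metis transpose_involutory)
        \<comment> \<open>An adjacent transposition reverses the order of the pair \<open>i\<close>,
          \<open>Suc i\<close> only, and the entries there differ by \<open>ne\<close>.\<close>
        moreover have "?s k < ?s j \<longleftrightarrow> k < j" if "lookup \<gamma> j = lookup \<gamma> k" "j \<noteq> k"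
          using that ne by (auto simp: transpose_def)
        ultimately show ?thesis by (auto simp: sw)
      qed
      show ?thesis
      proof (rule set_eqI)
        fix j
        show "j \<in> ?L \<longleftrightarrow> j \<in> ?s ` ?R"
          using iff[of "?s j"] iff by (metis (no_types, lifting) imageE image_eqI transpose_involutory)
      qed
    qed
    then have "below_count n \<eta> (?s k) = below_count n \<gamma> k"
      by (simp only: *[OF k] *[OF sk]) (simp add: card_image)
    then show ?thesis by (simp add: spec_def sw)
  qed
  define a where "a = spec n \<gamma> i"
  define b where "b = spec n \<gamma> (Suc i)"
  have ab: "spec n \<eta> i = b" "spec n \<eta> (Suc i) = a"
    using i spec_sw[of i] spec_sw[of "Suc i"] by (simp_all add: a_def b_def)
  \<comment> \<open>The parts of \<open>a\<close> and \<open>b\<close> free of r are distinct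
    entries of \<gamma>, so the difference is not an integer multiple of r. The value 0 is excluded
    for the denominator of \<open>t\<close>, the values r and -r for
    \<open>t * t = 1\<close>.\<close>
  have diff: "b - a \<noteq> 0" "b - a \<noteq> rr" "b - a \<noteq> - rr"
  proof -
    have "b - a = rr * 0 \<Longrightarrow> False"
      using rr_linear_inject[of "lookup \<gamma> (Suc i)" "below_count n \<gamma> (Suc i)" "lookup \<gamma> i" "below_count n \<gamma> i"] ne
      by (simp add: a_def b_def spec_def)
    then show "b - a \<noteq> 0" by auto
    have "b - a = rr \<Longrightarrow> False"
      using rr_linear_inject[of "lookup \<gamma> (Suc i)" "below_count n \<gamma> (Suc i)" "lookup \<gamma> i" "Suc (below_count n \<gamma> i)"] ne
      by (simp add: a_def b_def spec_def algebra_simps)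
    then show "b - a \<noteq> rr" by auto
    have "b - a = - rr \<Longrightarrow> False"
      using rr_linear_inject[of "lookup \<gamma> (Suc i)" "Suc (below_count n \<gamma> (Suc i))" "lookup \<gamma> i" "below_count n \<gamma> i"] ne
      by (simp add: a_def b_def spec_def algebra_simps)
    then show "b - a \<noteq> - rr" by auto
  qed
  \<comment> \<open>The solution of \<open>t * b = t * a + rr\<close>, which is the equation
    required at both \<open>i\<close> and \<open>Suc i\<close>.\<close>
  define t where "t = rr / (b - a)"
  have t: "t * b = t * a + rr"
    using diff(1) by (simp add: t_def field_simps)
  have t2: "t * t \<noteq> 1"
  proof
    assume "t * t = 1"
    then have "t = 1 \<or> t = -1" by (simp add: square_eq_1_iff)
    then show False using diff by (auto simp: t_def divide_simps)
  qed
  define e' where "e' = sw i (Suc i) e + Const t * e"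
  have ce: "cherednik n k e = Const (spec n \<gamma> k) * e" if "k \<in> {1..n}" for k
    using e that by (simp add: joint_eigenvector_def)
  have "e' \<noteq> 0"
  proof
    assume "e' = 0"
    then have 1: "sw i (Suc i) e = Const (- t) * e"
      by (simp add: e'_def Const_uminus eq_neg_iff_add_eq_0)
    then have "sw i (Suc i) (sw i (Suc i) e) = Const (- t) * (Const (- t) * e)"
      by (simp del: sw_sw)
    then have "Const (t * t) * e = e"
      by (simp add: Const_mult Const_uminus mult.assoc)
    then have "Const (t * t - 1) * e = 0"
      by (simp add: Const_diff left_diff_distrib)
    moreover have "Const (t * t - 1) \<noteq> 0"
      using t2 by simp
    ultimately show False using e by (simp add: joint_eigenvector_def)
  qed
  moreover have "e' \<in> polys_in {1..n}" "homog (csize \<eta>) e'"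
  proof -
    show "e' \<in> polys_in {1..n}"
      using e perm unfolding e'_def joint_eigenvector_def
      by (intro polys_in_add polys_in_mult polys_in_Const vperm_polys_in[of _ "{1..n}"])
        (auto simp: permutes_image)
    have "csize \<eta> = csize \<gamma>"
      unfolding csize_comps[OF assms(3)] csize_comps[OF assms(4)] sw
      using sum.permute[OF perm, of "lookup \<gamma>"] by (simp add: comp_def)
    then show "homog (csize \<eta>) e'"
      using e unfolding e'_def joint_eigenvector_def by (auto intro!: homog_add vperm_homog homog_Const_mult)
  qed
  moreover have "cherednik n k e' = Const (spec n \<eta> k) * e'" if k: "k \<in> {1..n}" for k
  proof -
    have ce': "cherednik n k e' = cherednik n k (sw i (Suc i) e) + Const t * cherednik n k e"
      by (simp add: e'_def cherednik_add cherednik_Const_mult)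
    consider "k = i" | "k = Suc i" | "k \<noteq> i" "k \<noteq> Suc i" by blast
    then show ?thesis
    proof cases
      case 1
      have "cherednik n k e' = Const b * sw i (Suc i) e + (Const rr + Const t * Const a) * e"
        unfolding ce' using 1 i ce[of i] ce[of "Suc i"]
        by (simp add: cherednik_sw a_def b_def) (simp add: algebra_simps)
      also have "Const rr + Const t * Const a = Const (t * b)"
        by (simp add: t Const_mult Const_add add.commute)
      finally show ?thesis
        using 1 ab by (simp add: e'_def Const_mult algebra_simps)
    next
      case 2
      have "cherednik n (Suc i) (sw i (Suc i) e) = sw i (Suc i) (cherednik n i e) - Const rr * e"
        using i by (simp add: sw_cherednik)
      then have "cherednik n k e' = Const a * sw i (Suc i) e + (Const t * Const b - Const rr) * e"
        unfolding ce' using 2 i ce[of i] ce[of "Suc i"]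
        by (simp add: a_def b_def) (simp add: algebra_simps)
      also have "Const t * Const b - Const rr = Const (t * a)"
        by (simp add: Const_mult [symmetric] t Const_add)
      finally show ?thesis
        using 2 ab by (simp add: e'_def Const_mult algebra_simps)
    next
      case 3
      then have "?s k = k" by simp
      then have "spec n \<eta> k = spec n \<gamma> k" using spec_sw[OF k] by simp
      then show ?thesis
        unfolding ce' using 3 k i ce[OF k] sw_cherednik_other[of i n k e]
        by (simp add: e'_def algebra_simps)
    qed
  qed
  ultimately show ?thesis unfolding joint_eigenvector_def by blast
qed

text \<open>A nonzero last entry is removed by undoing \<open>raise\<close>, which lowers the
  degree. If the last entry is 0, the last nonzero entry is moved one place to the right past a 0,
  which keeps the degree and lowers the weighted sum.\<close>

lemma joint_eigenvector_exists:
  assumes n: "1 \<le> n" and "\<eta> \<in> comps n"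
  shows "\<exists>e. joint_eigenvector n \<eta> e"
  using assms(2)
proof (induction \<eta> rule: wf_induct[OF wf_measures[of "[csize, \<lambda>\<eta>. \<Sum>i=1..n. lookup \<eta> i * (n - i)]"]])
  case (1 \<eta>)
  show ?case
  proof (cases "\<eta> = 0")
    case True
    then show ?thesis using joint_eigenvector_zero by blast
  next
    case False
    show ?thesis
    proof (cases "lookup \<eta> n = 0")
      case False
      define \<gamma> where "\<gamma> = vec n (\<lambda>i. if i = 1 then lookup \<eta> n - 1 else lookup \<eta> (i - 1))"
      have "csize \<gamma> < csize \<eta>"
      proof -
        have "csize \<gamma> = (lookup \<eta> n - 1) + (\<Sum>i=Suc 1..n. lookup \<eta> (i - 1))"
          using n by (simp add: csize_comps[of _ n] \<gamma>_def lookup_vec sum.atLeast_Suc_atMost)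
        also have "(\<Sum>i=Suc 1..n. lookup \<eta> (i - 1)) = (\<Sum>i=1..<n. lookup \<eta> i)"
          by (rule sum.reindex_bij_witness[of _ Suc "\<lambda>i. i - 1"]) auto
        finally show ?thesis
          using n False \<open>\<eta> \<in> comps n\<close> by (simp add: csize_comps sum.last_plus)
      qed
      then have "(\<gamma>, \<eta>) \<in> measures [csize, \<lambda>\<eta>. \<Sum>i=1..n. lookup \<eta> i * (n - i)]"
        by simp
      moreover have "\<gamma> \<in> comps n" by (simp add: \<gamma>_def)
      ultimately obtain e where "joint_eigenvector n \<gamma> e" using 1(1) by blast
      then have "joint_eigenvector n \<eta> (raise n e)"
        using n False 1(2) by (intro joint_eigenvector_raise[of n \<gamma>]) (auto simp: \<gamma>_def lookup_vec)
      then show ?thesis by blast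
    next
      case last: True
      define i where "i = Max {i \<in> {1..n}. lookup \<eta> i \<noteq> 0}"
      have "{i \<in> {1..n}. lookup \<eta> i \<noteq> 0} \<noteq> {}"
      proof
        assume "{i \<in> {1..n}. lookup \<eta> i \<noteq> 0} = {}"
        then have "lookup \<eta> i = 0" for i using comps_lookup_0[OF 1(2), of i] by blast
        then show False using \<open>\<eta> \<noteq> 0\<close> by (auto intro: poly_mapping_eqI)
      qed
      then have "i \<in> {i \<in> {1..n}. lookup \<eta> i \<noteq> 0}"
        unfolding i_def by (intro Max_in) auto
      then have i: "1 \<le> i" "i < n" "lookup \<eta> i \<noteq> 0"
        using last by (cases "i = n"; auto)+
      have "lookup \<eta> (Suc i) = 0"
      proof (rule ccontr)
        assume "lookup \<eta> (Suc i) \<noteq> 0"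
        then have "Suc i \<le> i" unfolding i_def using i by (intro Max_ge) (auto simp: i_def)
        then show False by simp
      qed
      note i = i this
      let ?s = "transpose i (Suc i)"
      have perm: "?s permutes {1..n}"
        using i by (intro permutes_swap_id) auto
      \<comment> \<open>The two exchanged entries differ, one being nonzero and the other 0, so the
        intertwiner leads from this \<gamma> back to \<eta>.\<close>
      define \<gamma> where "\<gamma> = vec n (\<lambda>j. lookup \<eta> (?s j))"
      have g: "lookup \<gamma> j = lookup \<eta> (?s j)" for j
        using comps_lookup_0[OF 1(2), of "?s j"] unfolding \<gamma>_def lookup_vec
        by (cases "j \<in> {1..n}") (simp_all only: permutes_in_image[OF perm] if_True if_False simp_thms)
      have "csize \<gamma> = csize \<eta>"
        using sum.permute[OF perm, of "lookup \<eta>"] 1(2) by (simp add: csize_comps[of _ n] \<gamma>_def lookup_vec comp_def)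
      moreover have "(\<Sum>j=1..n. lookup \<gamma> j * (n - j)) < (\<Sum>j=1..n. lookup \<eta> j * (n - j))"
      proof -
        have "(\<Sum>j=1..n. lookup \<gamma> j * (n - j)) = (\<Sum>j\<in>{1..n} - {i, Suc i}. lookup \<gamma> j * (n - j)) + lookup \<eta> i * (n - Suc i)"
          using i by (subst sum.subset_diff[of "{i, Suc i}"]) (auto simp: g)
        moreover have "(\<Sum>j=1..n. lookup \<eta> j * (n - j)) = (\<Sum>j\<in>{1..n} - {i, Suc i}. lookup \<eta> j * (n - j)) + lookup \<eta> i * (n - i)"
          using i by (subst sum.subset_diff[of "{i, Suc i}"]) auto
        moreover have "(\<Sum>j\<in>{1..n} - {i, Suc i}. lookup \<gamma> j * (n - j)) = (\<Sum>j\<in>{1..n} - {i, Suc i}. lookup \<eta> j * (n - j))"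
          by (rule sum.cong) (auto simp: g)
        moreover have "lookup \<eta> i * (n - Suc i) < lookup \<eta> i * (n - i)"
          using i by simp
        ultimately show ?thesis by simp
      qed
      ultimately have "(\<gamma>, \<eta>) \<in> measures [csize, \<lambda>\<eta>. \<Sum>i=1..n. lookup \<eta> i * (n - i)]"
        by simp
      moreover have mem: "\<gamma> \<in> comps n" by (simp add: \<gamma>_def)
      ultimately obtain e where "joint_eigenvector n \<gamma> e" using 1(1) by blast
      then show ?thesis
        using i mem 1(2) by (intro joint_eigenvector_swap[of i n \<gamma>]) (auto simp: g)
    qed
  qed
qed

section \<open>Triangularity\<close>

definition move :: "(nat \<Rightarrow>\<^sub>0 nat) \<Rightarrow> nat \<Rightarrow> nat \<Rightarrow> nat \<Rightarrow> nat \<Rightarrow> (nat \<Rightarrow>\<^sub>0 nat)" where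
  "move \<mu> k j p q = Poly_Mapping.update j q (Poly_Mapping.update k p \<mu>)"

lemma lookup_move: "lookup (move \<mu> k j p q) i = (if i = j then q else if i = k then p else lookup \<mu> i)"
  by (simp add: move_def lookup_update)

lemma move_same: "move \<mu> k j (lookup \<mu> k) (lookup \<mu> j) = \<mu>"
  by (rule poly_mapping_eqI) (simp add: lookup_move)

lemma move_comps: "\<mu> \<in> comps n \<Longrightarrow> k \<in> {1..n} \<Longrightarrow> j \<in> {1..n} \<Longrightarrow> move \<mu> k j p q \<in> comps n"
  by (auto simp: comps_def in_keys_iff lookup_move subset_iff split: if_splits)

lemma xmon_single: "xmon (Poly_Mapping.single i p) = xvar i ^ p"
proof (induction p)
  case (Suc p)
  have "Poly_Mapping.single i (Suc p) = Poly_Mapping.single i 1 + Poly_Mapping.single i p"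
    by (simp add: single_add [symmetric])
  then show ?case
    using Suc by (simp add: xvar_mult_xmon [symmetric] del: One_nat_def)
qed simp

lemma xmon_move:
  assumes "k \<noteq> j"
  shows "xmon (move \<mu> k j p q) = xmon (move \<mu> k j 0 0) * (xvar k ^ p * xvar j ^ q)"
proof -
  have "move \<mu> k j p q = move \<mu> k j 0 0 + (Poly_Mapping.single k p + Poly_Mapping.single j q)"
    using assms by (intro poly_mapping_eqI) (auto simp: lookup_add lookup_move lookup_single when_def)
  then show ?thesis by (simp add: xmon_add xmon_single)
qed

lemma vperm_power: "vperm w (f ^ p) = vperm w f ^ p"
  by (induction p) simp_all

lemma sw_xmon_move:
  assumes "k \<noteq> j"
  shows "sw k j (xmon (move \<mu> k j p q)) = xmon (move \<mu> k j q p)"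
proof -
  have "sw k j (xmon (move \<mu> k j 0 0)) = xmon (move \<mu> k j 0 0)"
  proof (rule vperm_fixed)
    show "xmon (move \<mu> k j 0 0) \<in> polys_in (- {k, j})"
      by (rule polys_in_xmon) (auto simp: in_keys_iff lookup_move split: if_splits)
  qed (auto simp: transpose_def)
  then show ?thesis
    using assms by (simp add: xmon_move[of k j \<mu> p q] xmon_move[of k j \<mu> q p] vperm_power mult_ac)
qed

text \<open>A telescoping sum. Because of the extra factor \<open>x\<close>, it contains the
  monomial with exponents \<open>b + d\<close>, \<open>b\<close> but stops before the swapped one;
  this asymmetry decides which endpoint appears in the expansions below.\<close>

lemma geometric_diff:
  fixes x y :: "'a::comm_ring_1"
  shows "(x - y) * (\<Sum>l<d. x ^ (b + d - l) * y ^ (b + l)) = x * (x ^ (b + d) * y ^ b - x ^ b * y ^ (b + d))"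
proof (induction d)
  case (Suc d)
  have "(\<Sum>l<Suc d. x ^ (b + Suc d - l) * y ^ (b + l))
      = x * (\<Sum>l<d. x ^ (b + d - l) * y ^ (b + l)) + x ^ Suc b * y ^ (b + d)"
    by (simp add: sum_distrib_left Suc_diff_le mult.assoc)
  then have "(x - y) * (\<Sum>l<Suc d. x ^ (b + Suc d - l) * y ^ (b + l))
      = x * ((x - y) * (\<Sum>l<d. x ^ (b + d - l) * y ^ (b + l))) + (x - y) * (x ^ Suc b * y ^ (b + d))"
    by (simp only: distrib_left mult.left_commute)
  then show ?case
    unfolding Suc by (simp add: algebra_simps)
qed simp

lemma xvar_divided_diff_move:
  assumes "k \<noteq> j"
  shows "xvar k * divided_diff k j (xmon (move \<mu> k j (b + d) b)) = (\<Sum>l<d. xmon (move \<mu> k j (b + d - l) (b + l)))"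
proof -
  let ?R = "xmon (move \<mu> k j 0 0)"
  have "(xvar k - xvar j) * (\<Sum>l<d. xmon (move \<mu> k j (b + d - l) (b + l)))
      = ?R * ((xvar k - xvar j) * (\<Sum>l<d. xvar k ^ (b + d - l) * xvar j ^ (b + l)))"
    by (subst xmon_move[OF assms]) (simp only: sum_distrib_left mult.left_commute)
  also have "\<dots> = xvar k * (xmon (move \<mu> k j (b + d) b) - xmon (move \<mu> k j b (b + d)))"
    unfolding geometric_diff
    by (subst (2 3) xmon_move[OF assms]) (simp only: right_diff_distrib mult.left_commute)
  also have "\<dots> = (xvar k - xvar j) * (xvar k * divided_diff k j (xmon (move \<mu> k j (b + d) b)))"
    using divided_diff_mult[of k j "xmon (move \<mu> k j (b + d) b)"]
    by (simp only: sw_xmon_move[OF assms] mult.left_commute)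
  finally show ?thesis
    using assms mult_left_cancel[of "xvar k - xvar j"] by (simp add: xvar_eq_iff)
qed

lemma divided_diff_sw: "k \<noteq> j \<Longrightarrow> divided_diff k j (sw k j f) = - divided_diff k j f"
  by (rule divided_diff_unique) (simp_all add: divided_diff_mult)

definition cherednik_term :: "nat \<Rightarrow> nat \<Rightarrow> mpol \<Rightarrow> mpol" where
  "cherednik_term k j f = xvar k * divided_diff k j f + (if k < j then sw k j f else 0)"

lemma cherednik_eq_cherednik_term:
  assumes "k \<in> {1..n}"
  shows "cherednik n k f = theta k f + Const rr * (\<Sum>j\<in>{1..n} - {k}. cherednik_term k j f)"
proof -
  have "(\<Sum>j\<in>{1..n} - {k}. if k < j then sw k j f else 0) = (\<Sum>j\<in>{k<..n}. sw k j f)"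
    using assms by (intro sum.mono_neutral_cong_right) auto
  then show ?thesis
    by (simp add: cherednik_def var_dunkl_def cherednik_term_def sum.distrib distrib_left)
qed

text \<open>\<open>cherednik_term k j (xmon \<mu>)\<close> without its multiple of \<open>xmon \<mu>\<close>.\<close>

definition cherednik_rest :: "(nat \<Rightarrow>\<^sub>0 nat) \<Rightarrow> nat \<Rightarrow> nat \<Rightarrow> mpol" where
  "cherednik_rest \<mu> k j = (let a = lookup \<mu> k; b = lookup \<mu> j; c = (if k < j then 1 else 0) in
     if b \<le> a then \<Sum>l\<in>{1..<a - b + c}. xmon (move \<mu> k j (a - l) (b + l))
     else - (\<Sum>l\<in>{c..<b - a}. xmon (move \<mu> k j (b - l) (a + l))))"

text \<open>With \<open>a\<close>, \<open>b\<close> the exponents at \<open>k\<close>,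
  \<open>j\<close>: for \<open>b \<le> a\<close> the term \<open>l = 0\<close> of the geometric sum
  is \<open>xmon \<mu>\<close>, and for \<open>k < j\<close> the transposition appends the swapped
  monomial as the term \<open>l = a - b\<close>. For \<open>a < b\<close> the sum is negative and
  starts with the swapped monomial, which the transposition cancels when \<open>k < j\<close>. Both
  effects are the shift \<open>c\<close> in \<open>cherednik_rest\<close>.\<close>

lemma cherednik_term_xmon:
  assumes "k \<noteq> j"
  shows "cherednik_term k j (xmon \<mu>)
    = (if lookup \<mu> j < lookup \<mu> k \<or> lookup \<mu> j = lookup \<mu> k \<and> k < j then xmon \<mu> else 0) + cherednik_rest \<mu> k j"
proof -
  define a where "a = lookup \<mu> k"
  define b where "b = lookup \<mu> j"
  have \<mu>: "move \<mu> k j a b = \<mu>" by (simp add: a_def b_def move_same)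
  have swm: "sw k j (xmon \<mu>) = xmon (move \<mu> k j b a)"
    using sw_xmon_move[OF assms, of \<mu> a b] \<mu> by simp
  show ?thesis
  proof (cases "b \<le> a")
    case True
    define d where "d = a - b"
    have a: "a = b + d" using True by (simp add: d_def)
    have x: "xvar k * divided_diff k j (xmon \<mu>) = (\<Sum>l<d. xmon (move \<mu> k j (a - l) (b + l)))"
      using xvar_divided_diff_move[OF assms, of \<mu> b d] \<mu> a by simp
    have split: "(\<Sum>l<Suc e. xmon (move \<mu> k j (a - l) (b + l)))
        = xmon \<mu> + (\<Sum>l\<in>{1..<Suc e}. xmon (move \<mu> k j (a - l) (b + l)))" for e
      using \<mu> by (simp add: lessThan_atLeast0 sum.atLeast_Suc_lessThan)
    show ?thesis
    proof (cases "k < j")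
      case True
      have "cherednik_term k j (xmon \<mu>) = (\<Sum>l<Suc d. xmon (move \<mu> k j (a - l) (b + l)))"
        using True by (simp add: cherednik_term_def x swm a)
      then show ?thesis
        unfolding split using True a by (auto simp: cherednik_rest_def a_def[symmetric] b_def[symmetric] Let_def)
    next
      case False
      have "cherednik_term k j (xmon \<mu>) = (\<Sum>l<d. xmon (move \<mu> k j (a - l) (b + l)))"
        using False by (simp add: cherednik_term_def x)
      also have "\<dots> = (if b < a then xmon \<mu> else 0) + (\<Sum>l\<in>{1..<d}. xmon (move \<mu> k j (a - l) (b + l)))"
      proof (cases d)
        case (Suc e)
        then show ?thesis using split[of e] a by (simp del: sum.lessThan_Suc sum.op_ivl_Suc)
      qed (simp add: a)
      finally show ?thesis
        using False a by (simp add: cherednik_rest_def a_def[symmetric] b_def[symmetric] Let_def)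
    qed
  next
    case False
    define d where "d = b - a"
    have b: "b = a + d" using False by (simp add: d_def)
    \<comment> \<open>The geometric sum is available only with the larger exponent at
      \<open>k\<close>; swapping costs a sign.\<close>
    have "xvar k * divided_diff k j (xmon \<mu>) = xvar k * divided_diff k j (sw k j (xmon (move \<mu> k j b a)))"
      by (simp add: sw_xmon_move[OF assms] \<mu>)
    then have x: "xvar k * divided_diff k j (xmon \<mu>) = - (\<Sum>l<d. xmon (move \<mu> k j (b - l) (a + l)))"
      using xvar_divided_diff_move[OF assms, of \<mu> a d] by (simp add: divided_diff_sw[OF assms] b)
    show ?thesis
    proof (cases "k < j")
      case True
      have "(\<Sum>l<d. xmon (move \<mu> k j (b - l) (a + l)))
          = xmon (move \<mu> k j b a) + (\<Sum>l\<in>{1..<d}. xmon (move \<mu> k j (b - l) (a + l)))"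
        using False b by (simp add: lessThan_atLeast0 sum.atLeast_Suc_lessThan)
      then show ?thesis
        using True False b by (auto simp: cherednik_term_def x swm cherednik_rest_def a_def[symmetric] b_def[symmetric] Let_def)
    next
      case nk: False
      then show ?thesis
        using False b by (auto simp: cherednik_term_def x cherednik_rest_def a_def[symmetric] b_def[symmetric] Let_def lessThan_atLeast0)
    qed
  qed
qed

lemma below_count_alt:
  assumes "k \<in> {1..n}"
  shows "below_count n \<mu> k = card {j \<in> {1..n} - {k}. lookup \<mu> j < lookup \<mu> k \<or> lookup \<mu> j = lookup \<mu> k \<and> k < j}"
  unfolding below_count_def using assms
  by (subst card_Un_disjoint [symmetric]) (auto intro!: arg_cong[where f = card])

text \<open>Each \<open>j\<close> counted by \<open>below_count\<close> contributes one copy of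
  \<open>xmon \<mu>\<close>, so the diagonal coefficient is the spectral value.\<close>

lemma cherednik_xmon:
  assumes k: "k \<in> {1..n}"
  shows "cherednik n k (xmon \<mu>) = Const (spec n \<mu> k) * xmon \<mu> + Const rr * (\<Sum>j\<in>{1..n} - {k}. cherednik_rest \<mu> k j)"
proof -
  let ?D = "\<lambda>j. lookup \<mu> j < lookup \<mu> k \<or> lookup \<mu> j = lookup \<mu> k \<and> k < j"
  have "(\<Sum>j\<in>{1..n} - {k}. cherednik_term k j (xmon \<mu>))
      = (\<Sum>j\<in>{1..n} - {k}. if ?D j then xmon \<mu> else 0) + (\<Sum>j\<in>{1..n} - {k}. cherednik_rest \<mu> k j)"
    unfolding sum.distrib [symmetric] by (rule sum.cong) (auto simp: cherednik_term_xmon)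
  also have "(\<Sum>j\<in>{1..n} - {k}. if ?D j then xmon \<mu> else 0) = (\<Sum>j\<in>{j \<in> {1..n} - {k}. ?D j}. xmon \<mu>)"
    by (rule sum.inter_filter [symmetric]) simp
  also have "\<dots> = Const (of_nat (below_count n \<mu> k)) * xmon \<mu>"
    by (simp add: below_count_alt[OF k] Const_of_nat)
  finally show ?thesis
    by (simp add: cherednik_eq_cherednik_term[OF k] theta_xmon spec_def Const_add Const_mult distrib_right distrib_left mult.assoc)
qed

text \<open>A numerical stand-in for the usual order on nonsymmetric Jack indices. Bringing two
  exponents strictly closer lowers the sum of squares; moving the larger of two exponents to the
  right by a swap keeps the squares and lowers the weighted sum. Well-foundedness comes with
  \<open>measures\<close>.\<close>

definition below :: "nat \<Rightarrow> ((nat \<Rightarrow>\<^sub>0 nat) \<times> (nat \<Rightarrow>\<^sub>0 nat)) set" where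
  "below n = measures [\<lambda>\<mu>. \<Sum>i=1..n. lookup \<mu> i ^ 2, \<lambda>\<mu>. \<Sum>i=1..n. lookup \<mu> i * (n - i)]"

lemma wf_below: "wf (below n)"
  by (simp add: below_def)

lemma below_trans: "(a, b) \<in> below n \<Longrightarrow> (b, c) \<in> below n \<Longrightarrow> (a, c) \<in> below n"
  by (auto simp: below_def)

lemma below_irrefl: "(a, a) \<notin> below n"
  by (simp add: below_def)

lemma below_maximal:
  assumes "finite A" "A \<noteq> {}"
  shows "\<exists>m\<in>A. \<forall>x\<in>A. (m, x) \<notin> below n"
proof -
  have "\<exists>m\<in>A. \<forall>x\<in>A. x \<noteq> m \<longrightarrow> (m, x) \<notin> below n"
  proof (rule Finite_Set.bex_max_element[of A "\<lambda>a b. (a, b) \<in> below n"])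
    show "asymp_on A (\<lambda>a b. (a, b) \<in> below n)"
      by (rule asymp_onI) (use below_trans below_irrefl in metis)
    show "transp_on A (\<lambda>a b. (a, b) \<in> below n)"
      by (rule transp_onI) (rule below_trans)
  qed (use assms in auto)
  then show ?thesis using below_irrefl by metis
qed

text \<open>Stated without subtraction on naturals; used for the degree and for both measures of
  \<open>below\<close>.\<close>

lemma sum_move:
  fixes g :: "nat \<Rightarrow> nat \<Rightarrow> nat"
  assumes "k \<in> {1..n}" "j \<in> {1..n}" "k \<noteq> j"
  shows "(\<Sum>i=1..n. g i (lookup (move \<mu> k j p q) i)) + g k (lookup \<mu> k) + g j (lookup \<mu> j)
    = (\<Sum>i=1..n. g i (lookup \<mu> i)) + g k p + g j q"
proof -
  have *: "(\<Sum>i=1..n. h i) = (\<Sum>i\<in>{1..n} - {k, j}. h i) + (h k + h j)" for h :: "nat \<Rightarrow> nat"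
    using assms by (subst sum.subset_diff[of "{k, j}"]) auto
  have "(\<Sum>i\<in>{1..n} - {k, j}. g i (lookup (move \<mu> k j p q) i)) = (\<Sum>i\<in>{1..n} - {k, j}. g i (lookup \<mu> i))"
    by (rule sum.cong) (auto simp: lookup_move)
  then show ?thesis
    unfolding * using assms by (simp add: lookup_move)
qed

lemma csize_move:
  assumes "k \<in> {1..n}" "j \<in> {1..n}" "k \<noteq> j" "\<mu> \<in> comps n" "p + q = lookup \<mu> k + lookup \<mu> j"
  shows "csize (move \<mu> k j p q) = csize \<mu>"
  using sum_move[OF assms(1-3), of "\<lambda>i a. a" \<mu> p q] assms
  by (simp add: csize_comps[of _ n] move_comps)

text \<open>The pairs a + u, a + v and a, a + u + v have equal sums, and the sums of squares differ
  by 2uv.\<close>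

lemma move_interior_below:
  assumes "k \<in> {1..n}" "j \<in> {1..n}" "k \<noteq> j" "p + q = lookup \<mu> k + lookup \<mu> j"
    and "min (lookup \<mu> k) (lookup \<mu> j) < p" "min (lookup \<mu> k) (lookup \<mu> j) < q"
  shows "(move \<mu> k j p q, \<mu>) \<in> below n"
proof -
  have *: "p ^ 2 + q ^ 2 < a ^ 2 + b ^ 2" if ab: "p + q = a + b" and p: "a < p" and q: "a < q" for a b :: nat
  proof -
    obtain u where u: "p = a + u" "u > 0"
      using less_imp_add_positive[OF p] by blast
    obtain v where v: "q = a + v" "v > 0"
      using less_imp_add_positive[OF q] by blast
    have b: "b = a + u + v" using ab u v by simp
    have "a ^ 2 + (a + u + v) ^ 2 = (a + u) ^ 2 + (a + v) ^ 2 + 2 * (u * v)"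
      by (simp add: power2_eq_square algebra_simps)
    moreover have "0 < u * v" using u v by simp
    ultimately show ?thesis unfolding b u(1) v(1) by linarith
  qed
  have "p ^ 2 + q ^ 2 < lookup \<mu> k ^ 2 + lookup \<mu> j ^ 2"
    using *[of "lookup \<mu> k" "lookup \<mu> j"] *[of "lookup \<mu> j" "lookup \<mu> k"] assms(4-6)
    by (cases "lookup \<mu> k \<le> lookup \<mu> j") (auto simp: min_def add.commute)
  then show ?thesis
    using sum_move[OF assms(1-3), of "\<lambda>i a. a ^ 2" \<mu> p q] by (simp add: below_def)
qed

lemma move_swap_below:
  assumes "k \<in> {1..n}" "j \<in> {1..n}" "k \<noteq> j" "lookup \<mu> k < lookup \<mu> j \<and> j < k \<or> lookup \<mu> j < lookup \<mu> k \<and> k < j"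
  shows "(move \<mu> k j (lookup \<mu> j) (lookup \<mu> k), \<mu>) \<in> below n"
proof -
  have *: "a * x + b * y > a * y + b * x" if ab: "a < b" and xy: "x < y" for a b x y :: nat
  proof -
    obtain c where c: "b = a + c" "c > 0"
      using less_imp_add_positive[OF ab] by blast
    obtain z where z: "y = x + z" "z > 0"
      using less_imp_add_positive[OF xy] by blast
    have "a * x + (a + c) * (x + z) = a * (x + z) + (a + c) * x + c * z"
      by (simp add: algebra_simps)
    moreover have "0 < c * z" using c z by simp
    ultimately show ?thesis unfolding c(1) z(1) by linarith
  qed
  have "lookup \<mu> j * (n - k) + lookup \<mu> k * (n - j) < lookup \<mu> k * (n - k) + lookup \<mu> j * (n - j)"
    using assms(4)
  proof (elim disjE conjE)
    assume "lookup \<mu> k < lookup \<mu> j" "j < k"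
    moreover have "n - k < n - j" using \<open>j < k\<close> assms(1) by simp
    ultimately show ?thesis using *[of "lookup \<mu> k" "lookup \<mu> j" "n - k" "n - j"] by linarith
  next
    assume "lookup \<mu> j < lookup \<mu> k" "k < j"
    moreover have "n - j < n - k" using \<open>k < j\<close> assms(2) by simp
    ultimately show ?thesis using *[of "lookup \<mu> j" "lookup \<mu> k" "n - j" "n - k"] by linarith
  qed
  then show ?thesis
    using sum_move[OF assms(1-3), of "\<lambda>i a. a ^ 2" \<mu> "lookup \<mu> j" "lookup \<mu> k"]
      sum_move[OF assms(1-3), of "\<lambda>i a. a * (n - i)" \<mu> "lookup \<mu> j" "lookup \<mu> k"]
    by (simp add: below_def)
qed

definition lower :: "nat \<Rightarrow> (nat \<Rightarrow>\<^sub>0 nat) \<Rightarrow> (nat \<Rightarrow>\<^sub>0 nat) set" where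
  "lower n \<mu> = {\<nu> \<in> comps n. csize \<nu> = csize \<mu> \<and> (\<nu>, \<mu>) \<in> below n}"

lemma keys_cherednik_rest:
  assumes "k \<in> {1..n}" "j \<in> {1..n}" "k \<noteq> j" "\<mu> \<in> comps n"
  shows "keys (cherednik_rest \<mu> k j) \<subseteq> lower n \<mu>"
proof -
  define a where "a = lookup \<mu> k"
  define b where "b = lookup \<mu> j"
  define c :: nat where "c = (if k < j then 1 else 0)"
  have keys_sum_xmon: "keys (\<Sum>l\<in>A. xmon (g l)) \<subseteq> S" if "\<And>l. l \<in> A \<Longrightarrow> g l \<in> S" for A :: "nat set" and g S
    using keys_sum[of "\<lambda>l. xmon (g l)" A] that by auto
  show ?thesis
  proof (cases "b \<le> a")
    case True
    then have eq: "cherednik_rest \<mu> k j = (\<Sum>l\<in>{1..<a - b + c}. xmon (move \<mu> k j (a - l) (b + l)))"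
      by (simp add: cherednik_rest_def a_def b_def c_def Let_def)
    have "move \<mu> k j (a - l) (b + l) \<in> lower n \<mu>" if l: "l \<in> {1..<a - b + c}" for l
    proof -
      have sum: "a - l + (b + l) = a + b" using l True by (auto simp: c_def split: if_splits)
      have "(move \<mu> k j (a - l) (b + l), \<mu>) \<in> below n"
      \<comment> \<open>The endpoint occurs only for \<open>k < j\<close>; there the larger exponent
        moves to the right, so the second measure decides.\<close>
      proof (cases "l = a - b")
        case True
        then have "move \<mu> k j (a - l) (b + l) = move \<mu> k j b a" "k < j" "b < a"
          using l \<open>b \<le> a\<close> by (auto simp: c_def split: if_splits)
        then show ?thesis using move_swap_below[OF assms(1-3)] by (simp add: a_def b_def)
      next
        case False
        then show ?thesis
          using l sum True
          by (intro move_interior_below[OF assms(1-3)])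
            (auto simp: c_def a_def[symmetric] b_def[symmetric] split: if_splits)
      qed
      moreover have "csize (move \<mu> k j (a - l) (b + l)) = csize \<mu>"
        using assms sum by (intro csize_move) (auto simp: a_def b_def)
      ultimately show ?thesis
        using assms by (simp add: lower_def move_comps)
    qed
    then show ?thesis unfolding eq by (rule keys_sum_xmon)
  next
    case False
    then have eq: "cherednik_rest \<mu> k j = - (\<Sum>l\<in>{c..<b - a}. xmon (move \<mu> k j (b - l) (a + l)))"
      by (simp add: cherednik_rest_def a_def b_def c_def Let_def)
    have "move \<mu> k j (b - l) (a + l) \<in> lower n \<mu>" if l: "l \<in> {c..<b - a}" for l
    proof -
      have sum: "b - l + (a + l) = a + b" using l False by auto
      have "(move \<mu> k j (b - l) (a + l), \<mu>) \<in> below n"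
      \<comment> \<open>This term occurs only for \<open>j < k\<close>; again the larger exponent
        moves to the right.\<close>
      proof (cases "l = 0")
        case True
        then have "j < k" using l assms(3) by (auto simp: c_def split: if_splits)
        then show ?thesis using True False move_swap_below[OF assms(1-3), of \<mu>] by (simp add: a_def b_def)
      next
        case nz: False
        then show ?thesis
          using l sum False
          by (intro move_interior_below[OF assms(1-3)])
            (auto simp: a_def[symmetric] b_def[symmetric])
      qed
      moreover have "csize (move \<mu> k j (b - l) (a + l)) = csize \<mu>"
        using assms sum by (intro csize_move) (auto simp: a_def b_def)
      ultimately show ?thesis
        using assms by (simp add: lower_def move_comps)
    qed
    then have "keys (\<Sum>l\<in>{c..<b - a}. xmon (move \<mu> k j (b - l) (a + l))) \<subseteq> lower n \<mu>"
      by (rule keys_sum_xmon)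
    then show ?thesis unfolding eq by (auto simp: in_keys_iff)
  qed
qed

lemma keys_cherednik_xmon_rest:
  assumes "k \<in> {1..n}" "\<mu> \<in> comps n"
  shows "keys (cherednik n k (xmon \<mu>) - Const (spec n \<mu> k) * xmon \<mu>) \<subseteq> lower n \<mu>"
proof -
  have "keys (\<Sum>j\<in>{1..n} - {k}. cherednik_rest \<mu> k j) \<subseteq> (\<Union>j\<in>{1..n} - {k}. keys (cherednik_rest \<mu> k j))"
    by (rule keys_sum)
  also have "\<dots> \<subseteq> lower n \<mu>"
    using keys_cherednik_rest assms by fastforce
  finally show ?thesis
    using keys_Const_mult[of rr "\<Sum>j\<in>{1..n} - {k}. cherednik_rest \<mu> k j"] by (simp add: cherednik_xmon[OF assms(1)])
qed

lemma cherednik_sum: "cherednik n k (sum g A) = (\<Sum>x\<in>A. cherednik n k (g x))"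
proof (induction A rule: infinite_finite_induct)
  case (insert x F)
  then show ?case by (simp add: cherednik_add)
qed (use cherednik_Const_mult[of n k 0 0] in simp_all)

lemma cherednik_expand: "cherednik n k f = (\<Sum>m\<in>keys f. Const (lookup f m) * cherednik n k (xmon m))"
  by (subst (1) xmon_expand[of "keys f" f]) (simp_all add: cherednik_sum cherednik_Const_mult)

lemma cherednik_homog:
  assumes "k \<in> {1..n}" "f \<in> polys_in {1..n}" "homog d f"
  shows "homog d (cherednik n k f)"
proof -
  have "homog d (cherednik n k (xmon m))" if "m \<in> keys f" for m
  proof -
    have m: "m \<in> comps n" "csize m = d"
      using assms that by (auto simp: polys_in_def comps_def homog_def)
    then have "homog d (cherednik n k (xmon m) - Const (spec n m k) * xmon m)"
      using keys_cherednik_xmon_rest[OF assms(1), of m] by (auto simp: homog_def lower_def)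
    moreover have "homog d (Const (spec n m k) * xmon m)"
      using homog_Const_mult[OF homog_xmon[of m]] m by simp
    ultimately show ?thesis using homog_add by fastforce
  qed
  then show ?thesis
    by (subst cherednik_expand) (auto intro!: homog_sum homog_Const_mult)
qed

text \<open>At a \<open>below\<close>-maximal monomial \<mu> of \<open>e\<close>, no other monomial
  of \<open>e\<close> contributes to the coefficient after applying an operator. The eigenvalue
  equations therefore read \<open>spec n \<mu> = spec n \<eta>\<close> on all positions, so \<mu> =
  \<eta> is the only maximal monomial and all others lie below it.\<close>

lemma joint_eigenvector_leading:
  assumes \<eta>: "\<eta> \<in> comps n" and e: "joint_eigenvector n \<eta> e"
  shows "lookup e \<eta> \<noteq> 0" and "keys e \<subseteq> insert \<eta> (lower n \<eta>)"
proof -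
  have comps: "\<nu> \<in> comps n" "csize \<nu> = csize \<eta>" if "\<nu> \<in> keys e" for \<nu>
    using e that by (auto simp: joint_eigenvector_def polys_in_def comps_def homog_def)
  have max_eq: "\<mu> = \<eta>" if \<mu>: "\<mu> \<in> keys e" and max: "\<And>\<nu>. \<nu> \<in> keys e \<Longrightarrow> (\<mu>, \<nu>) \<notin> below n" for \<mu>
  proof (rule spec_inject)
    fix k assume k: "k \<in> {1..n}"
    have zero: "lookup (cherednik n k (xmon \<nu>)) \<mu> = spec n \<nu> k * lookup (xmon \<nu>) \<mu>" if "\<nu> \<in> keys e" for \<nu>
    proof -
      have "\<mu> \<notin> keys (cherednik n k (xmon \<nu>) - Const (spec n \<nu> k) * xmon \<nu>)"
        using keys_cherednik_xmon_rest[OF k comps(1)[OF that]] max[OF that] by (auto simp: lower_def)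
      then show ?thesis by (simp add: in_keys_iff lookup_minus)
    qed
    have "lookup (cherednik n k e) \<mu> = (\<Sum>\<nu>\<in>keys e. lookup e \<nu> * lookup (cherednik n k (xmon \<nu>)) \<mu>)"
      by (subst cherednik_expand) (simp add: lookup_sum)
    also have "\<dots> = (\<Sum>\<nu>\<in>keys e. if \<nu> = \<mu> then lookup e \<mu> * spec n \<mu> k else 0)"
      by (rule sum.cong) (auto simp: zero lookup_xmon)
    also have "\<dots> = lookup e \<mu> * spec n \<mu> k"
      using \<mu> by simp
    finally show "spec n \<mu> k = spec n \<eta> k"
      using e k \<mu> by (simp add: joint_eigenvector_def in_keys_iff)
  qed (use \<mu> \<eta> comps in auto)
  have ex: "\<exists>\<mu>\<in>keys e. (\<mu> = \<nu> \<or> (\<nu>, \<mu>) \<in> below n) \<and> (\<forall>\<kappa>\<in>keys e. (\<mu>, \<kappa>) \<notin> below n)" if "\<nu> \<in> keys e" for \<nu>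
  proof -
    let ?A = "{\<mu> \<in> keys e. \<mu> = \<nu> \<or> (\<nu>, \<mu>) \<in> below n}"
    have "?A \<noteq> {}" using that by auto
    then obtain m where m: "m \<in> ?A" and max: "\<And>x. x \<in> ?A \<Longrightarrow> (m, x) \<notin> below n"
      using below_maximal[of ?A n] by auto
    have "(m, \<kappa>) \<notin> below n" if "\<kappa> \<in> keys e" for \<kappa>
    proof
      assume *: "(m, \<kappa>) \<in> below n"
      then have "\<kappa> \<in> ?A" using m that below_trans[OF _ *] by auto
      then show False using max * by blast
    qed
    with m show ?thesis by blast
  qed
  then have ex': "\<eta> \<in> keys e \<and> (\<eta> = \<nu> \<or> (\<nu>, \<eta>) \<in> below n)" if "\<nu> \<in> keys e" for \<nu>
    using ex[OF that] max_eq by blast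
  have "keys e \<noteq> {}" using e by (simp add: joint_eigenvector_def)
  then have "\<eta> \<in> keys e" using ex' by blast
  then show "lookup e \<eta> \<noteq> 0" by (simp add: in_keys_iff)
  show "keys e \<subseteq> insert \<eta> (lower n \<eta>)"
    using ex' comps by (auto simp: lower_def)
qed

text \<open>The monic nonsymmetric Jack polynomial; \<open>E_hom_eq\<close> identifies it with
  \<open>E_hom n \<eta>\<close>.\<close>

definition jack :: "nat \<Rightarrow> (nat \<Rightarrow>\<^sub>0 nat) \<Rightarrow> mpol" where
  "jack n \<eta> = (SOME e. joint_eigenvector n \<eta> e \<and> lookup e \<eta> = 1)"

lemma jack:
  assumes "1 \<le> n" "\<eta> \<in> comps n"
  shows "joint_eigenvector n \<eta> (jack n \<eta>)" and "lookup (jack n \<eta>) \<eta> = 1"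
proof -
  obtain e where e: "joint_eigenvector n \<eta> e" using joint_eigenvector_exists[OF assms] by blast
  define c where "c = 1 / lookup e \<eta>"
  have nz: "lookup e \<eta> \<noteq> 0" using joint_eigenvector_leading(1)[OF assms(2) e] .
  have 1: "lookup (Const c * e) \<eta> = 1" using nz by (simp add: c_def)
  have "c \<noteq> 0" using nz by (simp add: c_def)
  then have "joint_eigenvector n \<eta> (Const c * e)"
    using e by (auto simp: joint_eigenvector_def cherednik_Const_mult mult.left_commute intro!: polys_in_mult homog_Const_mult)
  with 1 have "\<exists>e. joint_eigenvector n \<eta> e \<and> lookup e \<eta> = 1" by blast
  then have "joint_eigenvector n \<eta> (jack n \<eta>) \<and> lookup (jack n \<eta>) \<eta> = 1"
    unfolding jack_def by (rule someI_ex)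
  then show "joint_eigenvector n \<eta> (jack n \<eta>)" and "lookup (jack n \<eta>) \<eta> = 1" by auto
qed

section \<open>Joint left eigenfunctionals\<close>

interpretation mpol_space: vector_space "\<lambda>c p. Const c * (p :: mpol)"
  by standard (simp_all add: Const_add Const_mult algebra_simps)

declare mpol_space.scale_scale [simp del]

abbreviation jack_span :: "nat \<Rightarrow> mpol set" where
  "jack_span n \<equiv> mpol_space.span (jack n ` comps n)"

definition coord :: "nat \<Rightarrow> (nat \<Rightarrow>\<^sub>0 nat) \<Rightarrow> mpol \<Rightarrow> ratfun" where
  "coord n \<gamma> f = mpol_space.representation (jack n ` comps n) f (jack n \<gamma>)"

context
  fixes n :: nat
  assumes n: "1 \<le> n"
begin

lemma jack_polys_in: "\<eta> \<in> comps n \<Longrightarrow> jack n \<eta> \<in> polys_in {1..n}"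
  using jack(1)[OF n] by (simp add: joint_eigenvector_def)

lemma jack_homog: "\<eta> \<in> comps n \<Longrightarrow> homog (csize \<eta>) (jack n \<eta>)"
  using jack(1)[OF n] by (simp add: joint_eigenvector_def)

lemma cherednik_jack: "\<eta> \<in> comps n \<Longrightarrow> k \<in> {1..n} \<Longrightarrow> cherednik n k (jack n \<eta>) = Const (spec n \<eta> k) * jack n \<eta>"
  using jack(1)[OF n] by (simp add: joint_eigenvector_def)

lemma keys_jack: "\<eta> \<in> comps n \<Longrightarrow> keys (jack n \<eta>) \<subseteq> insert \<eta> (lower n \<eta>)"
  using joint_eigenvector_leading(2) jack(1)[OF n] by blast

lemma inj_jack: "inj_on (jack n) (comps n)"
proof (rule inj_onI)
  fix \<gamma> \<eta> assume *: "\<gamma> \<in> comps n" "\<eta> \<in> comps n" "jack n \<gamma> = jack n \<eta>"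
  show "\<gamma> = \<eta>"
  proof (rule spec_inject[OF *(1,2)])
    fix k assume "k \<in> {1..n}"
    then have eq: "Const (spec n \<gamma> k) * jack n \<eta> = Const (spec n \<eta> k) * jack n \<eta>"
      using cherednik_jack * by metis
    have "spec n \<gamma> k = lookup (Const (spec n \<gamma> k) * jack n \<eta>) \<eta>"
      by (simp add: jack(2)[OF n *(2)])
    also have "\<dots> = spec n \<eta> k"
      unfolding eq by (simp add: jack(2)[OF n *(2)])
    finally show "spec n \<gamma> k = spec n \<eta> k" .
  qed
qed

text \<open>In a vanishing combination, the coefficient of \<open>xmon \<gamma>\<close> for a
  \<open>below\<close>-maximal index \<gamma> comes from \<open>jack n \<gamma>\<close>
  alone.\<close>

lemma independent_jack: "mpol_space.independent (jack n ` comps n)"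
  unfolding mpol_space.dependent_explicit
proof clarify
  fix t u v
  assume t: "finite t" "t \<subseteq> jack n ` comps n" and sum: "(\<Sum>v\<in>t. Const (u v) * v) = 0"
    and v: "v \<in> t" "u v \<noteq> 0"
  obtain T where T: "T \<subseteq> comps n" "finite T" "t = jack n ` T"
    using finite_subset_image[OF t] by blast
  have inj: "inj_on (jack n) T" using inj_jack T(1) by (rule inj_on_subset)
  let ?A = "{\<gamma> \<in> T. u (jack n \<gamma>) \<noteq> 0}"
  have "?A \<noteq> {}" using v T by auto
  then obtain \<gamma> where \<gamma>: "\<gamma> \<in> T" "u (jack n \<gamma>) \<noteq> 0"
    and max: "\<And>x. x \<in> T \<Longrightarrow> u (jack n x) \<noteq> 0 \<Longrightarrow> (\<gamma>, x) \<notin> below n"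
    using below_maximal[of ?A n] T by auto
  have zero: "u (jack n x) * lookup (jack n x) \<gamma> = 0" if "x \<in> T" "x \<noteq> \<gamma>" for x
  proof (cases "u (jack n x) = 0")
    case False
    then have "(\<gamma>, x) \<notin> below n" using max that by blast
    then have "\<gamma> \<notin> keys (jack n x)"
      using keys_jack[of x] T that by (auto simp: lower_def)
    then show ?thesis by (simp add: in_keys_iff)
  qed simp
  have "0 = lookup (\<Sum>v\<in>t. Const (u v) * v) \<gamma>" by (simp add: sum)
  also have "\<dots> = (\<Sum>x\<in>T. u (jack n x) * lookup (jack n x) \<gamma>)"
    unfolding T(3) by (simp add: sum.reindex[OF inj] lookup_sum)
  also have "\<dots> = (\<Sum>x\<in>T. if x = \<gamma> then u (jack n \<gamma>) else 0)"
    using jack(2)[OF n] T \<gamma> zero by (intro sum.cong) auto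
  also have "\<dots> = u (jack n \<gamma>)" using T \<gamma> by simp
  finally show False using \<gamma> by simp
qed

text \<open>Inverts the unitriangular expansion by recursion along \<open>below\<close>. Keeping the
  degree fixed in the span is what yields \<open>coord_homog\<close>.\<close>

lemma xmon_in_span:
  assumes "\<eta> \<in> comps n"
  shows "xmon \<eta> \<in> mpol_space.span (jack n ` {\<gamma> \<in> comps n. csize \<gamma> = csize \<eta>})"
  using assms
proof (induction \<eta> rule: wf_induct[OF wf_below[of n]])
  case (1 \<eta>)
  let ?S = "mpol_space.span (jack n ` {\<gamma> \<in> comps n. csize \<gamma> = csize \<eta>})"
  have "jack n \<eta> = (\<Sum>m\<in>insert \<eta> (keys (jack n \<eta>)). Const (lookup (jack n \<eta>) m) * xmon m)"
    by (rule xmon_expand) auto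
  also have "\<dots> = xmon \<eta> + (\<Sum>m\<in>keys (jack n \<eta>) - {\<eta>}. Const (lookup (jack n \<eta>) m) * xmon m)"
    using jack(2)[OF n 1(2)] by (simp add: sum.insert_remove)
  finally have eq: "xmon \<eta> = jack n \<eta> - (\<Sum>m\<in>keys (jack n \<eta>) - {\<eta>}. Const (lookup (jack n \<eta>) m) * xmon m)"
    unfolding eq_diff_eq by (rule sym)
  have "xmon m \<in> ?S" if "m \<in> keys (jack n \<eta>) - {\<eta>}" for m
  proof -
    have "m \<in> lower n \<eta>" using keys_jack[OF 1(2)] that by blast
    then show ?thesis using 1(1) by (auto simp: lower_def)
  qed
  moreover have "jack n \<eta> \<in> ?S"
    using 1(2) by (intro mpol_space.span_base) auto
  ultimately show ?case
    unfolding eq by (intro mpol_space.span_diff mpol_space.span_sum mpol_space.span_scale) blast+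
qed

lemma homog_in_span:
  assumes "f \<in> polys_in {1..n}" "homog d f"
  shows "f \<in> mpol_space.span (jack n ` {\<gamma> \<in> comps n. csize \<gamma> = d})"
proof -
  have "(\<Sum>m\<in>keys f. Const (lookup f m) * xmon m) \<in> mpol_space.span (jack n ` {\<gamma> \<in> comps n. csize \<gamma> = d})"
  proof (intro mpol_space.span_sum mpol_space.span_scale)
    fix m assume "m \<in> keys f"
    then have "m \<in> comps n" "csize m = d"
      using assms by (auto simp: polys_in_def comps_def homog_def)
    then show "xmon m \<in> mpol_space.span (jack n ` {\<gamma> \<in> comps n. csize \<gamma> = d})"
      using xmon_in_span by blast
  qed
  then show ?thesis by (simp add: xmon_expand[of "keys f" f, symmetric])
qed

lemma polys_in_span:
  assumes "f \<in> polys_in {1..n}"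
  shows "f \<in> jack_span n"
proof -
  have "(\<Sum>m\<in>keys f. Const (lookup f m) * xmon m) \<in> jack_span n"
  proof (intro mpol_space.span_sum mpol_space.span_scale)
    fix m assume "m \<in> keys f"
    then have "m \<in> comps n"
      using assms by (auto simp: polys_in_def comps_def)
    then have "xmon m \<in> mpol_space.span (jack n ` {\<gamma> \<in> comps n. csize \<gamma> = csize m})"
      by (rule xmon_in_span)
    also have "\<dots> \<subseteq> jack_span n"
      by (rule mpol_space.span_mono) auto
    finally show "xmon m \<in> jack_span n" .
  qed
  then show ?thesis by (simp add: xmon_expand[of "keys f" f, symmetric])
qed

lemma coord_add:
  "f \<in> polys_in {1..n} \<Longrightarrow> g \<in> polys_in {1..n} \<Longrightarrow> coord n \<gamma> (f + g) = coord n \<gamma> f + coord n \<gamma> g"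
  by (simp add: coord_def mpol_space.representation_add[OF independent_jack] polys_in_span)

lemma coord_Const_mult:
  "f \<in> polys_in {1..n} \<Longrightarrow> coord n \<gamma> (Const c * f) = c * coord n \<gamma> f"
  using mpol_space.representation_scale[OF independent_jack polys_in_span, of f c] by (simp add: coord_def)

lemma coord_0: "coord n \<gamma> 0 = 0"
  by (simp add: coord_def mpol_space.representation_zero)

lemma coord_sum:
  "(\<And>x. x \<in> A \<Longrightarrow> g x \<in> polys_in {1..n}) \<Longrightarrow> coord n \<gamma> (sum g A) = (\<Sum>x\<in>A. coord n \<gamma> (g x))"
  by (induction A rule: infinite_finite_induct) (simp_all add: coord_0 coord_add polys_in_sum)

lemma coord_jack:
  assumes "\<gamma> \<in> comps n" "\<eta> \<in> comps n"
  shows "coord n \<gamma> (jack n \<eta>) = (if \<gamma> = \<eta> then 1 else 0)"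
  using assms inj_onD[OF inj_jack, of \<gamma> \<eta>]
  by (auto simp: coord_def mpol_space.representation_basis[OF independent_jack])

lemma coord_homog:
  assumes "f \<in> polys_in {1..n}" "homog d f" "\<gamma> \<in> comps n" "csize \<gamma> \<noteq> d"
  shows "coord n \<gamma> f = 0"
proof (rule ccontr)
  assume "coord n \<gamma> f \<noteq> 0"
  moreover have "mpol_space.representation (jack n ` comps n) f = mpol_space.representation (jack n ` {\<gamma> \<in> comps n. csize \<gamma> = d}) f"
    by (rule mpol_space.representation_extend[OF independent_jack homog_in_span[OF assms(1,2)]]) auto
  ultimately have "mpol_space.representation (jack n ` {\<gamma> \<in> comps n. csize \<gamma> = d}) f (jack n \<gamma>) \<noteq> 0"
    by (simp add: coord_def)
  then have "jack n \<gamma> \<in> jack n ` {\<gamma> \<in> comps n. csize \<gamma> = d}"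
    by (rule mpol_space.representation_ne_zero)
  then obtain \<eta> where "\<eta> \<in> comps n" "csize \<eta> = d" "jack n \<gamma> = jack n \<eta>" by blast
  then show False using inj_onD[OF inj_jack _ assms(3), of \<eta>] assms(4) by simp
qed

lemma coord_separates:
  assumes "f \<in> polys_in {1..n}" "\<And>\<gamma>. \<gamma> \<in> comps n \<Longrightarrow> coord n \<gamma> f = 0"
  shows "f = 0"
proof -
  have "{b. mpol_space.representation (jack n ` comps n) f b \<noteq> 0} = {}"
    using mpol_space.representation_ne_zero[of "jack n ` comps n" f] assms(2) by (fastforce simp: coord_def)
  then show ?thesis
    using mpol_space.sum_nonzero_representation_eq[OF independent_jack polys_in_span[OF assms(1)]] by simp
qed

text \<open>The operators are diagonal in the Jack basis, so each coordinate is a left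
  eigenfunctional; the exponential twist below starts from here.\<close>

lemma coord_cherednik:
  assumes "f \<in> polys_in {1..n}" "\<gamma> \<in> comps n" "k \<in> {1..n}"
  shows "coord n \<gamma> (cherednik n k f) = spec n \<gamma> k * coord n \<gamma> f"
proof -
  have "f \<in> polys_in {1..n} \<and> coord n \<gamma> (cherednik n k f) = spec n \<gamma> k * coord n \<gamma> f"
    using polys_in_span[OF assms(1)]
  proof (induction rule: mpol_space.span_induct_alt)
    case base
    show ?case using cherednik_Const_mult[of n k 0 0] by (simp add: coord_0)
  next
    case (step c x y)
    then obtain \<eta> where \<eta>: "\<eta> \<in> comps n" "x = jack n \<eta>" by blast
    have mem: "x \<in> polys_in {1..n}" "cherednik n k y \<in> polys_in {1..n}"
      using \<eta> jack_polys_in step assms(3) cherednik_polys_in by auto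
    have "cherednik n k (Const c * x + y) = Const (c * spec n \<eta> k) * x + cherednik n k y"
      using \<eta> assms(3) by (simp add: cherednik_add cherednik_Const_mult cherednik_jack Const_mult mult.assoc)
    moreover have "Const c * x + y \<in> polys_in {1..n}"
      using step mem by (intro polys_in_add polys_in_mult) auto
    moreover have "coord n \<gamma> (Const (c * spec n \<eta> k) * x + cherednik n k y)
        = c * spec n \<eta> k * coord n \<gamma> x + spec n \<gamma> k * coord n \<gamma> y"
      using step mem by (simp add: coord_add coord_Const_mult polys_in_mult)
    moreover have "coord n \<gamma> (Const c * x + y) = c * coord n \<gamma> x + coord n \<gamma> y"
      using step mem by (simp add: coord_add coord_Const_mult polys_in_mult)
    moreover have "coord n \<gamma> x = (if \<gamma> = \<eta> then 1 else 0)"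
      using \<eta> assms(2) by (simp add: coord_jack)
    ultimately show ?case
      by (simp add: distrib_left)
  qed
  then show ?thesis by blast
qed

end

section \<open>Twisting the coordinates by the exponential of the power sum\<close>

lemma psum_power_polys_in: "psum n ^ N \<in> polys_in {1..n}"
proof (induction N)
  case 0
  show ?case using polys_in_Const[of 1] by simp
next
  case (Suc N)
  then show ?case unfolding power_Suc psum_def
    by (intro polys_in_mult polys_in_sum polys_in_xvar) (auto simp: psum_def)
qed

text \<open>Iterates the commutator with \<open>psum n\<close>. At \<open>N = 0\<close> the
  truncated exponent is harmless because of the factor \<open>of_nat N\<close>.\<close>

lemma cherednik_psum_power_mult:
  assumes "k \<in> {1..n}"
  shows "cherednik n k (psum n ^ N * f) = psum n ^ N * cherednik n k f + of_nat N * (psum n ^ (N - 1) * (xvar k * f))"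
proof (induction N)
  case (Suc N)
  have 1: "psum n * (of_nat N * (psum n ^ (N - 1) * (xvar k * f))) = of_nat N * (psum n ^ N * (xvar k * f))"
    by (cases N) (simp_all add: mult_ac)
  have "cherednik n k (psum n ^ Suc N * f) = psum n * cherednik n k (psum n ^ N * f) + xvar k * (psum n ^ N * f)"
    using cherednik_psum_mult[OF assms, of "psum n ^ N * f"] by (simp add: mult.assoc)
  also have "\<dots> = psum n * (psum n ^ N * cherednik n k f) + of_nat N * (psum n ^ N * (xvar k * f)) + xvar k * (psum n ^ N * f)"
    by (simp only: Suc distrib_left 1)
  finally show ?case
    by (simp add: algebra_simps)
qed simp

text \<open>The power series coefficients of exp(-t).\<close>

definition exp_coeff :: "nat \<Rightarrow> ratfun" where
  "exp_coeff N = (- 1) ^ N / of_nat (fact N)"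

lemma exp_coeff_Suc: "exp_coeff (Suc N) * of_nat (Suc N) = - exp_coeff N"
proof -
  have "(of_nat (fact N) :: ratfun) \<noteq> 0" "(of_nat (Suc N) :: ratfun) \<noteq> 0"
    using fact_nonzero[of N] by (simp_all only: of_nat_eq_0_iff)
  moreover have "(of_nat (fact (Suc N)) :: ratfun) = of_nat (Suc N) * of_nat (fact N)"
    by (simp only: fact_Suc of_nat_mult of_nat_id)
  ultimately show ?thesis by (simp add: exp_coeff_def field_simps del: of_nat_Suc of_nat_fact fact_Suc)
qed

text \<open>The coefficient at the eigenvector of index \<open>\<gamma>\<close> of \<open>exp (- (x\<^sub>1 + \<dots> + x\<^sub>n))\<close> times a
  monomial. Conjugation by this exponential turns \<open>cherednik n k\<close> into \<open>cherednik n k - xvar k\<close>.\<close>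

definition left_eigen_mon :: "nat \<Rightarrow> (nat \<Rightarrow>\<^sub>0 nat) \<Rightarrow> (nat \<Rightarrow>\<^sub>0 nat) \<Rightarrow> ratfun" where
  "left_eigen_mon n \<gamma> m = (if csize m \<le> csize \<gamma>
     then exp_coeff (csize \<gamma> - csize m) * coord n \<gamma> (psum n ^ (csize \<gamma> - csize m) * xmon m) else 0)"

definition left_eigen :: "nat \<Rightarrow> (nat \<Rightarrow>\<^sub>0 nat) \<Rightarrow> mpol \<Rightarrow> ratfun" where
  "left_eigen n \<gamma> f = (\<Sum>m\<in>keys f. lookup f m * left_eigen_mon n \<gamma> m)"

lemma left_eigen_add: "left_eigen n \<gamma> (f + g) = left_eigen n \<gamma> f + left_eigen n \<gamma> g"
  unfolding left_eigen_def by (rule setsum_keys_plus_distrib) (auto simp: algebra_simps)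

lemma left_eigen_superset: "finite A \<Longrightarrow> keys f \<subseteq> A \<Longrightarrow> left_eigen n \<gamma> f = (\<Sum>m\<in>A. lookup f m * left_eigen_mon n \<gamma> m)"
  unfolding left_eigen_def by (rule sum.mono_neutral_left) (auto simp: in_keys_iff)

lemma left_eigen_Const_mult: "left_eigen n \<gamma> (Const c * f) = c * left_eigen n \<gamma> f"
  using keys_Const_mult[of c f]
  by (simp add: left_eigen_superset[of "keys f"] sum_distrib_left mult.assoc)

lemma left_eigen_0: "left_eigen n \<gamma> 0 = 0"
  by (simp add: left_eigen_def)

lemma left_eigen_diff: "left_eigen n \<gamma> (f - g) = left_eigen n \<gamma> f - left_eigen n \<gamma> g"
  using left_eigen_add[of n \<gamma> "f - g" g] by simp

lemma left_eigen_eq_0: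
  assumes "\<And>m. m \<in> keys f \<Longrightarrow> csize \<gamma> < csize m"
  shows "left_eigen n \<gamma> f = 0"
proof -
  have "left_eigen_mon n \<gamma> m = 0" if "m \<in> keys f" for m
    using assms[OF that] by (simp add: left_eigen_mon_def)
  then show ?thesis by (simp add: left_eigen_def)
qed

context
  fixes n :: nat
  assumes n: "1 \<le> n"
begin

text \<open>For homogeneous arguments a single power of \<open>psum n\<close> serves all monomials,
  so the commutation rule for that power can be applied to \<open>f\<close> as a whole.\<close>

lemma left_eigen_homog:
  assumes "f \<in> polys_in {1..n}" "homog d f" "d \<le> csize \<gamma>"
  shows "left_eigen n \<gamma> f = exp_coeff (csize \<gamma> - d) * coord n \<gamma> (psum n ^ (csize \<gamma> - d) * f)"
proof -
  let ?N = "csize \<gamma> - d"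
  have mem: "psum n ^ ?N * xmon m \<in> polys_in {1..n}" if "m \<in> keys f" for m
    using assms(1) that by (intro polys_in_mult psum_power_polys_in polys_in_xmon) (auto simp: polys_in_def)
  have "coord n \<gamma> (psum n ^ ?N * f) = coord n \<gamma> (\<Sum>m\<in>keys f. Const (lookup f m) * (psum n ^ ?N * xmon m))"
    by (subst xmon_expand[of "keys f" f]) (simp_all add: sum_distrib_left mult.left_commute)
  also have "\<dots> = (\<Sum>m\<in>keys f. lookup f m * coord n \<gamma> (psum n ^ ?N * xmon m))"
    using mem by (subst coord_sum[OF n]) (auto simp: coord_Const_mult[OF n] intro!: polys_in_mult[OF polys_in_Const])
  finally have "exp_coeff ?N * coord n \<gamma> (psum n ^ ?N * f)
      = (\<Sum>m\<in>keys f. lookup f m * (exp_coeff ?N * coord n \<gamma> (psum n ^ ?N * xmon m)))"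
    by (simp add: sum_distrib_left mult.left_commute)
  also have "\<dots> = left_eigen n \<gamma> f"
    unfolding left_eigen_def using assms(2,3) by (intro sum.cong) (auto simp: left_eigen_mon_def homog_def)
  finally show ?thesis by simp
qed

lemma left_eigen_homog_eq:
  assumes "f \<in> polys_in {1..n}" "homog (csize \<gamma>) f"
  shows "left_eigen n \<gamma> f = coord n \<gamma> f"
  using left_eigen_homog[OF assms] by (simp add: exp_coeff_def)

text \<open>Below degree \<open>d\<close> everything vanishes, and in degree \<open>d\<close> the
  term with \<open>xvar k\<close> vanishes and the coordinates are eigenfunctionals. Above it, the
  commutator with the power of \<open>psum n\<close> supplies a factor that turns
  \<open>exp_coeff (Suc N)\<close> into \<open>- exp_coeff N\<close>, the coefficient belonging to
  \<open>xvar k * f\<close>.\<close>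

lemma left_eigen_eigen_homog:
  assumes f: "f \<in> polys_in {1..n}" "homog d f" and \<gamma>: "\<gamma> \<in> comps n" and k: "k \<in> {1..n}"
  shows "left_eigen n \<gamma> (cherednik n k f) - left_eigen n \<gamma> (xvar k * f) = spec n \<gamma> k * left_eigen n \<gamma> f"
proof -
  have cf: "cherednik n k f \<in> polys_in {1..n}" "homog d (cherednik n k f)"
    by (rule cherednik_polys_in[OF k f(1)]) (rule cherednik_homog[OF k f])
  have xf: "xvar k * f \<in> polys_in {1..n}" "homog (Suc d) (xvar k * f)"
    using polys_in_mult[OF polys_in_xvar[OF k] f(1)] homog_mult[OF homog_xvar[of k] f(2)] by simp_all
  consider "csize \<gamma> < d" | "csize \<gamma> = d" | N where "csize \<gamma> = d + Suc N"
    by (metis add_Suc_right less_imp_Suc_add linorder_neqE_nat)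
  then show ?thesis
  proof cases
    case 1
    then show ?thesis
      using f(2) cf(2) xf(2) by (simp add: homog_def left_eigen_eq_0)
  next
    case 2
    then have "left_eigen n \<gamma> (xvar k * f) = 0"
      using xf(2) by (intro left_eigen_eq_0) (auto simp: homog_def)
    with 2 show ?thesis
      using f cf \<gamma> k by (simp add: left_eigen_homog_eq coord_cherednik[OF n])
  next
    case 3
    let ?N = "Suc N"
    have mem: "psum n ^ M * g \<in> polys_in {1..n}" if "g \<in> polys_in {1..n}" for M g
      using that by (intro polys_in_mult psum_power_polys_in)
    have "spec n \<gamma> k * coord n \<gamma> (psum n ^ ?N * f) = coord n \<gamma> (cherednik n k (psum n ^ ?N * f))"
      by (rule coord_cherednik[OF n mem[OF f(1)] \<gamma> k, symmetric])
    also have "cherednik n k (psum n ^ ?N * f) = psum n ^ ?N * cherednik n k f + Const (of_nat ?N) * (psum n ^ N * (xvar k * f))"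
      by (subst cherednik_psum_power_mult[OF k]) (simp add: Const_of_nat del: of_nat_Suc power_Suc)
    also have "coord n \<gamma> \<dots> = coord n \<gamma> (psum n ^ ?N * cherednik n k f) + of_nat ?N * coord n \<gamma> (psum n ^ N * (xvar k * f))"
      using mem[OF cf(1), of ?N] mem[OF xf(1), of N]
      by (simp add: coord_add[OF n] coord_Const_mult[OF n] polys_in_mult del: of_nat_Suc power_Suc)
    finally have "spec n \<gamma> k * (exp_coeff ?N * coord n \<gamma> (psum n ^ ?N * f))
      = exp_coeff ?N * coord n \<gamma> (psum n ^ ?N * cherednik n k f) + (exp_coeff ?N * of_nat ?N) * coord n \<gamma> (psum n ^ N * (xvar k * f))"
      by (simp add: algebra_simps del: of_nat_Suc power_Suc)
    then show ?thesis
      using 3 left_eigen_homog[OF f, of \<gamma>] left_eigen_homog[OF cf, of \<gamma>] left_eigen_homog[OF xf, of \<gamma>]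
      by (simp add: exp_coeff_Suc del: of_nat_Suc power_Suc)
  qed
qed

lemma left_eigen_eigen:
  assumes f: "f \<in> polys_in {1..n}" and \<gamma>: "\<gamma> \<in> comps n" and k: "k \<in> {1..n}"
  shows "left_eigen n \<gamma> (xvar k * f) = left_eigen n \<gamma> (cherednik n k f) - spec n \<gamma> k * left_eigen n \<gamma> f"
proof (induction f rule: mpol_induct)
  case zero
  show ?case using cherednik_Const_mult[of n k 0 0] by (simp add: left_eigen_0)
next
  case (monomial m c)
  then have "keys m \<subseteq> {1..n}" using f by (auto simp: polys_in_def)
  then have "Const c * xmon m \<in> polys_in {1..n}" "homog (csize m) (Const c * xmon m)"
    by (auto intro!: polys_in_mult polys_in_xmon polys_in_Const homog_Const_mult homog_xmon)
  then show ?case using left_eigen_eigen_homog[OF _ _ \<gamma> k] by (simp add: algebra_simps)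
next
  case (add f g)
  then show ?case by (simp add: distrib_left left_eigen_add cherednik_add)
qed

lemma left_eigen_jack:
  assumes "\<gamma> \<in> comps n" "\<eta> \<in> comps n" "csize \<gamma> \<le> csize \<eta>"
  shows "left_eigen n \<gamma> (jack n \<eta>) = (if \<gamma> = \<eta> then 1 else 0)"
proof (cases "csize \<gamma> = csize \<eta>")
  case True
  then show ?thesis
    using assms jack_homog[OF n, of \<eta>] jack_polys_in[OF n, of \<eta>] by (simp add: left_eigen_homog_eq coord_jack[OF n])
next
  case False
  then have "left_eigen n \<gamma> (jack n \<eta>) = 0"
    using assms jack_homog[OF n, of \<eta>] by (intro left_eigen_eq_0) (auto simp: homog_def)
  with False show ?thesis by auto
qed

text \<open>Functionals of the lowest degree \<open>N\<close> in \<open>f\<close> see only the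
  component \<open>g\<close> of that degree, on which they are the Jack coordinates. Since
  \<open>N \<le> d\<close>, indices of degree at most \<open>d\<close> suffice; this matches the
  range of the vanishing conditions.\<close>

lemma left_eigen_separates:
  assumes f: "f \<in> polys_in {1..n}"
    and bound: "\<And>m. m \<in> keys f \<Longrightarrow> csize m \<le> d"
    and zero: "\<And>\<gamma>. \<gamma> \<in> comps n \<Longrightarrow> csize \<gamma> \<le> d \<Longrightarrow> left_eigen n \<gamma> f = 0"
  shows "f = 0"
proof (rule ccontr)
  assume "f \<noteq> 0"
  define N where "N = Min (csize ` keys f)"
  have "N \<in> csize ` keys f" unfolding N_def using \<open>f \<noteq> 0\<close> by (intro Min_in) auto
  then obtain m where m: "m \<in> keys f" "csize m = N" by auto
  have le: "N \<le> csize m" if "m \<in> keys f" for m unfolding N_def using that by simp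
  define g where "g = (\<Sum>m\<in>{m \<in> keys f. csize m = N}. Const (lookup f m) * xmon m)"
  have lg: "lookup g m = (if csize m = N then lookup f m else 0)" for m
    by (auto simp: g_def lookup_sum lookup_xmon if_distrib[of "\<lambda>x. _ * x"] sum.delta' in_keys_iff cong: if_cong)
  have g: "g \<in> polys_in {1..n}" "homog N g"
    using f by (auto simp: polys_in_def homog_def in_keys_iff lg split: if_splits)
  have "csize m > N" if "m \<in> keys (f - g)" for m
  proof -
    from that have "lookup (f - g) m \<noteq> 0" by (simp add: in_keys_iff)
    then have "csize m \<noteq> N" "lookup f m \<noteq> 0" by (auto simp: lookup_minus lg split: if_splits)
    then show ?thesis using le[of m] by (simp add: in_keys_iff)
  qed
  then have fg: "left_eigen n \<gamma> (f - g) = 0" if "csize \<gamma> = N" for \<gamma>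
    using that by (intro left_eigen_eq_0) auto
  have "g = 0"
  proof (rule coord_separates[OF n g(1)])
    fix \<gamma> assume \<gamma>: "\<gamma> \<in> comps n"
    show "coord n \<gamma> g = 0"
    proof (cases "csize \<gamma> = N")
      case True
      then have "csize \<gamma> \<le> d" using bound[OF m(1)] m(2) by simp
      then show ?thesis
        using fg[OF True] zero[OF \<gamma>] left_eigen_homog_eq[of g \<gamma>] g True by (simp add: left_eigen_diff)
    next
      case False
      then show ?thesis using coord_homog[OF n g \<gamma>] by blast
    qed
  qed
  then show False using m lg[of m] by (simp add: in_keys_iff)
qed

end

section \<open>The transfer map\<close>

text \<open>\<open>transfers n p f\<close> expresses \<open>p(\<xi> - x) 1 = f\<close> through the functionals \<open>left_eigen n \<gamma>\<close>,
  which avoids substituting operators into polynomials.\<close>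

definition transfers :: "nat \<Rightarrow> mpol \<Rightarrow> mpol \<Rightarrow> bool" where
  "transfers n p f \<longleftrightarrow> (\<forall>\<gamma>\<in>comps n. peval p (spec n \<gamma>) * left_eigen n \<gamma> 1 = left_eigen n \<gamma> f)"

lemma peval_add: "peval (p + q) v = peval p v + peval q v"
  and peval_diff: "peval (p - q) v = peval p v - peval q v"
  and peval_Const_mult: "peval (Const c * p) v = c * peval p v"
  and peval_xvar_mult: "peval (xvar i * p) v = v i * peval p v"
  and peval_0: "peval 0 v = 0"
  and peval_1: "peval 1 v = 1"
  by (simp_all add: peval_eq_subst peval.subst_add peval.subst_diff peval.subst_Const_mult peval.subst_xvar_mult)

lemma transfers_add: "transfers n p f \<Longrightarrow> transfers n q g \<Longrightarrow> transfers n (p + q) (f + g)"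
  by (simp add: transfers_def peval_add left_eigen_add distrib_right)

lemma transfers_diff: "transfers n p f \<Longrightarrow> transfers n q g \<Longrightarrow> transfers n (p - q) (f - g)"
  by (simp add: transfers_def peval_diff left_eigen_diff left_diff_distrib)

lemma transfers_Const_mult: "transfers n p f \<Longrightarrow> transfers n (Const c * p) (Const c * f)"
  by (simp add: transfers_def peval_Const_mult left_eigen_Const_mult mult.assoc)

lemma transfers_0: "transfers n 0 0"
  by (simp add: transfers_def peval_0 left_eigen_0)

lemma transfers_sum:
  "(\<And>x. x \<in> A \<Longrightarrow> transfers n (p x) (f x)) \<Longrightarrow> transfers n (sum p A) (sum f A)"
  by (induction A rule: infinite_finite_induct) (simp_all add: transfers_0 transfers_add)

text \<open>The bound is strict so that \<open>small 0 p\<close> means \<open>p = 0\<close>, which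
  starts the induction on degree in \<open>transfers_surj\<close>.\<close>

definition small :: "nat \<Rightarrow> mpol \<Rightarrow> bool" where
  "small d p \<longleftrightarrow> (\<forall>m\<in>keys p. csize m < d)"

lemma small_add: "small d p \<Longrightarrow> small d q \<Longrightarrow> small d (p + q)"
  using keys_add[of p q] unfolding small_def by blast

lemma small_diff: "small d p \<Longrightarrow> small d q \<Longrightarrow> small d (p - q)"
  using keys_diff[of p q] unfolding small_def by blast

lemma small_0: "small d 0"
  by (simp add: small_def)

lemma small_Const_mult: "small d p \<Longrightarrow> small d (Const c * p)"
  using keys_Const_mult[of c p] unfolding small_def by blast

lemma small_sum: "(\<And>x. x \<in> A \<Longrightarrow> small d (p x)) \<Longrightarrow> small d (sum p A)"
  by (induction A rule: infinite_finite_induct) (auto intro: small_add small_0)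

lemma small_xvar_mult:
  assumes "small d p"
  shows "small (Suc d) (xvar i * p)"
proof -
  have "keys (xvar i * p) \<subseteq> {a + b |a b. a \<in> keys (xvar i) \<and> b \<in> keys p}"
    by (rule keys_mult)
  then show ?thesis
    using assms unfolding small_def by (fastforce simp: xvar_def)
qed

lemma small_mono: "small d p \<Longrightarrow> d \<le> e \<Longrightarrow> small e p"
  unfolding small_def by fastforce

lemma small_xmon: "csize m < d \<Longrightarrow> small d (xmon m)"
  by (simp add: small_def)

lemma keys_bound_lincomb:
  assumes "homog d g" "\<And>m. m \<in> keys g \<Longrightarrow> small (Suc d) (p m)"
  shows "small (Suc d) (\<Sum>m\<in>keys g. Const (lookup g m) * p m)"
  using assms by (intro small_sum small_Const_mult) auto

context
  fixes n :: nat
  assumes n: "1 \<le> n"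
begin

text \<open>A variable on the side of \<open>p\<close> corresponds to the k-th Cherednik operator
  minus \<open>xvar k\<close> on the side of \<open>f\<close>; solving for \<open>xvar k * f\<close>
  gives this rule.\<close>

lemma transfers_xvar_mult:
  assumes "f \<in> polys_in {1..n}" "k \<in> {1..n}" "transfers n p f" "transfers n q (cherednik n k f)"
  shows "transfers n (q - xvar k * p) (xvar k * f)"
  using assms(3,4)
  by (simp add: transfers_def left_eigen_eigen[OF n assms(1) _ assms(2)] peval_diff peval_xvar_mult left_diff_distrib mult.assoc)

text \<open>Writing x^m as \<open>xvar k * xmon m'\<close>, the Cherednik term has only the degree
  of \<open>m'\<close> and is covered by the induction hypothesis. Only \<open>- xvar k * p'\<close>
  reaches the top degree, hence the alternating leading sign.\<close>

lemma transfers_xmon_exists: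
  assumes "m \<in> comps n"
  shows "\<exists>p\<in>polys_in {1..n}. transfers n p (xmon m) \<and> small (csize m) (p - Const ((- 1) ^ csize m) * xmon m)"
  using assms
proof (induction "csize m" arbitrary: m)
  case 0
  then have "m = 0" by (simp add: csize_eq_0_iff)
  moreover have "1 \<in> polys_in {1..n}" using polys_in_Const[of 1] by simp
  ultimately show ?case
    by (intro bexI[of _ 1]) (auto simp: transfers_def peval_1 small_0)
next
  case (Suc d)
  then obtain k where k: "k \<in> keys m"
    by (metis csize_def nat.distinct(1) sum.empty equals0I)
  from k obtain m' where m': "m = Poly_Mapping.single k 1 + m'" "csize m = Suc (csize m')"
    "keys m' \<subseteq> keys m" by (rule nonzero_exponent_split)
  have kn: "k \<in> {1..n}" and m'c: "m' \<in> comps n" and d: "csize m' = d"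
    using k m' Suc by (auto simp: comps_def)
  have xm: "xmon m = xvar k * xmon m'"
    by (simp only: m'(1) xvar_mult_xmon)
  have xm': "xmon m' \<in> polys_in {1..n}"
    using m'c by (intro polys_in_xmon) (simp add: comps_def)
  obtain p' where p': "p' \<in> polys_in {1..n}" "transfers n p' (xmon m')"
    "small d (p' - Const ((- 1) ^ d) * xmon m')"
    using Suc(1)[of m'] d m'c by auto
  define g where "g = cherednik n k (xmon m')"
  have g: "g \<in> polys_in {1..n}" "homog d g"
    using cherednik_polys_in[OF kn xm'] cherednik_homog[OF kn xm', of d] homog_xmon[of m'] d by (auto simp: g_def)
  have "\<forall>m\<in>keys g. \<exists>p. p \<in> polys_in {1..n} \<and> transfers n p (xmon m) \<and> small d (p - Const ((- 1) ^ d) * xmon m)"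
  proof
    fix m assume "m \<in> keys g"
    then have "m \<in> comps n" "csize m = d" using g by (auto simp: polys_in_def comps_def homog_def)
    then show "\<exists>p. p \<in> polys_in {1..n} \<and> transfers n p (xmon m) \<and> small d (p - Const ((- 1) ^ d) * xmon m)"
      using Suc(1)[of m] by auto
  qed
  from bchoice[OF this] obtain q where q: "\<And>m. m \<in> keys g \<Longrightarrow> q m \<in> polys_in {1..n} \<and> transfers n (q m) (xmon m)
      \<and> small d (q m - Const ((- 1) ^ d) * xmon m)"
    by blast
  define Q where "Q = (\<Sum>m\<in>keys g. Const (lookup g m) * q m)"
  have Qt: "transfers n Q g"
  proof -
    have "transfers n Q (\<Sum>m\<in>keys g. Const (lookup g m) * xmon m)"
      unfolding Q_def using q by (intro transfers_sum transfers_Const_mult) blast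
    then show ?thesis by (simp add: xmon_expand[of "keys g" g, symmetric])
  qed
  have Qm: "Q \<in> polys_in {1..n}"
    unfolding Q_def using q by (intro polys_in_sum polys_in_mult polys_in_Const) blast
  have Qs: "small (Suc d) Q"
    unfolding Q_def
  proof (rule keys_bound_lincomb[OF g(2)])
    fix m assume m: "m \<in> keys g"
    then have "small d (q m - Const ((- 1) ^ d) * xmon m)" using q by blast
    then have "small (Suc d) (q m - Const ((- 1) ^ d) * xmon m)" by (rule small_mono) simp
    moreover have "small (Suc d) (Const ((- 1) ^ d) * xmon m)"
      using g m by (intro small_Const_mult small_xmon) (simp add: homog_def)
    ultimately show "small (Suc d) (q m)" using small_add by fastforce
  qed
  have "Q - xvar k * p' \<in> polys_in {1..n}"
    using Qm p' kn by (intro polys_in_diff polys_in_mult polys_in_xvar)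
  moreover have "transfers n (Q - xvar k * p') (xmon m)"
    unfolding xm using transfers_xvar_mult[OF xm' kn p'(2)] Qt by (simp add: g_def)
  moreover have eq: "Q - xvar k * p' - Const ((- 1) ^ Suc d) * xmon m
      = Q - xvar k * (p' - Const ((- 1) ^ d) * xmon m')"
    by (simp add: xm Const_uminus algebra_simps)
  have "small (csize m) (Q - xvar k * p' - Const ((- 1) ^ csize m) * xmon m)"
    unfolding m'(2) d eq by (rule small_diff[OF Qs small_xvar_mult[OF p'(3)]])
  ultimately show ?case by blast
qed

end

text \<open>The choice is in fact forced, by \<open>transfers_unique\<close>. The leading term is
  selected along with it because surjectivity, on which uniqueness rests, uses it.\<close>

definition transfer_mon :: "nat \<Rightarrow> (nat \<Rightarrow>\<^sub>0 nat) \<Rightarrow> mpol" where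
  "transfer_mon n m = (SOME p. p \<in> polys_in {1..n} \<and> transfers n p (xmon m)
     \<and> small (csize m) (p - Const ((- 1) ^ csize m) * xmon m))"

definition transfer :: "nat \<Rightarrow> mpol \<Rightarrow> mpol" where
  "transfer n f = (\<Sum>m\<in>keys f. Const (lookup f m) * transfer_mon n m)"

lemma transfer_add: "transfer n (f + g) = transfer n f + transfer n g"
  unfolding transfer_def by (rule setsum_keys_plus_distrib) (auto simp: Const_add algebra_simps)

lemma transfer_superset: "finite A \<Longrightarrow> keys f \<subseteq> A \<Longrightarrow> transfer n f = (\<Sum>m\<in>A. Const (lookup f m) * transfer_mon n m)"
  unfolding transfer_def by (rule sum.mono_neutral_left) (auto simp: in_keys_iff)

lemma transfer_Const_mult: "transfer n (Const c * f) = Const c * transfer n f"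
  using keys_Const_mult[of c f]
  by (simp add: transfer_superset[of "keys f"] sum_distrib_left Const_mult mult.assoc)

context
  fixes n :: nat
  assumes n: "1 \<le> n"
begin

lemma transfer_mon:
  assumes "m \<in> comps n"
  shows "transfer_mon n m \<in> polys_in {1..n}" "transfers n (transfer_mon n m) (xmon m)"
    "small (csize m) (transfer_mon n m - Const ((- 1) ^ csize m) * xmon m)"
proof -
  have "\<exists>p. p \<in> polys_in {1..n} \<and> transfers n p (xmon m)
      \<and> small (csize m) (p - Const ((- 1) ^ csize m) * xmon m)"
    using transfers_xmon_exists[OF n assms] by blast
  then have "transfer_mon n m \<in> polys_in {1..n} \<and> transfers n (transfer_mon n m) (xmon m)
      \<and> small (csize m) (transfer_mon n m - Const ((- 1) ^ csize m) * xmon m)"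
    unfolding transfer_mon_def by (rule someI_ex)
  then show "transfer_mon n m \<in> polys_in {1..n}" "transfers n (transfer_mon n m) (xmon m)"
    "small (csize m) (transfer_mon n m - Const ((- 1) ^ csize m) * xmon m)" by blast+
qed

lemma transfer_polys_in: "f \<in> polys_in {1..n} \<Longrightarrow> transfer n f \<in> polys_in {1..n}"
  unfolding transfer_def by (intro polys_in_sum polys_in_mult polys_in_Const transfer_mon(1))
    (auto simp: polys_in_def comps_def)

lemma transfer_transfers:
  assumes "f \<in> polys_in {1..n}"
  shows "transfers n (transfer n f) f"
proof -
  have "transfers n (transfer n f) (\<Sum>m\<in>keys f. Const (lookup f m) * xmon m)"
    unfolding transfer_def using assms by (intro transfers_sum transfers_Const_mult transfer_mon(2))
      (auto simp: polys_in_def comps_def)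
  then show ?thesis by (simp add: xmon_expand[of "keys f" f, symmetric])
qed

lemma transfer_top:
  assumes "f \<in> polys_in {1..n}" "small (Suc d) f"
  shows "small (Suc d) (transfer n f)" and "csize \<mu> = d \<Longrightarrow> lookup (transfer n f) \<mu> = (- 1) ^ d * lookup f \<mu>"
proof -
  have small: "small d (Const (lookup f m) * transfer_mon n m - Const ((- 1) ^ d * lookup f m) * xmon m)"
    if "m \<in> keys f" "csize m = d" for m
  proof -
    have "m \<in> comps n" using assms(1) that by (auto simp: polys_in_def comps_def)
    then have "small d (Const (lookup f m) * (transfer_mon n m - Const ((- 1) ^ d) * xmon m))"
      using transfer_mon(3)[of m] that by (intro small_Const_mult) simp
    then show ?thesis by (simp add: Const_mult algebra_simps)
  qed
  have small': "small d (Const (lookup f m) * transfer_mon n m)" if "m \<in> keys f" "csize m < d" for m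
  proof -
    have "m \<in> comps n" using assms(1) that by (auto simp: polys_in_def comps_def)
    then have "small d (transfer_mon n m - Const ((- 1) ^ csize m) * xmon m)"
      using small_mono[OF transfer_mon(3)[of m]] that by simp
    moreover have "small d (Const ((- 1) ^ csize m) * xmon m)"
      using that by (intro small_Const_mult small_xmon)
    ultimately have "small d (transfer_mon n m)" using small_add by fastforce
    then show ?thesis by (rule small_Const_mult)
  qed
  define h where "h = (\<Sum>m\<in>keys f. Const (if csize m = d then (- 1) ^ d * lookup f m else 0) * xmon m)"
  have lh: "lookup h m = (if csize m = d then (- 1) ^ d * lookup f m else 0)" for m
    by (auto simp: h_def lookup_sum lookup_xmon if_distrib[of "\<lambda>x. _ * x"] sum.delta' in_keys_iff cong: if_cong)
  have "transfer n f - h = (\<Sum>m\<in>keys f. Const (lookup f m) * transfer_mon n m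
      - Const (if csize m = d then (- 1) ^ d * lookup f m else 0) * xmon m)"
    by (simp add: transfer_def h_def sum_subtractf)
  also have "small d \<dots>"
  proof (rule small_sum)
    fix m assume m: "m \<in> keys f"
    then have "csize m < d \<or> csize m = d" using assms(2) by (auto simp: small_def)
    then show "small d (Const (lookup f m) * transfer_mon n m
      - Const (if csize m = d then (- 1) ^ d * lookup f m else 0) * xmon m)"
      using small[OF m] small'[OF m] by auto
  qed
  finally have diff: "small d (transfer n f - h)" .
  show "lookup (transfer n f) \<mu> = (- 1) ^ d * lookup f \<mu>" if "csize \<mu> = d"
  proof -
    have "\<mu> \<notin> keys (transfer n f - h)" using diff that by (auto simp: small_def)
    then show ?thesis using that by (simp add: in_keys_iff lookup_minus lh)
  qed
  have "small (Suc d) h"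
    by (auto simp: small_def in_keys_iff lh split: if_splits)
  moreover have "small (Suc d) (transfer n f - h)" using small_mono[OF diff] by simp
  ultimately show "small (Suc d) (transfer n f)" using small_add by fastforce
qed

text \<open>Subtracting the transfer of the signed top component lowers the degree. The leading
  coefficients are recorded for use in the uniqueness argument.\<close>

lemma transfers_surj:
  assumes "p \<in> polys_in {1..n}" "small d p"
  shows "\<exists>f\<in>polys_in {1..n}. transfers n p f \<and> small d f
    \<and> (\<forall>\<mu>. Suc (csize \<mu>) = d \<longrightarrow> lookup p \<mu> = (- 1) ^ csize \<mu> * lookup f \<mu>)"
  using assms
proof (induction d arbitrary: p)
  case 0
  then have "p = 0" by (simp add: small_def)
  then show ?case using transfers_0 small_0 by (intro bexI[of _ 0]) auto
next
  case (Suc d)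
  \<comment> \<open>The sign undoes the one that \<open>transfer\<close> puts on the top
    component.\<close>
  define g where "g = (\<Sum>m\<in>keys p. Const (if csize m = d then (- 1) ^ d * lookup p m else 0) * xmon m)"
  have lg: "lookup g m = (if csize m = d then (- 1) ^ d * lookup p m else 0)" for m
    by (auto simp: g_def lookup_sum lookup_xmon if_distrib[of "\<lambda>x. _ * x"] sum.delta' in_keys_iff cong: if_cong)
  have g: "g \<in> polys_in {1..n}" "small (Suc d) g"
    using Suc.prems by (auto simp: polys_in_def small_def in_keys_iff lg split: if_splits)
  have "lookup (p - transfer n g) m = 0" if "csize m \<ge> d" for m
  proof (cases "csize m = d")
    case True
    then show ?thesis
      using transfer_top(2)[OF g True] lg[of m]
      by (simp add: lookup_minus mult.assoc [symmetric] power_add [symmetric] mult_2 [symmetric])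
  next
    case False
    then have "m \<notin> keys p" "m \<notin> keys (transfer n g)"
      using that Suc.prems(2) transfer_top(1)[OF g] by (auto simp: small_def)
    then have "lookup p m = 0" "lookup (transfer n g) m = 0"
      by (simp_all add: in_keys_iff)
    then show ?thesis by (simp add: lookup_minus)
  qed
  then have "small d (p - transfer n g)"
    by (auto simp: small_def in_keys_iff not_le [symmetric])
  moreover have "p - transfer n g \<in> polys_in {1..n}"
    using Suc.prems g by (intro polys_in_diff transfer_polys_in)
  ultimately obtain f where f: "f \<in> polys_in {1..n}" "transfers n (p - transfer n g) f" "small d f"
    using Suc.IH by blast
  have "transfers n p (f + g)"
    using transfers_add[OF f(2) transfer_transfers[OF g(1)]] by simp
  moreover have "small (Suc d) (f + g)"
    using small_mono[OF f(3)] g by (intro small_add) auto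
  moreover have "lookup p \<mu> = (- 1) ^ csize \<mu> * lookup (f + g) \<mu>" if "csize \<mu> = d" for \<mu>
  proof -
    have "lookup f \<mu> = 0" using f(3) that by (auto simp: small_def in_keys_iff)
    then show ?thesis
      using that by (simp add: lookup_add lg mult.assoc [symmetric] power_add [symmetric] mult_2 [symmetric])
  qed
  moreover have "f + g \<in> polys_in {1..n}" using f g by (intro polys_in_add)
  ultimately show ?case by auto
qed

lemma left_eigen_determines:
  assumes "f \<in> polys_in {1..n}" "\<And>\<gamma>. \<gamma> \<in> comps n \<Longrightarrow> left_eigen n \<gamma> f = 0"
  shows "f = 0"
  using assms(2) by (intro left_eigen_separates[OF n assms(1), of "Max (csize ` keys f)"]) auto

text \<open>The difference \<open>h\<close> corresponds to 0. By surjectivity it also corresponds to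
  some \<open>f\<close> with the same top coefficients up to sign; all functionals vanish on
  \<open>f\<close>, so \<open>f = 0\<close>, against the choice of a top monomial of
  \<open>h\<close>.\<close>

lemma transfers_unique:
  assumes "p \<in> polys_in {1..n}" "q \<in> polys_in {1..n}" "transfers n p f" "transfers n q f"
  shows "p = q"
proof (rule ccontr)
  assume "p \<noteq> q"
  define h where "h = p - q"
  have h: "h \<in> polys_in {1..n}" "transfers n h 0" "h \<noteq> 0"
    using assms \<open>p \<noteq> q\<close> transfers_diff[OF assms(3,4)] by (auto simp: h_def intro: polys_in_diff)
  define d where "d = Max (csize ` keys h)"
  have "d \<in> csize ` keys h" unfolding d_def using h(3) by (intro Max_in) auto
  then obtain m where m: "m \<in> keys h" "csize m = d" by auto
  have "small (Suc d) h" unfolding small_def d_def by (auto simp: less_Suc_eq_le)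
  then obtain f where f: "f \<in> polys_in {1..n}" "transfers n h f"
    "\<forall>\<mu>. Suc (csize \<mu>) = Suc d \<longrightarrow> lookup h \<mu> = (- 1) ^ csize \<mu> * lookup f \<mu>"
    using transfers_surj[OF h(1)] by blast
  have "f = 0"
    by (rule left_eigen_determines[OF f(1)]) (use h(2) f(2) in \<open>metis transfers_def left_eigen_0\<close>)
  then show False using f(3) m by (auto simp: in_keys_iff)
qed

text \<open>Both sides correspond to \<open>xvar k * f\<close>. After the sign change of the
  variables this is the product rule for \<open>Xi\<close>, the source of the recursion.\<close>

lemma transfer_xvar_mult:
  assumes "f \<in> polys_in {1..n}" "k \<in> {1..n}"
  shows "transfer n (xvar k * f) = transfer n (cherednik n k f) - xvar k * transfer n f"
proof (rule transfers_unique)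
  show "transfer n (xvar k * f) \<in> polys_in {1..n}"
    using assms by (intro transfer_polys_in polys_in_mult polys_in_xvar)
  show "transfer n (cherednik n k f) - xvar k * transfer n f \<in> polys_in {1..n}"
    using assms by (intro polys_in_diff polys_in_mult polys_in_xvar transfer_polys_in cherednik_polys_in)
  show "transfers n (transfer n (xvar k * f)) (xvar k * f)"
    using assms by (intro transfer_transfers polys_in_mult polys_in_xvar)
  show "transfers n (transfer n (cherednik n k f) - xvar k * transfer n f) (xvar k * f)"
    using assms by (intro transfers_xvar_mult[OF n] transfer_transfers cherednik_polys_in)
qed

text \<open>The value is a factor of \<open>left_eigen n \<gamma> (jack n \<gamma>)\<close>, which
  is 1. It can therefore be cancelled to turn functional identities into values at interpolation
  points.\<close>

lemma left_eigen_1_nonzero: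
  assumes "\<gamma> \<in> comps n"
  shows "left_eigen n \<gamma> 1 \<noteq> 0"
  using transfer_transfers[OF jack_polys_in[OF n assms]] assms left_eigen_jack[OF n assms assms]
  by (auto simp: transfers_def)

lemma peval_transfer_jack:
  assumes "\<gamma> \<in> comps n" "\<eta> \<in> comps n" "csize \<gamma> \<le> csize \<eta>" "\<gamma> \<noteq> \<eta>"
  shows "peval (transfer n (jack n \<eta>)) (spec n \<gamma>) = 0"
  using transfer_transfers[OF jack_polys_in[OF n assms(2)]] left_eigen_jack[OF n assms(1-3)] left_eigen_1_nonzero[OF assms(1)]
    assms(1,4) by (auto simp: transfers_def)

text \<open>Pulled back to \<open>f\<close>, the vanishing conditions kill every functional of
  degree at most |\<eta>| except the one of index \<eta>, so \<open>f\<close> is a multiple of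
  \<open>jack n \<eta>\<close>. The coefficient 1 of \<open>p\<close> at \<eta> then forces the
  scalar to be the sign.\<close>

lemma interpolation_unique:
  assumes \<eta>: "\<eta> \<in> comps n" and p: "p \<in> polys_in {1..n}" "small (Suc (csize \<eta>)) p" "lookup p \<eta> = 1"
    and vanish: "\<And>\<gamma>. \<gamma> \<in> comps n \<Longrightarrow> \<gamma> \<noteq> \<eta> \<Longrightarrow> csize \<gamma> \<le> csize \<eta> \<Longrightarrow> peval p (spec n \<gamma>) = 0"
  shows "p = Const ((- 1) ^ csize \<eta>) * transfer n (jack n \<eta>)"
proof -
  obtain f where f: "f \<in> polys_in {1..n}" "transfers n p f" "small (Suc (csize \<eta>)) f"
    and "lookup p \<eta> = (- 1) ^ csize \<eta> * lookup f \<eta>"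
    using transfers_surj[OF p(1,2)] by blast
  then have fe: "(- 1) ^ csize \<eta> * lookup f \<eta> = 1" using p(3) by simp
  let ?c = "left_eigen n \<eta> f"
  have J: "Const ?c * jack n \<eta> \<in> polys_in {1..n}"
    using jack_polys_in[OF n \<eta>] by (intro polys_in_mult polys_in_Const)
  have "f - Const ?c * jack n \<eta> = 0"
  proof (rule left_eigen_separates[OF n, of _ "csize \<eta>"])
    show "f - Const ?c * jack n \<eta> \<in> polys_in {1..n}"
      using f J by (intro polys_in_diff)
    have "small (Suc (csize \<eta>)) (Const ?c * jack n \<eta>)"
      using jack_homog[OF n \<eta>] by (intro small_Const_mult) (simp add: small_def homog_def)
    then have "small (Suc (csize \<eta>)) (f - Const ?c * jack n \<eta>)"
      using f(3) by (intro small_diff)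
    then show "csize m \<le> csize \<eta>" if "m \<in> keys (f - Const ?c * jack n \<eta>)" for m
      using that by (simp add: small_def less_Suc_eq_le)
    fix \<gamma> assume \<gamma>: "\<gamma> \<in> comps n" "csize \<gamma> \<le> csize \<eta>"
    show "left_eigen n \<gamma> (f - Const ?c * jack n \<eta>) = 0"
    proof (cases "\<gamma> = \<eta>")
      case True
      then show ?thesis using left_eigen_jack[OF n \<eta> \<eta>] by (simp add: left_eigen_diff left_eigen_Const_mult)
    next
      case False
      then have "left_eigen n \<gamma> f = 0"
        using f(2) vanish[OF \<gamma>(1) False \<gamma>(2)] \<gamma>(1) by (simp add: transfers_def) (metis mult_zero_left)
      then show ?thesis using left_eigen_jack[OF n \<gamma>(1) \<eta> \<gamma>(2)] False by (simp add: left_eigen_diff left_eigen_Const_mult)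
    qed
  qed
  then have feq: "f = Const ?c * jack n \<eta>" by simp
  then have "lookup f \<eta> = ?c" using jack(2)[OF n \<eta>] by (metis lookup_Const_mult mult.right_neutral)
  then have "(- 1) ^ csize \<eta> * ?c = 1" using fe by simp
  then have "?c = (- 1) ^ csize \<eta>"
    by (metis (no_types, lifting) left_minus_one_mult_self mult.right_neutral)
  then have "p = transfer n (Const ((- 1) ^ csize \<eta>) * jack n \<eta>)"
    using feq f J p(1) by (intro transfers_unique[OF p(1) transfer_polys_in f(2)]) (auto intro: transfer_transfers)
  then show ?thesis by (simp add: transfer_Const_mult)
qed

lemma lookup_transfer_jack:
  assumes "\<eta> \<in> comps n"
  shows "small (Suc (csize \<eta>)) (transfer n (jack n \<eta>))"
    and "csize m = csize \<eta> \<Longrightarrow> lookup (transfer n (jack n \<eta>)) m = (- 1) ^ csize \<eta> * lookup (jack n \<eta>) m"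
proof -
  have "small (Suc (csize \<eta>)) (jack n \<eta>)"
    using jack_homog[OF n assms] by (simp add: small_def homog_def)
  note * = transfer_top[OF jack_polys_in[OF n assms] this]
  show "small (Suc (csize \<eta>)) (transfer n (jack n \<eta>))" by (rule *(1))
  show "csize m = csize \<eta> \<Longrightarrow> lookup (transfer n (jack n \<eta>)) m = (- 1) ^ csize \<eta> * lookup (jack n \<eta>) m"
    by (rule *(2))
qed

end

section \<open>The interpolation points\<close>

context
  fixes n :: nat and \<gamma> :: "nat \<Rightarrow>\<^sub>0 nat"
begin

text \<open>The stable decreasing order of the indices: \<open>j\<close> is placed after
  \<open>k\<close>.\<close>

definition after :: "nat \<Rightarrow> nat \<Rightarrow> bool" where
  "after k j \<longleftrightarrow> lookup \<gamma> j < lookup \<gamma> k \<or> lookup \<gamma> j = lookup \<gamma> k \<and> k < j"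

definition ascents :: "(nat \<times> nat) set" where
  "ascents = {(a, b). 1 \<le> a \<and> a < b \<and> b \<le> n \<and> lookup \<gamma> a < lookup \<gamma> b}"

definition inversions :: "(nat \<Rightarrow> nat) \<Rightarrow> (nat \<times> nat) set" where
  "inversions w = {(a, b). 1 \<le> a \<and> a < b \<and> b \<le> n \<and> w b < w a}"

definition sorting :: "(nat \<Rightarrow> nat) \<Rightarrow> bool" where
  "sorting w \<longleftrightarrow> w permutes {1..n} \<and> is_partition n (act (inv w) (lookup \<gamma>))"

lemma finite_inversions: "finite (inversions w)"
  by (rule finite_subset[of _ "{1..n} \<times> {1..n}"]) (auto simp: inversions_def)

text \<open>For a sorting permutation, \<open>inv w a\<close> is the position at which index
  \<open>a\<close> lands. Inversions of the inverse are pairs of indices of \<gamma> and so can be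
  compared with \<open>ascents\<close>.\<close>

lemma perm_length_eq_inverse:
  assumes w: "w permutes {1..n}"
  shows "perm_length n w = card (inversions (inv w))"
proof -
  have wi: "inv w permutes {1..n}" using w by (rule permutes_inv)
  have inv [simp]: "inv w (w i) = i" "w (inv w i) = i" for i
    using permutes_inverses[OF w] by auto
  have m: "w i \<in> {1..n} \<longleftrightarrow> i \<in> {1..n}" "inv w i \<in> {1..n} \<longleftrightarrow> i \<in> {1..n}" for i
    using permutes_in_image[OF w] permutes_in_image[OF wi] by auto
  have "bij_betw (\<lambda>(i, j). (w j, w i)) {(i, j). 1 \<le> i \<and> i < j \<and> j \<le> n \<and> w j < w i} (inversions (inv w))"
  proof (rule bij_betwI[where g = "\<lambda>(a, b). (inv w b, inv w a)"])
    show "(\<lambda>(i, j). (w j, w i)) \<in> {(i, j). 1 \<le> i \<and> i < j \<and> j \<le> n \<and> w j < w i} \<rightarrow> inversions (inv w)"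
    proof clarify
      fix i j assume "1 \<le> i" "i < j" "j \<le> n" "w j < w i"
      then show "(w j, w i) \<in> inversions (inv w)"
        using m(1)[of i] m(1)[of j] by (auto simp: inversions_def)
    qed
    show "(\<lambda>(a, b). (inv w b, inv w a)) \<in> inversions (inv w) \<rightarrow> {(i, j). 1 \<le> i \<and> i < j \<and> j \<le> n \<and> w j < w i}"
    proof clarify
      fix a b assume "(a, b) \<in> inversions (inv w)"
      then show "1 \<le> inv w b \<and> inv w b < inv w a \<and> inv w a \<le> n \<and> w (inv w a) < w (inv w b)"
        using m(2)[of a] m(2)[of b] by (auto simp: inversions_def)
    qed
  qed auto
  then show ?thesis unfolding perm_length_def by (rule bij_betw_same_card)
qed

lemma sorting_iff:
  assumes "w permutes {1..n}"
  shows "sorting w \<longleftrightarrow> (\<forall>i j. 1 \<le> i \<and> i \<le> j \<and> j \<le> n \<longrightarrow> lookup \<gamma> (w j) \<le> lookup \<gamma> (w i))"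
  using assms by (simp add: sorting_def is_partition_def act_def permutes_inv_inv)

text \<open>A larger entry standing to the right has to overtake the smaller one; this bounds the
  length from below.\<close>

lemma ascents_subset:
  assumes "sorting w"
  shows "ascents \<subseteq> inversions (inv w)"
proof clarify
  fix a b assume ab: "(a, b) \<in> ascents"
  have w: "w permutes {1..n}" using assms by (simp add: sorting_def)
  have inv [simp]: "w (inv w i) = i" for i
    using permutes_inverses[OF w] by auto
  have m: "inv w i \<in> {1..n} \<longleftrightarrow> i \<in> {1..n}" for i
    using permutes_in_image[OF permutes_inv[OF w]] by auto
  have "\<not> inv w a \<le> inv w b"
  proof
    assume "inv w a \<le> inv w b"
    moreover have "\<forall>i j. 1 \<le> i \<and> i \<le> j \<and> j \<le> n \<longrightarrow> lookup \<gamma> (w j) \<le> lookup \<gamma> (w i)"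
      using assms sorting_iff[OF w] by blast
    moreover have "1 \<le> inv w a" "inv w b \<le> n"
      using ab m[of a] m[of b] by (auto simp: ascents_def)
    ultimately have "lookup \<gamma> (w (inv w b)) \<le> lookup \<gamma> (w (inv w a))"
      by blast
    then show False using ab by (simp add: ascents_def)
  qed
  then show "(a, b) \<in> inversions (inv w)"
    using ab by (auto simp: ascents_def inversions_def)
qed

lemma below_count_after:
  "k \<in> {1..n} \<Longrightarrow> below_count n \<gamma> k = card {j \<in> {1..n}. after k j}"
  by (subst below_count_alt) (auto simp: after_def intro!: arg_cong[where f = card])

lemma below_count_less:
  assumes "k \<in> {1..n}" "j \<in> {1..n}" "after k j"
  shows "below_count n \<gamma> j < below_count n \<gamma> k"
proof -
  have "{i \<in> {1..n}. after j i} \<subset> {i \<in> {1..n}. after k i}"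
    using assms by (auto simp: after_def)
  then show ?thesis
    using assms by (simp only: below_count_after) (intro psubset_card_mono; simp)
qed

lemma after_total: "k \<noteq> j \<Longrightarrow> after k j \<or> after j k"
  by (auto simp: after_def)

text \<open>With only the forced inversions, \<open>inv w\<close> is monotone for
  \<open>after\<close>, so the indices after \<open>i\<close> fill exactly the positions beyond
  \<open>inv w i\<close>.\<close>

lemma inverse_minimal:
  assumes w: "w permutes {1..n}" and inv: "inversions (inv w) = ascents" and i: "i \<in> {1..n}"
  shows "n - inv w i = below_count n \<gamma> i"
proof -
  have wi: "inv w permutes {1..n}" using w by (rule permutes_inv)
  have inj: "inv w j = inv w k \<longleftrightarrow> j = k" for j k
    using permutes_inj[OF wi] by (simp add: inj_eq)
  have iff: "after i j \<longleftrightarrow> inv w i < inv w j" if j: "j \<in> {1..n}" for j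
  proof -
    consider "i = j" | "i < j" | "j < i" by linarith
    then show ?thesis
    proof cases
      case 2
      then have "inv w j < inv w i \<longleftrightarrow> lookup \<gamma> i < lookup \<gamma> j"
        using inv i j by (auto simp: inversions_def ascents_def set_eq_iff)
      with 2 show ?thesis using inj[of i j] by (auto simp: after_def)
    next
      case 3
      then have "inv w i < inv w j \<longleftrightarrow> lookup \<gamma> j < lookup \<gamma> i"
        using inv i j by (auto simp: inversions_def ascents_def set_eq_iff)
      with 3 show ?thesis by (auto simp: after_def)
    qed (simp add: after_def)
  qed
  have "inv w ` {j \<in> {1..n}. after i j} = {inv w i<..n}"
  proof -
    have "inv w ` {j \<in> {1..n}. after i j} = {k \<in> inv w ` {1..n}. inv w i < k}"
      using iff by auto
    also have "\<dots> = {inv w i<..n}"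
      unfolding permutes_image[OF wi] by auto
    finally show ?thesis .
  qed
  moreover have "card (inv w ` {j \<in> {1..n}. after i j}) = card {j \<in> {1..n}. after i j}"
    by (rule card_image) (rule inj_on_subset[OF permutes_inj[OF wi] subset_UNIV])
  ultimately have "card {inv w i<..n} = card {j \<in> {1..n}. after i j}"
    by simp
  then show ?thesis by (simp add: below_count_after[OF i])
qed

lemma minimal_sorting_exists: "\<exists>w. sorting w \<and> inversions (inv w) = ascents"
proof -
  \<comment> \<open>The position forced by \<open>inverse_minimal\<close>; the sorting permutation
    is its inverse.\<close>
  define p where "p i = (if i \<in> {1..n} then n - below_count n \<gamma> i else i)" for i
  have lt: "below_count n \<gamma> i < n" if "i \<in> {1..n}" for i
  proof -
    have "card {j \<in> {1..n}. after i j} \<le> card ({1..n} - {i})"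
      by (rule card_mono) (auto simp: after_def)
    also have "\<dots> < n" using that by auto
    finally show ?thesis by (simp only: below_count_after[OF that])
  qed
  have less: "p i < p j \<longleftrightarrow> after i j" if "i \<in> {1..n}" "j \<in> {1..n}" for i j
  proof (cases "i = j")
    case False
    then consider "after i j" "\<not> after j i" | "after j i" "\<not> after i j"
      using after_total[OF False] by (auto simp: after_def)
    then show ?thesis
      using below_count_less[of i j] below_count_less[of j i] lt[of i] lt[of j] that
      by cases (auto simp: p_def)
  qed (simp add: after_def)
  have inj: "inj_on p {1..n}"
    using less after_total by (intro inj_onI) (metis less_irrefl)
  have "p ` {1..n} \<subseteq> {1..n}"
    using lt by (force simp: p_def)
  then have "bij_betw p {1..n} {1..n}"
    using inj by (simp add: bij_betw_def endo_inj_surj)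
  then have p: "p permutes {1..n}"
    by (rule bij_imp_permutes) (simp only: p_def if_False)
  define w where "w = inv p"
  have w: "w permutes {1..n}" using p by (simp add: w_def permutes_inv)
  have wp: "inv w = p" using p by (simp add: w_def permutes_inv_inv)
  have pw: "p (w i) = i" for i using permutes_inverses[OF p] by (simp add: w_def)
  have "lookup \<gamma> (w j) \<le> lookup \<gamma> (w i)" if "1 \<le> i" "i \<le> j" "j \<le> n" for i j
  proof (cases "i = j")
    case False
    then have "p (w i) < p (w j)" using that by (simp add: pw)
    moreover have "w i \<in> {1..n}" "w j \<in> {1..n}"
      using that by (simp_all only: permutes_in_image[OF w]) auto
    ultimately have "after (w i) (w j)" using less by blast
    then show ?thesis by (auto simp: after_def)
  qed simp
  then have "sorting w" by (simp add: sorting_iff[OF w])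
  moreover have "inversions (inv w) = ascents"
    using less by (auto simp: wp inversions_def ascents_def after_def)
  ultimately show ?thesis by blast
qed

text \<open>The forced inversions are attained by some sorting permutation, so the shortest ones are
  those without further inversions. Their positions are determined by \<open>below_count\<close>,
  which makes the description in \<open>sort_perm\<close> well defined.\<close>

lemma sort_perm_inverse:
  assumes i: "i \<in> {1..n}"
  shows "n - inv (sort_perm n \<gamma>) i = below_count n \<gamma> i"
proof -
  obtain w where w: "sorting w" "inversions (inv w) = ascents"
    using minimal_sorting_exists by blast
  have len: "sorting v \<Longrightarrow> perm_length n v = card (inversions (inv v))" for v
    using perm_length_eq_inverse by (simp add: sorting_def)
  have min: "is_arg_min (perm_length n) sorting v \<longleftrightarrow> sorting v \<and> inversions (inv v) = ascents" for v
  proof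
    assume v: "is_arg_min (perm_length n) sorting v"
    then have "sorting v" "\<not> perm_length n w < perm_length n v"
      using w by (auto simp: is_arg_min_def)
    then have "card (inversions (inv v)) \<le> card ascents"
      using len w by simp
    then have "ascents = inversions (inv v)"
      using ascents_subset[OF \<open>sorting v\<close>] finite_inversions by (intro card_seteq) auto
    then show "sorting v \<and> inversions (inv v) = ascents" using \<open>sorting v\<close> by simp
  next
    assume v: "sorting v \<and> inversions (inv v) = ascents"
    have "\<not> perm_length n u < perm_length n v" if "sorting u" for u
      using card_mono[OF finite_inversions ascents_subset[OF that]] len[OF that] len[of v] v by simp
    then show "is_arg_min (perm_length n) sorting v"
      using v by (auto simp: is_arg_min_def)
  qed
  have uniq: "v = w" if "sorting v" "inversions (inv v) = ascents" for v
  proof -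
    have vp: "v permutes {1..n}" and wp: "w permutes {1..n}"
      using that w by (auto simp: sorting_def)
    have "inv v j = inv w j" for j
    proof (cases "j \<in> {1..n}")
      case True
      then have "n - inv v j = n - inv w j"
        using inverse_minimal[OF vp that(2)] inverse_minimal[OF wp w(2)] by simp
      \<comment> \<open>Truncated subtraction from \<open>n\<close> is injective on
        \<open>{1..n}\<close>.\<close>
      moreover have "inv v j \<in> {1..n}" "inv w j \<in> {1..n}"
        using True by (simp_all only: permutes_in_image[OF permutes_inv[OF vp]] permutes_in_image[OF permutes_inv[OF wp]])
      ultimately show ?thesis by auto
    next
      case False
      then show ?thesis using permutes_inv[OF vp] permutes_inv[OF wp] by (simp add: permutes_def)
    qed
    then have "inv v = inv w" by (rule ext)
    then have "inv (inv v) = inv (inv w)" by simp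
    then show ?thesis by (simp only: permutes_inv_inv[OF vp] permutes_inv_inv[OF wp])
  qed
  have "sort_perm n \<gamma> = (THE w. is_arg_min (perm_length n) sorting w)"
    unfolding sort_perm_def sorting_def ..
  also have "\<dots> = w"
  proof (rule the_equality)
    show "is_arg_min (perm_length n) sorting w" using w by (simp only: min)
    show "v = w" if "is_arg_min (perm_length n) sorting v" for v
      using that uniq by (simp only: min)
  qed
  finally show ?thesis
    using inverse_minimal[OF _ w(2) i] w(1) by (simp add: sorting_def)
qed

lemma cbar_eq_spec: "i \<in> {1..n} \<Longrightarrow> cbar n \<gamma> i = spec n \<gamma> i"
  by (simp only: cbar_def act_def sort_perm_inverse spec_def)

end

lemma peval_cong:
  assumes "p \<in> polys_in I" "\<And>i. i \<in> I \<Longrightarrow> v i = v' i"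
  shows "peval p v = peval p v'"
  unfolding peval_def using assms
  by (intro sum.cong refl arg_cong2[where f = "(*)"] prod.cong) (auto simp: polys_in_def subset_iff)

lemma peval_cbar: "p \<in> polys_in {1..n} \<Longrightarrow> peval p (cbar n \<gamma>) = peval p (spec n \<gamma>)"
  by (rule peval_cong) (auto simp: cbar_eq_spec)

section \<open>The operator Xi\<close>

text \<open>All factors are positive since \<open>rr\<close> is; \<open>Xi_eq\<close> divides by
  this product.\<close>

lemma dfac_nonzero: "dfac n \<eta> \<noteq> 0"
proof -
  have "alpha > 0" using rr_pos by (simp add: alpha_def)
  then have "alpha * (of_nat a + 1) + of_nat b + 1 > 0" for a b
    by (intro add_nonneg_pos add_nonneg_nonneg mult_nonneg_nonneg) auto
  then have "dfac n \<eta> > 0"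
    unfolding dfac_def by (intro prod_pos) auto
  then show ?thesis by simp
qed

lemma total_deg_eq:
  assumes "small (Suc d) p" "m \<in> keys p" "csize m = d"
  shows "total_deg p = d"
  unfolding total_deg_def using assms
  by (intro Max_eqI) (auto simp: small_def less_Suc_eq_le)

lemma small_total_deg: "small (Suc (total_deg p)) p"
  by (auto simp: small_def total_deg_def less_Suc_eq_le)

lemma lookup_top_component:
  "lookup (top_component p) m = (if csize m = total_deg p then lookup p m else 0)"
  by (auto simp: top_component_def lookup_sum lookup_single when_def in_keys_iff)

definition neg_vars :: "mpol \<Rightarrow> mpol" where
  "neg_vars p = psubst p (\<lambda>i. - xvar i)"

lemma neg_vars_add: "neg_vars (p + q) = neg_vars p + neg_vars q"
  and neg_vars_diff: "neg_vars (p - q) = neg_vars p - neg_vars q"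
  and neg_vars_Const_mult: "neg_vars (Const c * p) = Const c * neg_vars p"
  and neg_vars_xvar_mult: "neg_vars (xvar i * p) = - (xvar i * neg_vars p)"
  and neg_vars_sum: "neg_vars (sum g A) = (\<Sum>x\<in>A. neg_vars (g x))"
  and neg_vars_Const: "neg_vars (Const c) = Const c"
  by (simp_all add: neg_vars_def psubst_eq_subst psubst.subst_add psubst.subst_diff
      psubst.subst_Const_mult psubst.subst_xvar_mult psubst.subst_sum)

lemma neg_vars_polys_in: "p \<in> polys_in I \<Longrightarrow> neg_vars p \<in> polys_in I"
proof (induction rule: polys_in_induct)
  case (xvar i f)
  then have "Const (- 1) * (xvar i * neg_vars f) \<in> polys_in I"
    by (intro polys_in_mult polys_in_Const polys_in_xvar)
  then show ?case by (simp add: neg_vars_xvar_mult Const_uminus)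
qed (auto simp: neg_vars_add neg_vars_Const intro: polys_in_add)

lemma transfer_sum: "transfer n (sum g A) = (\<Sum>x\<in>A. transfer n (g x))"
  by (induction A rule: infinite_finite_induct) (simp_all add: transfer_add, simp_all add: transfer_def)

context
  fixes n :: nat
  assumes n: "1 \<le> n"
begin

text \<open>The sign compensates the one that \<open>transfer\<close> gives to leading coefficients.
  The points \<open>cbar\<close> and \<open>spec\<close> agree on \<open>{1..n}\<close>, where all
  variables of the polynomials lie.\<close>

lemma E_inhom_eq:
  assumes \<eta>: "\<eta> \<in> comps n"
  shows "E_inhom n \<eta> = Const ((- 1) ^ csize \<eta>) * transfer n (jack n \<eta>)"
  unfolding E_inhom_def
proof (rule the_equality)
  let ?p = "Const ((- 1) ^ csize \<eta>) * transfer n (jack n \<eta>)"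
  have mem: "?p \<in> polys_in {1..n}"
    using \<eta> by (intro polys_in_mult polys_in_Const transfer_polys_in[OF n] jack_polys_in[OF n])
  have one: "lookup ?p \<eta> = 1"
    using lookup_transfer_jack(2)[OF n \<eta> refl] jack(2)[OF n \<eta>]
    by (simp add: power_add [symmetric] mult_2 [symmetric])
  have "total_deg ?p = csize \<eta>"
    using lookup_transfer_jack(1)[OF n \<eta>] one
    by (intro total_deg_eq[of _ _ \<eta>] small_Const_mult) (auto simp: in_keys_iff)
  moreover have "peval ?p (cbar n \<gamma>) = 0" if "\<gamma> \<in> comps n" "\<gamma> \<noteq> \<eta>" "csize \<gamma> \<le> csize \<eta>" for \<gamma>
    unfolding peval_cbar[OF mem] unfolding peval_Const_mult using peval_transfer_jack[OF n that(1) \<eta> that(3,2)] by simp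
  ultimately show "?p \<in> Pol n \<and> total_deg ?p = csize \<eta> \<and>
    (\<forall>\<gamma>\<in>comps n. \<gamma> \<noteq> \<eta> \<and> csize \<gamma> \<le> csize \<eta> \<longrightarrow> peval ?p (cbar n \<gamma>) = 0) \<and> lookup ?p \<eta> = 1"
    using mem one by (simp add: Pol_eq_polys_in)
  fix p
  assume "p \<in> Pol n \<and> total_deg p = csize \<eta> \<and>
    (\<forall>\<gamma>\<in>comps n. \<gamma> \<noteq> \<eta> \<and> csize \<gamma> \<le> csize \<eta> \<longrightarrow> peval p (cbar n \<gamma>) = 0) \<and> lookup p \<eta> = 1"
  then have p: "p \<in> polys_in {1..n}" "total_deg p = csize \<eta>" "lookup p \<eta> = 1"
    and van: "\<And>\<gamma>. \<gamma> \<in> comps n \<Longrightarrow> \<gamma> \<noteq> \<eta> \<Longrightarrow> csize \<gamma> \<le> csize \<eta> \<Longrightarrow> peval p (cbar n \<gamma>) = 0"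
    by (auto simp: Pol_eq_polys_in)
  then show "p = ?p"
    using small_total_deg[of p] van by (intro interpolation_unique[OF n \<eta> p(1)]) (auto simp: peval_cbar[OF p(1)])
qed

lemma E_hom_eq:
  assumes \<eta>: "\<eta> \<in> comps n"
  shows "E_hom n \<eta> = jack n \<eta>"
proof (rule poly_mapping_eqI)
  fix m
  let ?p = "Const ((- 1) ^ csize \<eta>) * transfer n (jack n \<eta>)"
  have *: "csize m = csize \<eta> \<Longrightarrow> lookup ?p m = lookup (jack n \<eta>) m" for m
    using lookup_transfer_jack(2)[OF n \<eta>, of m]
    by (simp add: power_add [symmetric] mult_2 [symmetric] mult.assoc [symmetric])
  have "total_deg ?p = csize \<eta>"
    using lookup_transfer_jack(1)[OF n \<eta>] *[of \<eta>] jack(2)[OF n \<eta>]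
    by (intro total_deg_eq[of _ _ \<eta>] small_Const_mult) (auto simp: in_keys_iff)
  then have "lookup (E_hom n \<eta>) m = (if csize m = csize \<eta> then lookup (jack n \<eta>) m else 0)"
    using *[of m] by (simp add: E_hom_def E_inhom_eq[OF \<eta>] lookup_top_component)
  then show "lookup (E_hom n \<eta>) m = lookup (jack n \<eta>) m"
    using jack_homog[OF n \<eta>] by (auto simp: homog_def in_keys_iff)
qed

text \<open>On \<open>F_hom\<close> the signs from \<open>E_inhom_eq\<close> and
  \<open>F_inhom\<close> cancel and the scalar passes by linearity. Conversely, dividing by
  \<open>dfac\<close> recovers the Jack polynomials, which span \<open>Pol n\<close>; outside
  \<open>Pol n\<close> extensionality fixes the value.\<close>

lemma Xi_eq: "Xi n = restrict (\<lambda>f. neg_vars (transfer n f)) (Pol n)"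
  unfolding Xi_def
proof (rule the_equality)
  let ?T = "restrict (\<lambda>f. neg_vars (transfer n f)) (Pol n)"
  have F_hom: "F_hom n \<eta> = Const (dfac n \<eta>) * jack n \<eta>" if "\<eta> \<in> comps n" for \<eta>
    using that by (simp add: F_hom_def E_hom_eq)
  have F_inhom: "F_inhom n \<eta> = neg_vars (transfer n (F_hom n \<eta>))" if "\<eta> \<in> comps n" for \<eta>
  proof -
    have "F_inhom n \<eta> = Const ((- 1) ^ csize \<eta> * dfac n \<eta>) * neg_vars (Const ((- 1) ^ csize \<eta>) * transfer n (jack n \<eta>))"
      by (simp add: F_inhom_def E_inhom_eq[OF that] neg_vars_def)
    also have "\<dots> = Const (((- 1) ^ csize \<eta> * (- 1) ^ csize \<eta>) * dfac n \<eta>) * neg_vars (transfer n (jack n \<eta>))"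
      by (simp only: neg_vars_Const_mult Const_mult) (simp only: mult_ac)
    also have "\<dots> = neg_vars (transfer n (F_hom n \<eta>))"
      by (simp add: power_add [symmetric] mult_2 [symmetric] F_hom[OF that] transfer_Const_mult neg_vars_Const_mult)
    finally show ?thesis .
  qed
  have memF: "F_hom n \<eta> \<in> Pol n" if "\<eta> \<in> comps n" for \<eta>
    using that by (simp only: F_hom Pol_eq_polys_in) (intro polys_in_mult polys_in_Const jack_polys_in[OF n])
  have "?T \<in> Pol n \<rightarrow>\<^sub>E Pol n"
    by (auto simp: Pol_eq_polys_in intro!: neg_vars_polys_in transfer_polys_in[OF n, simplified])
  then show "linear_op n ?T \<and> (\<forall>\<eta>\<in>comps n. ?T (F_hom n \<eta>) = F_inhom n \<eta>)"
    by (auto simp: linear_op_def Pol_eq_polys_in polys_in_add polys_in_mult transfer_add neg_vars_add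
        transfer_Const_mult neg_vars_Const_mult F_inhom memF[unfolded Pol_eq_polys_in, simplified])
  fix T assume T: "linear_op n T \<and> (\<forall>\<eta>\<in>comps n. T (F_hom n \<eta>) = F_inhom n \<eta>)"
  have Tadd: "T (p + q) = T p + T q" if "p \<in> Pol n" "q \<in> Pol n" for p q
    using T that by (simp add: linear_op_def)
  have Tsc: "T (Const c * p) = Const c * T p" if "p \<in> Pol n" for c p
    using T that by (simp add: linear_op_def)
  have T0: "T 0 = 0"
    using Tsc[of 0 0] by (simp add: Pol_eq_polys_in)
  show "T = ?T"
  proof (rule ext)
    fix f
    show "T f = ?T f"
    proof (cases "f \<in> Pol n")
      case False
      moreover have "T \<in> extensional (Pol n)" using T by (simp add: linear_op_def PiE_def)
      ultimately show ?thesis by (simp add: extensional_def)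
    next
      case True
      have "f \<in> jack_span n"
        using True by (intro polys_in_span[OF n]) (simp add: Pol_eq_polys_in)
      then have "f \<in> Pol n \<and> T f = neg_vars (transfer n f)"
      proof (induction rule: mpol_space.span_induct_alt)
        case base
        show ?case using T0 transfer_Const_mult[of n 0 0] neg_vars_Const[of 0] by (simp add: Pol_eq_polys_in)
      next
        case (step c x y)
        then obtain \<eta> where \<eta>: "\<eta> \<in> comps n" "x = jack n \<eta>" by blast
        have x: "x = Const (1 / dfac n \<eta>) * F_hom n \<eta>"
          using dfac_nonzero[of n \<eta>] \<eta> by (simp add: F_hom mult.assoc [symmetric] Const_mult [symmetric])
        have xm: "x \<in> Pol n"
          using \<eta> jack_polys_in[OF n] by (simp add: Pol_eq_polys_in)
        have "T x = Const (1 / dfac n \<eta>) * F_inhom n \<eta>"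
          using T \<eta> memF by (subst x) (simp add: Tsc)
        also have "\<dots> = neg_vars (transfer n x)"
          by (subst x) (simp only: F_inhom[OF \<eta>(1)] transfer_Const_mult neg_vars_Const_mult)
        finally have Tx: "T x = neg_vars (transfer n x)" .
        have cx: "Const c * x \<in> Pol n"
          using xm unfolding Pol_eq_polys_in by (intro polys_in_mult polys_in_Const)
        have "Const c * x + y \<in> Pol n"
          using cx step unfolding Pol_eq_polys_in by (intro polys_in_add) auto
        then show ?case
          using step Tx xm cx by (simp add: Tadd Tsc transfer_add transfer_Const_mult neg_vars_add neg_vars_Const_mult)
      qed
      with True show ?thesis by simp
    qed
  qed
qed

lemma xfall_eq: "\<eta> \<in> comps n \<Longrightarrow> xfall n \<eta> = neg_vars (transfer n (xmon \<eta>))"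
  by (simp add: xfall_def Xi_eq Pol_def)

section \<open>The recursion\<close>

context
  fixes \<eta> :: "nat \<Rightarrow>\<^sub>0 nat"
  assumes \<eta>: "\<eta> \<in> comps n" and nz: "\<eta> \<noteq> 0"
begin

lemma mpart_ge: "i \<in> {1..n} \<Longrightarrow> lookup \<eta> i \<le> mpart n \<eta>"
  by (simp add: mpart_def)

lemma mpart_pos: "1 \<le> mpart n \<eta>"
proof -
  have "\<exists>i. lookup \<eta> i \<noteq> 0"
  proof (rule ccontr)
    assume "\<nexists>i. lookup \<eta> i \<noteq> 0"
    then have "\<eta> = 0" by (intro poly_mapping_eqI) simp
    then show False using nz by simp
  qed
  then obtain i where i: "lookup \<eta> i \<noteq> 0" by auto
  have "i \<in> {1..n}"
  proof (rule ccontr)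
    assume "i \<notin> {1..n}"
    then show False using comps_lookup_0[OF \<eta>, of i] i by simp
  qed
  then show ?thesis using mpart_ge[of i] i by linarith
qed

lemma kpos: "kpos n \<eta> \<in> {1..n}" "lookup \<eta> (kpos n \<eta>) = mpart n \<eta>"
proof -
  have "mpart n \<eta> \<in> lookup \<eta> ` {1..n}" unfolding mpart_def using n by (intro Max_in) auto
  then have "{i \<in> {1..n}. lookup \<eta> i = mpart n \<eta>} \<noteq> {}" by auto
  then have "kpos n \<eta> \<in> {i \<in> {1..n}. lookup \<eta> i = mpart n \<eta>}"
    unfolding kpos_def by (intro Min_in) auto
  then show "kpos n \<eta> \<in> {1..n}" "lookup \<eta> (kpos n \<eta>) = mpart n \<eta>" by auto
qed

lemma before_kpos:
  assumes "i \<in> {1..n}" "i < kpos n \<eta>"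
  shows "lookup \<eta> i < mpart n \<eta>"
proof (rule ccontr)
  assume "\<not> ?thesis"
  then have "lookup \<eta> i = mpart n \<eta>" using mpart_ge[OF assms(1)] by simp
  then have "kpos n \<eta> \<le> i" unfolding kpos_def using assms by (intro Min_le) auto
  then show False using assms by simp
qed

lemma lookup_star: "lookup (star n \<eta>) i = (if i = kpos n \<eta> then mpart n \<eta> - 1 else lookup \<eta> i)"
  by (simp add: star_def lookup_update)

lemma star_comps: "star n \<eta> \<in> comps n"
  using \<eta> kpos(1) by (auto simp: comps_def in_keys_iff lookup_star subset_iff split: if_splits)

lemma xmon_star: "xmon \<eta> = xvar (kpos n \<eta>) * xmon (star n \<eta>)"
proof -
  have "\<eta> = Poly_Mapping.single (kpos n \<eta>) 1 + star n \<eta>"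
    using mpart_pos kpos(2)
    by (intro poly_mapping_eqI) (auto simp: lookup_add lookup_single when_def lookup_star)
  then show ?thesis by (simp only: xvar_mult_xmon)
qed

text \<open>Left of k all entries are below m, so those not counted in \<open>below_count\<close> of
  \<open>star n \<eta>\<close> equal m - 1; right of k they equal m. Together these are what
  \<open>lnum\<close> counts, so the two counts add up to n - 1.\<close>

lemma wfac_eq: "wfac n \<eta> = xvar (kpos n \<eta>) + Const (spec n (star n \<eta>) (kpos n \<eta>))"
proof -
  let ?k = "kpos n \<eta>" and ?m = "mpart n \<eta>"
  have "{1..<?k} = {j \<in> {1..<?k}. lookup (star n \<eta>) j < ?m - 1} \<union> {i \<in> {1..n}. i < ?k \<and> lookup \<eta> i = ?m - 1}"
    (is "_ = ?A \<union> ?B")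
  proof (intro equalityI subsetI)
    fix j assume "j \<in> {1..<?k}"
    then show "j \<in> ?A \<union> ?B"
      using kpos(1) before_kpos[of j] by (auto simp: lookup_star)
  qed auto
  then have "card {1..<?k} = card (?A \<union> ?B)" by (rule arg_cong)
  moreover have "card (?A \<union> ?B) = card ?A + card ?B"
    by (rule card_Un_disjoint) (auto simp: lookup_star)
  ultimately have 1: "card ?A + card ?B = ?k - 1"
    using card_atLeastLessThan[of 1 ?k] by linarith
  have "{?k<..n} = {j \<in> {?k<..n}. lookup (star n \<eta>) j \<le> ?m - 1} \<union> {i \<in> {1..n}. ?k < i \<and> lookup \<eta> i = ?m}"
    (is "_ = ?C \<union> ?D")
  proof (intro equalityI subsetI)
    fix j assume "j \<in> {?k<..n}"
    then show "j \<in> ?C \<union> ?D"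
      using kpos(1) mpart_ge[of j] mpart_pos by (auto simp: lookup_star)
  qed auto
  then have "card {?k<..n} = card (?C \<union> ?D)" by (rule arg_cong)
  moreover have "card (?C \<union> ?D) = card ?C + card ?D"
    using mpart_pos by (intro card_Un_disjoint) (auto simp: lookup_star)
  ultimately have 2: "card ?C + card ?D = n - ?k"
    using card_greaterThanAtMost[of ?k n] by linarith
  have "below_count n (star n \<eta>) ?k = card ?A + card ?C"
    by (simp add: below_count_def lookup_star)
  moreover have "lnum n \<eta> = card ?D + card ?B"
    by (simp only: lnum_def)
  moreover have "1 \<le> ?k" "?k \<le> n" using kpos(1) by auto
  ultimately have "below_count n (star n \<eta>) ?k + lnum n \<eta> + 1 = n"
    using 1 2 by linarith
  then have "(of_nat n :: ratfun) = of_nat (below_count n (star n \<eta>) ?k + lnum n \<eta> + 1)" by simp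
  moreover have "(of_nat ?m :: ratfun) = of_nat (?m - 1) + 1"
    using mpart_pos by (metis of_nat_1 of_nat_add le_add_diff_inverse2)
  ultimately show ?thesis
    by (simp add: wfac_def spec_def lookup_star)
qed

text \<open>The range of \<open>l\<close> encodes \<epsilon> > 0 for \<open>j < k\<close> and
  \<epsilon> \<ge> 0 for \<open>j > k\<close>. If \<eta>_j = m, the truncated difference is 0 and
  the range is empty.\<close>

definition pairs :: "(nat \<times> nat) set" where
  "pairs = (SIGMA j:{1..n} - {kpos n \<eta>}. {1..<mpart n \<eta> - 1 - lookup \<eta> j + (if kpos n \<eta> < j then 1 else 0)})"

definition moved :: "nat \<times> nat \<Rightarrow> (nat \<Rightarrow>\<^sub>0 nat)" where
  "moved = (\<lambda>(j, l). move (star n \<eta>) (kpos n \<eta>) j (mpart n \<eta> - 1 - l) (lookup \<eta> j + l))"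

lemma moved_inj: "inj_on moved pairs"
proof (rule inj_onI, clarify)
  fix j l j' l'
  assume *: "(j, l) \<in> pairs" "(j', l') \<in> pairs" and eq: "moved (j, l) = moved (j', l')"
  then have eq': "lookup (moved (j, l)) i = lookup (moved (j', l')) i" for i by simp
  show "j = j' \<and> l = l'"
    \<comment> \<open>Away from k, position \<open>j\<close> is the only one at which the value
      differs from \<eta>, and it exceeds \<eta>_j by \<open>l\<close>.\<close>
    using * eq'[of j] by (cases "j = j'") (auto simp: moved_def lookup_move pairs_def lookup_star split: if_splits)
qed

lemma moved_image: "moved ` pairs = Pset n \<eta>"
proof (intro equalityI subsetI)
  fix \<gamma> assume "\<gamma> \<in> moved ` pairs"
  then obtain j l where jl: "(j, l) \<in> pairs" and \<gamma>: "\<gamma> = moved (j, l)" by auto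
  let ?k = "kpos n \<eta>"
  have j: "j \<in> {1..n}" "j \<noteq> ?k" and l: "1 \<le> l" "l < mpart n \<eta> - 1 - lookup \<eta> j + (if ?k < j then 1 else 0)"
    using jl by (auto simp: pairs_def)
  have lk: "lookup \<gamma> i = (if i = j then lookup \<eta> j + l else if i = ?k then mpart n \<eta> - 1 - l else lookup \<eta> i)" for i
    by (simp add: \<gamma> moved_def lookup_move lookup_star)
  have "\<gamma> \<in> comps n"
    using star_comps kpos(1) j by (simp add: \<gamma> moved_def move_comps)
  moreover have "\<gamma> \<noteq> star n \<eta>"
    using lk[of j] j l by (auto simp: lookup_star)
  moreover have le: "lookup \<eta> j + l \<le> mpart n \<eta> - 1" "j < ?k \<longrightarrow> lookup \<eta> j + l < mpart n \<eta> - 1"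
    using l j by (auto split: if_splits)
  ultimately show "\<gamma> \<in> Pset n \<eta>"
    using j l mpart_pos unfolding Pset_def
    by (auto simp: lk Let_def intro!: bexI[of _ j] exI[of _ "int l"])
next
  fix \<gamma> assume "\<gamma> \<in> Pset n \<eta>"
  then obtain j and l :: int where \<gamma>: "\<gamma> \<in> comps n" and j: "j \<in> {1..n}" "j \<noteq> kpos n \<eta>" and l: "l > 0"
    and vals: "int (lookup \<gamma> j) = int (lookup \<eta> j) + l"
      "int (lookup \<gamma> (kpos n \<eta>)) = int (mpart n \<eta>) - 1 - l"
      "\<forall>i\<in>{1..n}. i \<noteq> j \<and> i \<noteq> kpos n \<eta> \<longrightarrow> lookup \<gamma> i = lookup \<eta> i"
    and e: "j < kpos n \<eta> \<Longrightarrow> int (mpart n \<eta>) - 1 - int (lookup \<eta> j) - l > 0"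
      "kpos n \<eta> < j \<Longrightarrow> int (mpart n \<eta>) - 1 - int (lookup \<eta> j) - l \<ge> 0"
    unfolding Pset_def Let_def by blast
  have "(j, nat l) \<in> pairs"
    using j l e by (cases "j < kpos n \<eta>") (auto simp: pairs_def)
  moreover have "\<gamma> = moved (j, nat l)"
  proof (rule poly_mapping_eqI)
    fix i
    show "lookup \<gamma> i = lookup (moved (j, nat l)) i"
    proof (cases "i \<in> {1..n}")
      case True
      then show ?thesis using vals l j by (auto simp: moved_def lookup_move lookup_star)
    next
      case False
      then have "lookup \<gamma> i = 0" "lookup \<eta> i = 0" "i \<noteq> j" "i \<noteq> kpos n \<eta>"
        using comps_lookup_0[OF \<gamma>] comps_lookup_0[OF \<eta>] j kpos(1) by blast+
      then show ?thesis by (simp add: moved_def lookup_move lookup_star)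
    qed
  qed
  ultimately show "\<gamma> \<in> moved ` pairs" by blast
qed

text \<open>At k the exponent of \<open>star n \<eta>\<close> is m - 1, so the negative branch of
  \<open>cherednik_rest\<close> could arise only from an entry m elsewhere, and there it is empty.
  The remaining terms are exactly the moves parametrised by \<open>pairs\<close>.\<close>

lemma cherednik_star:
  "cherednik n (kpos n \<eta>) (xmon (star n \<eta>))
    = Const (spec n (star n \<eta>) (kpos n \<eta>)) * xmon (star n \<eta>) + Const rr * (\<Sum>\<gamma>\<in>Pset n \<eta>. xmon \<gamma>)"
proof -
  let ?k = "kpos n \<eta>" and ?\<mu> = "star n \<eta>"
  have "cherednik_rest ?\<mu> ?k j = (\<Sum>l\<in>{1..<mpart n \<eta> - 1 - lookup \<eta> j + (if ?k < j then 1 else 0)}. xmon (moved (j, l)))"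
    if j: "j \<in> {1..n} - {?k}" for j
  proof (cases "lookup \<eta> j \<le> mpart n \<eta> - 1")
    case True
    with j show ?thesis by (simp add: cherednik_rest_def Let_def lookup_star moved_def)
  next
    case False
    \<comment> \<open>Position k is the first maximum, so \<open>k < j\<close>; then
      \<open>cherednik_rest\<close> sums from 1 up to but excluding 1, and the right-hand range is
      empty as well.\<close>
    then have "lookup \<eta> j = mpart n \<eta>" using mpart_ge[of j] j by simp
    moreover have "\<not> j < ?k" using before_kpos[of j] j calculation by auto
    then have "?k < j" using j by auto
    ultimately show ?thesis using j mpart_pos by (simp add: cherednik_rest_def Let_def lookup_star)
  qed
  then have "(\<Sum>j\<in>{1..n} - {?k}. cherednik_rest ?\<mu> ?k j)
      = (\<Sum>j\<in>{1..n} - {?k}. \<Sum>l\<in>{1..<mpart n \<eta> - 1 - lookup \<eta> j + (if ?k < j then 1 else 0)}. xmon (moved (j, l)))"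
    by (rule sum.cong[OF refl])
  also have "\<dots> = (\<Sum>x\<in>pairs. xmon (moved x))"
    unfolding pairs_def by (subst sum.Sigma) (auto intro: sum.cong)
  also have "\<dots> = (\<Sum>\<gamma>\<in>Pset n \<eta>. xmon \<gamma>)"
    unfolding moved_image [symmetric] by (simp add: sum.reindex[OF moved_inj])
  finally show ?thesis by (simp add: cherednik_xmon[OF kpos(1)])
qed

lemma recursion:
  "xfall n \<eta> = wfac n \<eta> * xfall n (star n \<eta>) + Const rr * (\<Sum>\<gamma>\<in>Pset n \<eta>. xfall n \<gamma>)"
proof -
  let ?k = "kpos n \<eta>" and ?\<mu> = "star n \<eta>"
  have mem: "xmon ?\<mu> \<in> polys_in {1..n}"
    using star_comps by (intro polys_in_xmon) (simp add: comps_def)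
  have "transfer n (xmon \<eta>) = transfer n (cherednik n ?k (xmon ?\<mu>)) - xvar ?k * transfer n (xmon ?\<mu>)"
    unfolding xmon_star by (rule transfer_xvar_mult[OF n mem kpos(1)])
  also have "transfer n (cherednik n ?k (xmon ?\<mu>))
      = Const (spec n ?\<mu> ?k) * transfer n (xmon ?\<mu>) + Const rr * (\<Sum>\<gamma>\<in>Pset n \<eta>. transfer n (xmon \<gamma>))"
    by (simp only: cherednik_star transfer_add transfer_Const_mult transfer_sum)
  \<comment> \<open>The sign change of the variables turns the subtracted \<open>xvar ?k\<close>
    into the positive summand of \<open>wfac\<close>.\<close>
  finally have "neg_vars (transfer n (xmon \<eta>)) = (xvar ?k + Const (spec n ?\<mu> ?k)) * neg_vars (transfer n (xmon ?\<mu>))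
      + Const rr * (\<Sum>\<gamma>\<in>Pset n \<eta>. neg_vars (transfer n (xmon \<gamma>)))"
    by (simp add: neg_vars_add neg_vars_diff neg_vars_Const_mult neg_vars_xvar_mult neg_vars_sum distrib_right)
  moreover have "(\<Sum>\<gamma>\<in>Pset n \<eta>. xfall n \<gamma>) = (\<Sum>\<gamma>\<in>Pset n \<eta>. neg_vars (transfer n (xmon \<gamma>)))"
    by (rule sum.cong) (auto simp: Pset_def xfall_eq)
  ultimately show ?thesis
    by (simp add: wfac_eq xfall_eq[OF \<eta>] xfall_eq[OF star_comps])
qed

end

end

theorem theorem4p19:
  fixes n :: nat and \<eta> :: "nat \<Rightarrow>\<^sub>0 nat"
  assumes "n \<ge> 1" and "\<eta> \<in> comps n" and "\<eta> \<noteq> 0"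
  shows "xfall n \<eta> = wfac n \<eta> * xfall n (star n \<eta>) + Const rr * (\<Sum>\<gamma>\<in>Pset n \<eta>. xfall n \<gamma>)"
  using assms by (rule recursion)

end
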